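(* Let $\mathcal{I}$ be a small category. For any functor $X:\mathcal{I}^{op}\to\mathcal{T}c$ such that $X(i)$ is complete for any $i\in\mathcal{I}$, we have $$\mathrm{IB}(\varprojlim_{i\in\mathcal{I}}X(i))\simeq\varprojlim_{i\in\mathcal{I}}\mathrm{IB}(X(i)).$$
   Context: $\mathcal{T}c$ is the category of complex locally convex topological vector spaces (not necessarily Hausdorff) and continuous linear maps; "complete" includes Hausdorff. The projective limit on the left is taken in $\mathcal{T}c$, the one on the right in $\mathrm{Ind}(\mathcal{B}an)$. $\mathcal{B}an$ is the category of complex Banach spaces and continuous linear maps; $\mathrm{Ind}(\mathcal{B}an)$ is its category of ind-objects (formal filtered inductive limits $``\varinjlim"_iE_i$ with $\mathrm{Hom}(``\varinjlim"_iE_i,``\varinjlim"_jF_j)=\varprojlim_i\varinjlim_j\mathrm{Hom}(E_i,F_j)$). For $E$ in $\mathcal{T}c$, $\mathrm{IB}(E)=``\varinjlim"_B\widehat{E}_B$, where $B$ runs over the absolutely convex bounded subsets of $E$ (ordered by inclusion), $E_B$ is the linear hull of $B$ with the gauge semi-norm of $B$, and $\widehat{E}_B$ its completion; a continuous linear map $f:E\to F$ induces $\mathrm{IB}(f)$ via the maps $\widehat{E}_B\to\widehat{F}_{f(B)}$. *)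

theory Defs
  imports "HOL-Analysis.Analysis" "HOL-Algebra.Module"
begin

section \<open>Small categories and functors\<close>

text \<open>
  Categories are given by hom-sets. The hom-sets of different pairs of objects need not be
  disjoint, so composition takes the objects as arguments: for \<open>f\<close> from \<open>a\<close> to \<open>b\<close> and \<open>g\<close> from
  \<open>b\<close> to \<open>c\<close>, the composite of \<open>g\<close> after \<open>f\<close> is \<open>Cmp C a b c g f\<close>.
\<close>

record ('o, 'm) cat =
  Ob :: "'o set"
  Hom :: "'o \<Rightarrow> 'o \<Rightarrow> 'm set"
  Idn :: "'o \<Rightarrow> 'm"
  Cmp :: "'o \<Rightarrow> 'o \<Rightarrow> 'o \<Rightarrow> 'm \<Rightarrow> 'm \<Rightarrow> 'm"

definition category :: "('o, 'm) cat \<Rightarrow> bool" where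
  "category C \<longleftrightarrow>
     (\<forall>a\<in>Ob C. Idn C a \<in> Hom C a a) \<and>
     (\<forall>a\<in>Ob C. \<forall>b\<in>Ob C. \<forall>c\<in>Ob C. \<forall>f\<in>Hom C a b. \<forall>g\<in>Hom C b c. Cmp C a b c g f \<in> Hom C a c) \<and>
     (\<forall>a\<in>Ob C. \<forall>b\<in>Ob C. \<forall>f\<in>Hom C a b. Cmp C a b b (Idn C b) f = f \<and> Cmp C a a b f (Idn C a) = f) \<and>
     (\<forall>a\<in>Ob C. \<forall>b\<in>Ob C. \<forall>c\<in>Ob C. \<forall>d\<in>Ob C. \<forall>f\<in>Hom C a b. \<forall>g\<in>Hom C b c. \<forall>h\<in>Hom C c d.
        Cmp C a b d (Cmp C b c d h g) f = Cmp C a c d h (Cmp C a b c g f))"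

definition op_cat :: "('o, 'm) cat \<Rightarrow> ('o, 'm) cat" where
  "op_cat C = \<lparr>Ob = Ob C, Hom = (\<lambda>a b. Hom C b a), Idn = Idn C,
               Cmp = (\<lambda>a b c g f. Cmp C c b a f g)\<rparr>"

definition filtered :: "('o, 'm) cat \<Rightarrow> bool" where
  "filtered C \<longleftrightarrow> Ob C \<noteq> {} \<and>
     (\<forall>a\<in>Ob C. \<forall>b\<in>Ob C. \<exists>c\<in>Ob C. Hom C a c \<noteq> {} \<and> Hom C b c \<noteq> {}) \<and>
     (\<forall>a\<in>Ob C. \<forall>b\<in>Ob C. \<forall>u\<in>Hom C a b. \<forall>v\<in>Hom C a b.
        \<exists>c\<in>Ob C. \<exists>w\<in>Hom C b c. Cmp C a b c w u = Cmp C a b c w v)"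

record ('o, 'm, 'p, 'n) func =
  fobj :: "'o \<Rightarrow> 'p"
  farr :: "'o \<Rightarrow> 'o \<Rightarrow> 'm \<Rightarrow> 'n"

definition is_functor :: "('o, 'm) cat \<Rightarrow> ('p, 'n) cat \<Rightarrow> ('o, 'm, 'p, 'n) func \<Rightarrow> bool" where
  "is_functor C D F \<longleftrightarrow>
     (\<forall>a\<in>Ob C. fobj F a \<in> Ob D) \<and>
     (\<forall>a\<in>Ob C. \<forall>b\<in>Ob C. \<forall>u\<in>Hom C a b. farr F a b u \<in> Hom D (fobj F a) (fobj F b)) \<and>
     (\<forall>a\<in>Ob C. farr F a a (Idn C a) = Idn D (fobj F a)) \<and>
     (\<forall>a\<in>Ob C. \<forall>b\<in>Ob C. \<forall>c\<in>Ob C. \<forall>u\<in>Hom C a b. \<forall>v\<in>Hom C b c.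
        farr F a c (Cmp C a b c v u) =
        Cmp D (fobj F a) (fobj F b) (fobj F c) (farr F b c v) (farr F a b u))"


section \<open>Complex vector spaces and linear maps\<close>

text \<open>
  Complex vector spaces are modules, in the sense of HOL-Algebra, over the ring of complex
  numbers. The record type of modules carries the two unused fields \<open>mult\<close> and \<open>one\<close>, which are
  irrelevant everywhere below.
\<close>

definition complex_ring :: "complex ring" where
  "complex_ring = \<lparr>carrier = UNIV, monoid.mult = (*), one = 1, zero = 0, add = (+)\<rparr>"

abbreviation complex_vs :: "(complex, 'a, 'z) module_scheme \<Rightarrow> bool" where
  "complex_vs E \<equiv> Module.module complex_ring E"

text \<open>Linear maps are undefined (\<open>extensional\<close>) outside their domain, so that equal maps are
  equal as HOL functions.\<close>

definition lin_hom ::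
  "(complex, 'a, 'y) module_scheme \<Rightarrow> (complex, 'b, 'z) module_scheme \<Rightarrow> ('a \<Rightarrow> 'b) set" where
  "lin_hom E F = {f \<in> carrier E \<rightarrow>\<^sub>E carrier F.
     (\<forall>x\<in>carrier E. \<forall>y\<in>carrier E. f (x \<oplus>\<^bsub>E\<^esub> y) = f x \<oplus>\<^bsub>F\<^esub> f y) \<and>
     (\<forall>c. \<forall>x\<in>carrier E. f (c \<odot>\<^bsub>E\<^esub> x) = c \<odot>\<^bsub>F\<^esub> f x)}"

definition lin_hull :: "(complex, 'a, 'z) module_scheme \<Rightarrow> 'a set \<Rightarrow> 'a set" where
  "lin_hull E B = \<Inter>{S. submodule S complex_ring E \<and> B \<subseteq> S}"

definition convex_in :: "(complex, 'a, 'z) module_scheme \<Rightarrow> 'a set \<Rightarrow> bool" where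
  "convex_in E C \<longleftrightarrow> C \<subseteq> carrier E \<and>
     (\<forall>x\<in>C. \<forall>y\<in>C. \<forall>t\<in>{0..1::real}.
        complex_of_real (1 - t) \<odot>\<^bsub>E\<^esub> x \<oplus>\<^bsub>E\<^esub> complex_of_real t \<odot>\<^bsub>E\<^esub> y \<in> C)"

text \<open>Absolutely convex sets are nonempty, so that they contain zero and their gauge is
  defined.\<close>

definition abs_convex_in :: "(complex, 'a, 'z) module_scheme \<Rightarrow> 'a set \<Rightarrow> bool" where
  "abs_convex_in E B \<longleftrightarrow> B \<subseteq> carrier E \<and> B \<noteq> {} \<and>
     (\<forall>x\<in>B. \<forall>y\<in>B. \<forall>a b :: complex. cmod a + cmod b \<le> 1 \<longrightarrow>
        a \<odot>\<^bsub>E\<^esub> x \<oplus>\<^bsub>E\<^esub> b \<odot>\<^bsub>E\<^esub> y \<in> B)"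

definition gauge_in :: "(complex, 'a, 'z) module_scheme \<Rightarrow> 'a set \<Rightarrow> 'a \<Rightarrow> real" where
  "gauge_in E B x = Inf {r. 0 < r \<and> x \<in> (\<lambda>b. complex_of_real r \<odot>\<^bsub>E\<^esub> b) ` B}"


section \<open>The category of locally convex spaces\<close>

record 'a lctvs = "(complex, 'a) module" +
  topol :: "'a topology"

definition is_lctvs :: "'a lctvs \<Rightarrow> bool" where
  "is_lctvs E \<longleftrightarrow> complex_vs E \<and> topspace (topol E) = carrier E \<and>
     continuous_map (prod_topology (topol E) (topol E)) (topol E) (\<lambda>(x, y). x \<oplus>\<^bsub>E\<^esub> y) \<and>
     continuous_map (prod_topology euclidean (topol E)) (topol E) (\<lambda>(c, x). c \<odot>\<^bsub>E\<^esub> x) \<and>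
     (\<forall>U. openin (topol E) U \<and> \<zero>\<^bsub>E\<^esub> \<in> U \<longrightarrow>
        (\<exists>V C. openin (topol E) V \<and> \<zero>\<^bsub>E\<^esub> \<in> V \<and> V \<subseteq> C \<and> convex_in E C \<and> C \<subseteq> U))"

definition cauchy_filter_in :: "'a lctvs \<Rightarrow> 'a filter \<Rightarrow> bool" where
  "cauchy_filter_in E \<F> \<longleftrightarrow> \<F> \<noteq> bot \<and>
     (\<forall>U. openin (topol E) U \<and> \<zero>\<^bsub>E\<^esub> \<in> U \<longrightarrow>
        (\<exists>A\<subseteq>carrier E. eventually (\<lambda>x. x \<in> A) \<F> \<and> (\<forall>x\<in>A. \<forall>y\<in>A. x \<ominus>\<^bsub>E\<^esub> y \<in> U)))"

definition complete_lctvs :: "'a lctvs \<Rightarrow> bool" where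
  "complete_lctvs E \<longleftrightarrow> Hausdorff_space (topol E) \<and>
     (\<forall>\<F>. cauchy_filter_in E \<F> \<longrightarrow> (\<exists>l. limitin (topol E) (\<lambda>x. x) l \<F>))"

definition bounded_in :: "'a lctvs \<Rightarrow> 'a set \<Rightarrow> bool" where
  "bounded_in E B \<longleftrightarrow> B \<subseteq> carrier E \<and>
     (\<forall>U. openin (topol E) U \<and> \<zero>\<^bsub>E\<^esub> \<in> U \<longrightarrow>
        (\<exists>r>0. B \<subseteq> (\<lambda>x. complex_of_real r \<odot>\<^bsub>E\<^esub> x) ` U))"

definition Tc_hom :: "'a lctvs \<Rightarrow> 'b lctvs \<Rightarrow> ('a \<Rightarrow> 'b) set" where
  "Tc_hom E F = {f \<in> lin_hom E F. continuous_map (topol E) (topol F) f}"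

definition Tc :: "('a lctvs, 'a \<Rightarrow> 'a) cat" where
  "Tc = \<lparr>Ob = Collect is_lctvs, Hom = Tc_hom, Idn = (\<lambda>E. \<lambda>x\<in>carrier E. x),
         Cmp = (\<lambda>E F G g f. compose (carrier E) g f)\<rparr>"

text \<open>
  The projective limit in \<open>Tc\<close> of a functor on \<open>J\<close>: the compatible families in the product,
  with the topology induced by the product topology. For a contravariant functor on \<open>I\<close>, take
  \<open>J = op_cat I\<close>.
\<close>

definition Tc_lim ::
  "('i, 'm) cat \<Rightarrow> ('i, 'm, 'a lctvs, 'a \<Rightarrow> 'a) func \<Rightarrow> ('i \<Rightarrow> 'a) lctvs" where
  "Tc_lim J X =
     (let L = {x \<in> \<Pi>\<^sub>E i\<in>Ob J. carrier (fobj X i).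
                 \<forall>a\<in>Ob J. \<forall>b\<in>Ob J. \<forall>u\<in>Hom J a b. farr X a b u (x a) = x b}
      in \<lparr>carrier = L, monoid.mult = undefined, one = undefined,
          zero = (\<lambda>i\<in>Ob J. \<zero>\<^bsub>fobj X i\<^esub>),
          add = (\<lambda>x y. \<lambda>i\<in>Ob J. x i \<oplus>\<^bsub>fobj X i\<^esub> y i),
          smult = (\<lambda>c x. \<lambda>i\<in>Ob J. c \<odot>\<^bsub>fobj X i\<^esub> x i),
          topol = subtopology (product_topology (\<lambda>i. topol (fobj X i)) (Ob J)) L\<rparr>)"

definition Tc_proj ::
  "('i, 'm) cat \<Rightarrow> ('i, 'm, 'a lctvs, 'a \<Rightarrow> 'a) func \<Rightarrow> 'i \<Rightarrow> ('i \<Rightarrow> 'a) \<Rightarrow> 'a" where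
  "Tc_proj J X i = (\<lambda>x\<in>carrier (Tc_lim J X). x i)"


section \<open>Seminormed spaces, Banach spaces and completion\<close>

record 'a nspace = "(complex, 'a) module" +
  nrm :: "'a \<Rightarrow> real"

text \<open>The library locale \<open>Metric_space\<close> requires symmetry and nonnegativity also outside the
  carrier, hence the case distinction.\<close>

definition ndist :: "'a nspace \<Rightarrow> 'a \<Rightarrow> 'a \<Rightarrow> real" where
  "ndist V x y = (if x \<in> carrier V \<and> y \<in> carrier V then nrm V (x \<ominus>\<^bsub>V\<^esub> y) else 0)"

definition is_seminormed :: "'a nspace \<Rightarrow> bool" where
  "is_seminormed V \<longleftrightarrow> complex_vs V \<and>
     (\<forall>x\<in>carrier V. 0 \<le> nrm V x) \<and>
     (\<forall>c. \<forall>x\<in>carrier V. nrm V (c \<odot>\<^bsub>V\<^esub> x) = cmod c * nrm V x) \<and>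
     (\<forall>x\<in>carrier V. \<forall>y\<in>carrier V. nrm V (x \<oplus>\<^bsub>V\<^esub> y) \<le> nrm V x + nrm V y)"

definition is_banach :: "'a nspace \<Rightarrow> bool" where
  "is_banach V \<longleftrightarrow> is_seminormed V \<and> (\<forall>x\<in>carrier V. nrm V x = 0 \<longrightarrow> x = \<zero>\<^bsub>V\<^esub>) \<and>
     Metric_space.mcomplete (carrier V) (ndist V)"

definition Ban_hom :: "'a nspace \<Rightarrow> 'b nspace \<Rightarrow> ('a \<Rightarrow> 'b) set" where
  "Ban_hom V W = {f \<in> lin_hom V W.
     continuous_map (Metric_space.mtopology (carrier V) (ndist V))
                    (Metric_space.mtopology (carrier W) (ndist W)) f}"

definition Ban :: "('a nspace, 'a \<Rightarrow> 'a) cat" where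
  "Ban = \<lparr>Ob = Collect is_banach, Hom = Ban_hom, Idn = (\<lambda>V. \<lambda>x\<in>carrier V. x),
          Cmp = (\<lambda>U V W g f. compose (carrier U) g f)\<rparr>"

text \<open>The (Hausdorff) completion of a seminormed space: Cauchy sequences modulo sequences whose
  difference tends to zero. The map induced by \<open>f\<close> sends the class of \<open>s\<close> to that of \<open>f \<circ> s\<close>.\<close>

definition cauchy_seqs :: "'a nspace \<Rightarrow> (nat \<Rightarrow> 'a) set" where
  "cauchy_seqs V = {s. range s \<subseteq> carrier V \<and>
     (\<forall>e>0. \<exists>N. \<forall>m\<ge>N. \<forall>n\<ge>N. nrm V (s m \<ominus>\<^bsub>V\<^esub> s n) < e)}"

definition null_rel :: "'a nspace \<Rightarrow> ((nat \<Rightarrow> 'a) \<times> (nat \<Rightarrow> 'a)) set" where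
  "null_rel V = {(s, t). s \<in> cauchy_seqs V \<and> t \<in> cauchy_seqs V \<and>
     (\<lambda>n. nrm V (s n \<ominus>\<^bsub>V\<^esub> t n)) \<longlonglongrightarrow> 0}"

definition completion :: "'a nspace \<Rightarrow> (nat \<Rightarrow> 'a) set nspace" where
  "completion V =
     \<lparr>carrier = cauchy_seqs V // null_rel V, monoid.mult = undefined, one = undefined,
      zero = null_rel V `` {\<lambda>_. \<zero>\<^bsub>V\<^esub>},
      add = (\<lambda>P Q. \<Union>s\<in>P. \<Union>t\<in>Q. null_rel V `` {\<lambda>n. s n \<oplus>\<^bsub>V\<^esub> t n}),
      smult = (\<lambda>c P. \<Union>s\<in>P. null_rel V `` {\<lambda>n. c \<odot>\<^bsub>V\<^esub> s n}),
      nrm = (\<lambda>P. the_elem ((\<lambda>s. lim (\<lambda>n. nrm V (s n))) ` P))\<rparr>"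

definition completion_map ::
  "'a nspace \<Rightarrow> 'b nspace \<Rightarrow> ('a \<Rightarrow> 'b) \<Rightarrow> (nat \<Rightarrow> 'a) set \<Rightarrow> (nat \<Rightarrow> 'b) set" where
  "completion_map V W f = (\<lambda>P\<in>carrier (completion V). \<Union>s\<in>P. null_rel W `` {f \<circ> s})"


section \<open>Ind-objects of the category of Banach spaces\<close>

record ('j, 'k, 'c) ind =
  idx :: "('j, 'k) cat"
  dgm :: "('j, 'k, 'c nspace, 'c \<Rightarrow> 'c) func"

definition is_ind :: "('j, 'k, 'c) ind \<Rightarrow> bool" where
  "is_ind F \<longleftrightarrow> category (idx F) \<and> filtered (idx F) \<and> is_functor (idx F) Ban (dgm F)"

text \<open>
  For a Banach space \<open>V\<close>, \<open>colim_hom V G\<close> is the filtered colimit of the sets of morphisms from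
  \<open>V\<close> to the terms of \<open>G\<close>: pairs \<open>(j, f)\<close> with \<open>f\<close> from \<open>V\<close> to the \<open>j\<close>-th term, two pairs being
  identified when they agree at a later stage. Precomposition with \<open>h\<close> from \<open>V\<close> to \<open>W\<close> is
  \<open>\<lambda>c. germ_pull V G c h\<close>, a map from \<open>colim_hom W G\<close> to \<open>colim_hom V G\<close>.
\<close>

definition germs :: "'b nspace \<Rightarrow> ('j, 'k, 'c) ind \<Rightarrow> ('j \<times> ('b \<Rightarrow> 'c)) set" where
  "germs V G = (SIGMA j:Ob (idx G). Ban_hom V (fobj (dgm G) j))"

definition germ_rel ::
  "'b nspace \<Rightarrow> ('j, 'k, 'c) ind \<Rightarrow> (('j \<times> ('b \<Rightarrow> 'c)) \<times> ('j \<times> ('b \<Rightarrow> 'c))) set" where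
  "germ_rel V G = {((i, f), (j, g)). (i, f) \<in> germs V G \<and> (j, g) \<in> germs V G \<and>
     (\<exists>k\<in>Ob (idx G). \<exists>u\<in>Hom (idx G) i k. \<exists>v\<in>Hom (idx G) j k.
        compose (carrier V) (farr (dgm G) i k u) f =
        compose (carrier V) (farr (dgm G) j k v) g)}"

definition colim_hom :: "'b nspace \<Rightarrow> ('j, 'k, 'c) ind \<Rightarrow> ('j \<times> ('b \<Rightarrow> 'c)) set set" where
  "colim_hom V G = germs V G // germ_rel V G"

definition germ_pull ::
  "'a nspace \<Rightarrow> ('j, 'k, 'c) ind \<Rightarrow> ('j \<times> ('b \<Rightarrow> 'c)) set \<Rightarrow> ('a \<Rightarrow> 'b)
     \<Rightarrow> ('j \<times> ('a \<Rightarrow> 'c)) set" where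
  "germ_pull V G c h = (\<Union>(j, f)\<in>c. germ_rel V G `` {(j, compose (carrier V) f h)})"

text \<open>\<open>ind_hom F G\<close> is the projective limit, over the index category of \<open>F\<close>, of the sets
  \<open>colim_hom (fobj (dgm F) a) G\<close>. Source and target may live over different types.\<close>

definition ind_hom ::
  "('i, 'm, 'b) ind \<Rightarrow> ('j, 'k, 'c) ind \<Rightarrow> ('i \<Rightarrow> ('j \<times> ('b \<Rightarrow> 'c)) set) set" where
  "ind_hom F G = {\<phi> \<in> \<Pi>\<^sub>E a\<in>Ob (idx F). colim_hom (fobj (dgm F) a) G.
     \<forall>a\<in>Ob (idx F). \<forall>b\<in>Ob (idx F). \<forall>u\<in>Hom (idx F) a b.
       germ_pull (fobj (dgm F) a) G (\<phi> b) (farr (dgm F) a b u) = \<phi> a}"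

definition ind_id :: "('j, 'k, 'c) ind \<Rightarrow> 'j \<Rightarrow> ('j \<times> ('c \<Rightarrow> 'c)) set" where
  "ind_id F = (\<lambda>a\<in>Ob (idx F).
     germ_rel (fobj (dgm F) a) F `` {(a, \<lambda>x\<in>carrier (fobj (dgm F) a). x)})"

text \<open>The composite of \<open>\<psi>\<close> after \<open>\<phi>\<close>, for \<open>\<phi>\<close> from \<open>F\<close> to some ind-object and \<open>\<psi>\<close> from that
  ind-object to \<open>H\<close>.\<close>

definition ind_comp ::
  "('i, 'm, 'a) ind \<Rightarrow> ('l, 'n, 'c) ind \<Rightarrow> ('j \<Rightarrow> ('l \<times> ('b \<Rightarrow> 'c)) set)
     \<Rightarrow> ('i \<Rightarrow> ('j \<times> ('a \<Rightarrow> 'b)) set) \<Rightarrow> 'i \<Rightarrow> ('l \<times> ('a \<Rightarrow> 'c)) set" where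
  "ind_comp F H \<psi> \<phi> = (\<lambda>a\<in>Ob (idx F).
     \<Union>(j, f)\<in>\<phi> a. germ_pull (fobj (dgm F) a) H (\<psi> j) f)"

definition IndBan :: "(('j, 'k, 'c) ind, 'j \<Rightarrow> ('j \<times> ('c \<Rightarrow> 'c)) set) cat" where
  "IndBan = \<lparr>Ob = Collect is_ind, Hom = ind_hom, Idn = ind_id,
             Cmp = (\<lambda>F G H \<psi> \<phi>. ind_comp F H \<psi> \<phi>)\<rparr>"

definition ind_cone ::
  "('i, 'm) cat \<Rightarrow> ('i, 'm, ('j, 'k, 'c) ind, 'j \<Rightarrow> ('j \<times> ('c \<Rightarrow> 'c)) set) func
     \<Rightarrow> ('p, 'q, 'b) ind \<Rightarrow> ('i \<Rightarrow> 'p \<Rightarrow> ('j \<times> ('b \<Rightarrow> 'c)) set) \<Rightarrow> bool" where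
  "ind_cone J D F \<phi> \<longleftrightarrow> is_ind F \<and> (\<forall>i\<in>Ob J. \<phi> i \<in> ind_hom F (fobj D i)) \<and>
     (\<forall>a\<in>Ob J. \<forall>b\<in>Ob J. \<forall>u\<in>Hom J a b. ind_comp F (fobj D b) (farr D a b u) (\<phi> a) = \<phi> b)"

text \<open>
  \<open>L\<close> with the projections \<open>\<pi>\<close> is a projective limit in \<open>IndBan\<close> of the functor \<open>D\<close> on \<open>J\<close>.
  The universal property is expressed for all ind-objects \<open>F\<close> over the types given by the first
  argument; it holds for all ind-objects whatsoever when these types are left arbitrary.
\<close>

definition ind_limit ::
  "('p, 'q, 'b) ind itself \<Rightarrow>
   ('i, 'm) cat \<Rightarrow> ('i, 'm, ('j, 'k, 'c) ind, 'j \<Rightarrow> ('j \<times> ('c \<Rightarrow> 'c)) set) func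
     \<Rightarrow> ('l, 'n, 'd) ind \<Rightarrow> ('i \<Rightarrow> 'l \<Rightarrow> ('j \<times> ('d \<Rightarrow> 'c)) set) \<Rightarrow> bool" where
  "ind_limit _ J D L \<pi> \<longleftrightarrow> is_functor J IndBan D \<and> ind_cone J D L \<pi> \<and>
     (\<forall>(F :: ('p, 'q, 'b) ind) \<phi>. ind_cone J D F \<phi> \<longrightarrow>
        (\<exists>!m. m \<in> ind_hom F L \<and> (\<forall>i\<in>Ob J. ind_comp F (fobj D i) (\<pi> i) m = \<phi> i)))"


section \<open>The functor IB\<close>

definition disks :: "'a lctvs \<Rightarrow> 'a set set" where
  "disks E = {B. abs_convex_in E B \<and> bounded_in E B}"

definition gauge_space :: "'a lctvs \<Rightarrow> 'a set \<Rightarrow> 'a nspace" where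
  "gauge_space E B = \<lparr>carrier = lin_hull E B, monoid.mult = undefined, one = undefined,
     zero = \<zero>\<^bsub>E\<^esub>, add = add E, smult = smult E, nrm = gauge_in E B\<rparr>"

definition IB :: "'a lctvs \<Rightarrow> ('a set, unit, (nat \<Rightarrow> 'a) set) ind" where
  "IB E = \<lparr>idx = \<lparr>Ob = disks E, Hom = (\<lambda>B C. if B \<subseteq> C then {()} else {}),
                  Idn = (\<lambda>_. ()), Cmp = (\<lambda>_ _ _ _ _. ())\<rparr>,
           dgm = \<lparr>fobj = (\<lambda>B. completion (gauge_space E B)),
                  farr = (\<lambda>B C _. completion_map (gauge_space E B) (gauge_space E C) (\<lambda>x. x))\<rparr>\<rparr>"

definition IB_map ::
  "'a lctvs \<Rightarrow> 'b lctvs \<Rightarrow> ('a \<Rightarrow> 'b)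
     \<Rightarrow> 'a set \<Rightarrow> ('b set \<times> ((nat \<Rightarrow> 'a) set \<Rightarrow> (nat \<Rightarrow> 'b) set)) set" where
  "IB_map E F f = (\<lambda>B\<in>disks E. germ_rel (completion (gauge_space E B)) (IB F) ``
     {(f ` B, completion_map (gauge_space E B) (gauge_space F (f ` B)) f)})"

definition IB_diagram ::
  "('i, 'm, 'a lctvs, 'a \<Rightarrow> 'a) func \<Rightarrow>
   ('i, 'm, ('a set, unit, (nat \<Rightarrow> 'a) set) ind,
    'a set \<Rightarrow> ('a set \<times> ((nat \<Rightarrow> 'a) set \<Rightarrow> (nat \<Rightarrow> 'a) set)) set) func" where
  "IB_diagram X = \<lparr>fobj = (\<lambda>i. IB (fobj X i)),
                   farr = (\<lambda>a b u. IB_map (fobj X a) (fobj X b) (farr X a b u))\<rparr>"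

end

theory Submission
  imports Defs
begin

text \<open>
  For a Banach space \<open>V\<close> and a complete locally convex space \<open>E\<close>, a morphism from \<open>V\<close> to the
  ind-object \<open>IB E\<close> is the same thing as a continuous linear map from \<open>V\<close> to \<open>E\<close>. Once this is
  known, the theorem is formal. A morphism from an ind-object \<open>F\<close> to \<open>IB E\<close> is a compatible family
  of continuous linear maps from the terms of \<open>F\<close> to \<open>E\<close>; a cone over the diagram \<open>IB (X i)\<close> is
  therefore a family of such maps into the spaces \<open>X i\<close>, compatible in both directions, and this is
  one compatible family of maps into the locally convex limit, which is again complete.

  The comparison of the two kinds of morphisms goes as follows. Since \<open>E\<close> is complete and Hausdorff,
  a Cauchy sequence for the gauge of a disk \<open>B\<close>, that is of an absolutely convex bounded set, has a
  unique limit in \<open>E\<close>. This gives a linear map \<open>realize\<close> from the completion of the gauge space of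
  \<open>B\<close> to \<open>E\<close>. A germ, represented by a disk \<open>B\<close> and a bounded operator \<open>f\<close> from \<open>V\<close> to that
  completion, is sent to the composite \<open>realize \<circ> f\<close>, which maps the unit ball into a
  multiple of the closure of \<open>B\<close>.

  \<^item> Every linear map with bounded values on the unit ball arises: it factors through the gauge space
    of the image of the unit ball (\<open>bounded_map_factors\<close>).
  \<^item> Two germs with the same composite are equal (\<open>germ_rel_iff\<close>). The map \<open>realize\<close> can fail to be
    injective, but it is injective when \<open>B\<close> is closed (\<open>realize_inj\<close>), and every disk is contained
    in a closed one, its closure.

  The resulting bijection \<open>colim_val\<close> is natural in both arguments (\<open>germ_pull_val\<close>,
  \<open>IB_map_apply_val\<close>), so that every equation between morphisms into some \<open>IB E\<close> becomes an equation
  between maps with values in \<open>E\<close>. Functoriality of \<open>IB\<close>, the cone property and the universal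
  property are all verified in this way.
\<close>

section \<open>Complex vector spaces\<close>

lemma complex_ring_simps [simp]:
  "carrier complex_ring = UNIV"
  "a \<oplus>\<^bsub>complex_ring\<^esub> b = a + b"
  "a \<otimes>\<^bsub>complex_ring\<^esub> b = a * b"
  "\<zero>\<^bsub>complex_ring\<^esub> = 0"
  "\<one>\<^bsub>complex_ring\<^esub> = 1"
  by (simp_all add: complex_ring_def)

lemma cring_complex_ring: "cring complex_ring"
proof (rule cringI)
  show "abelian_group complex_ring"
    by (rule abelian_groupI) (auto simp: add_ac add_eq_0_iff)
  show "Group.comm_monoid complex_ring"
    by (rule comm_monoidI) (auto simp: algebra_simps)
qed (auto simp: algebra_simps)

text \<open>Negatives come for free from multiplication by \<open>-1\<close>, so that the axioms for a vector space need
  only mention addition, zero and scalars.\<close>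

lemma complex_vsI:
  assumes "\<And>x y. x \<in> carrier E \<Longrightarrow> y \<in> carrier E \<Longrightarrow> x \<oplus>\<^bsub>E\<^esub> y \<in> carrier E"
    and "\<zero>\<^bsub>E\<^esub> \<in> carrier E"
    and "\<And>x y z. x \<in> carrier E \<Longrightarrow> y \<in> carrier E \<Longrightarrow> z \<in> carrier E \<Longrightarrow>
           (x \<oplus>\<^bsub>E\<^esub> y) \<oplus>\<^bsub>E\<^esub> z = x \<oplus>\<^bsub>E\<^esub> (y \<oplus>\<^bsub>E\<^esub> z)"
    and "\<And>x y. x \<in> carrier E \<Longrightarrow> y \<in> carrier E \<Longrightarrow> x \<oplus>\<^bsub>E\<^esub> y = y \<oplus>\<^bsub>E\<^esub> x"
    and "\<And>x. x \<in> carrier E \<Longrightarrow> \<zero>\<^bsub>E\<^esub> \<oplus>\<^bsub>E\<^esub> x = x"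
    and "\<And>c x. x \<in> carrier E \<Longrightarrow> c \<odot>\<^bsub>E\<^esub> x \<in> carrier E"
    and "\<And>a b x. x \<in> carrier E \<Longrightarrow> (a + b) \<odot>\<^bsub>E\<^esub> x = a \<odot>\<^bsub>E\<^esub> x \<oplus>\<^bsub>E\<^esub> b \<odot>\<^bsub>E\<^esub> x"
    and "\<And>a x y. x \<in> carrier E \<Longrightarrow> y \<in> carrier E \<Longrightarrow>
           a \<odot>\<^bsub>E\<^esub> (x \<oplus>\<^bsub>E\<^esub> y) = a \<odot>\<^bsub>E\<^esub> x \<oplus>\<^bsub>E\<^esub> a \<odot>\<^bsub>E\<^esub> y"
    and "\<And>a b x. x \<in> carrier E \<Longrightarrow> (a * b) \<odot>\<^bsub>E\<^esub> x = a \<odot>\<^bsub>E\<^esub> (b \<odot>\<^bsub>E\<^esub> x)"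
    and "\<And>x. x \<in> carrier E \<Longrightarrow> 1 \<odot>\<^bsub>E\<^esub> x = x"
    and "\<And>x. x \<in> carrier E \<Longrightarrow> 0 \<odot>\<^bsub>E\<^esub> x = \<zero>\<^bsub>E\<^esub>"
  shows "complex_vs (E :: (complex, 'a, 'z) module_scheme)"
proof (rule moduleI)
  show "abelian_group E"
  proof (rule abelian_groupI)
    fix x assume x: "x \<in> carrier E"
    have "(-1) \<odot>\<^bsub>E\<^esub> x \<oplus>\<^bsub>E\<^esub> x = (-1 + 1) \<odot>\<^bsub>E\<^esub> x"
      using assms(7)[OF x, of "-1" 1] assms(10)[OF x] by simp
    then show "\<exists>y\<in>carrier E. y \<oplus>\<^bsub>E\<^esub> x = \<zero>\<^bsub>E\<^esub>"
      using assms(11)[OF x] assms(6)[OF x] by auto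
  qed (use assms in auto)
qed (use assms cring_complex_ring in auto)

locale complex_space =
  fixes E :: "(complex, 'a, 'z) module_scheme" (structure)
  assumes is_vs: "complex_vs E"
begin

sublocale Module.module complex_ring E
  by (rule is_vs)

lemma add_closed: "x \<in> carrier E \<Longrightarrow> y \<in> carrier E \<Longrightarrow> x \<oplus> y \<in> carrier E"
  by simp

lemma smult_in: "x \<in> carrier E \<Longrightarrow> c \<odot> x \<in> carrier E"
  using smult_closed by simp

lemma smult_add_left: "x \<in> carrier E \<Longrightarrow> (a + b) \<odot> x = a \<odot> x \<oplus> b \<odot> x"
  using smult_l_distr[of a b x] by simp

lemma smult_add_right: "x \<in> carrier E \<Longrightarrow> y \<in> carrier E \<Longrightarrow> a \<odot> (x \<oplus> y) = a \<odot> x \<oplus> a \<odot> y"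
  using smult_r_distr[of a x y] by simp

lemma smult_smult: "x \<in> carrier E \<Longrightarrow> a \<odot> (b \<odot> x) = (a * b) \<odot> x"
  using smult_assoc1[of a b x] by simp

lemma one_smult: "x \<in> carrier E \<Longrightarrow> 1 \<odot> x = x"
  using smult_one[of x] by simp

lemma zero_smult: "x \<in> carrier E \<Longrightarrow> 0 \<odot> x = \<zero>"
  using smult_l_null[of x] by simp

lemma smult_zero: "c \<odot> \<zero> = \<zero>"
  using smult_r_null[of c] by simp

lemma diff_eq: "x \<in> carrier E \<Longrightarrow> y \<in> carrier E \<Longrightarrow> x \<ominus> y = x \<oplus> (-1) \<odot> y"
proof -
  assume x: "x \<in> carrier E" and y: "y \<in> carrier E"
  have "(-1) \<odot> y \<oplus> y = \<zero>"
    using smult_add_left[OF y, of "-1" 1] one_smult[OF y] zero_smult[OF y] by simp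
  then have "(-1) \<odot> y = \<ominus> y"
    using y smult_in by (metis M.minus_equality)
  then show ?thesis by (simp add: a_minus_def)
qed

lemma diff_closed: "x \<in> carrier E \<Longrightarrow> y \<in> carrier E \<Longrightarrow> x \<ominus> y \<in> carrier E"
  by simp

lemma diff_self: "x \<in> carrier E \<Longrightarrow> x \<ominus> x = \<zero>"
  by (simp add: a_minus_def M.r_neg)

lemmas closed = add_closed smult_in diff_closed M.zero_closed

lemma diff_swap:
  assumes "x \<in> carrier E" "y \<in> carrier E"
  shows "y \<ominus> x = (-1) \<odot> (x \<ominus> y)"
  using assms by (simp add: diff_eq smult_in smult_add_right smult_smult one_smult M.a_comm)

lemma diff_add_diff:
  assumes "x \<in> carrier E" "y \<in> carrier E" "x' \<in> carrier E" "y' \<in> carrier E"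
  shows "(x \<oplus> y) \<ominus> (x' \<oplus> y') = (x \<ominus> x') \<oplus> (y \<ominus> y')"
  using assms by (simp add: diff_eq smult_in smult_add_right M.a_ac)

lemma smult_diff:
  assumes "x \<in> carrier E" "y \<in> carrier E"
  shows "c \<odot> (x \<ominus> y) = c \<odot> x \<ominus> c \<odot> y"
  using assms by (simp add: diff_eq smult_in smult_add_right smult_smult mult.commute)

lemma diff_add_cancel:
  assumes "x \<in> carrier E" "y \<in> carrier E"
  shows "(x \<ominus> y) \<oplus> y = x"
  using assms by (simp add: a_minus_def M.a_assoc M.l_neg)

lemma diff_split:
  assumes "x \<in> carrier E" "y \<in> carrier E" "z \<in> carrier E"
  shows "x \<ominus> z = (x \<ominus> y) \<oplus> (y \<ominus> z)"
proof -
  have "(x \<ominus> y) \<oplus> (y \<ominus> z) = ((x \<ominus> y) \<oplus> y) \<ominus> z"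
    using assms by (simp add: a_minus_def M.a_assoc)
  then show ?thesis using assms by (simp add: diff_add_cancel)
qed

lemma diff_zero: "x \<in> carrier E \<Longrightarrow> x \<ominus> \<zero> = x"
  by (simp add: a_minus_def)

lemma diff_eq_zero:
  assumes "x \<in> carrier E" "y \<in> carrier E" "x \<ominus> y = \<zero>"
  shows "x = y"
  using diff_add_cancel[OF assms(1,2)] assms by simp

end

section \<open>Seminormed spaces and their completion\<close>

locale seminormed = complex_space V for V :: "'a nspace" (structure) +
  assumes nrm_nonneg: "x \<in> carrier V \<Longrightarrow> 0 \<le> nrm V x"
    and nrm_smult: "x \<in> carrier V \<Longrightarrow> nrm V (c \<odot> x) = cmod c * nrm V x"
    and nrm_triangle: "x \<in> carrier V \<Longrightarrow> y \<in> carrier V \<Longrightarrow> nrm V (x \<oplus> y) \<le> nrm V x + nrm V y"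

lemma is_seminormed_iff: "is_seminormed V \<longleftrightarrow> seminormed V"
  by (auto simp: is_seminormed_def seminormed_def seminormed_axioms_def complex_space_def)

context seminormed
begin

lemma nrm_zero: "nrm V \<zero> = 0"
  using nrm_smult[of \<zero> 0] by (simp add: smult_zero)

lemma nrm_diff_swap: "x \<in> carrier V \<Longrightarrow> y \<in> carrier V \<Longrightarrow> nrm V (y \<ominus> x) = nrm V (x \<ominus> y)"
  by (subst diff_swap) (simp_all add: nrm_smult)

lemma nrm_diff_triangle:
  assumes "x \<in> carrier V" "y \<in> carrier V" "z \<in> carrier V"
  shows "nrm V (x \<ominus> z) \<le> nrm V (x \<ominus> y) + nrm V (y \<ominus> z)"
  using assms nrm_triangle[of "x \<ominus> y" "y \<ominus> z"] by (simp add: diff_split[of x y z])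

lemma nrm_diff_abs:
  assumes "x \<in> carrier V" "y \<in> carrier V"
  shows "\<bar>nrm V x - nrm V y\<bar> \<le> nrm V (x \<ominus> y)"
  using assms nrm_diff_triangle[of x y \<zero>] nrm_diff_triangle[of y x \<zero>] nrm_diff_swap[of x y]
  by (simp add: diff_zero)

lemma nrm_add_diff:
  assumes "x \<in> carrier V" "y \<in> carrier V" "x' \<in> carrier V" "y' \<in> carrier V"
  shows "nrm V ((x \<oplus> y) \<ominus> (x' \<oplus> y')) \<le> nrm V (x \<ominus> x') + nrm V (y \<ominus> y')"
  using assms nrm_triangle[of "x \<ominus> x'" "y \<ominus> y'"] by (simp add: diff_add_diff)

lemma nrm_smult_diff:
  assumes "x \<in> carrier V" "y \<in> carrier V"
  shows "nrm V (c \<odot> x \<ominus> c \<odot> y) = cmod c * nrm V (x \<ominus> y)"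
  using assms by (simp add: smult_diff[symmetric] nrm_smult)

lemma cauchy_seqsI:
  assumes "\<And>n. s n \<in> carrier V"
    and "\<And>e. e > 0 \<Longrightarrow> \<exists>N. \<forall>m\<ge>N. \<forall>n\<ge>N. nrm V (s m \<ominus> s n) < e"
  shows "s \<in> cauchy_seqs V"
  using assms by (auto simp: cauchy_seqs_def)

lemma cauchy_seqs_in: "s \<in> cauchy_seqs V \<Longrightarrow> s n \<in> carrier V"
  by (auto simp: cauchy_seqs_def)

lemma cauchy_seqsD:
  assumes "s \<in> cauchy_seqs V" "e > 0"
  obtains N where "\<And>m n. m \<ge> N \<Longrightarrow> n \<ge> N \<Longrightarrow> nrm V (s m \<ominus> s n) < e"
proof -
  have "\<forall>e>0. \<exists>N. \<forall>m\<ge>N. \<forall>n\<ge>N. nrm V (s m \<ominus> s n) < e"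
    using assms(1) by (simp add: cauchy_seqs_def)
  then obtain N where "\<forall>m\<ge>N. \<forall>n\<ge>N. nrm V (s m \<ominus> s n) < e"
    using assms(2) by presburger
  then show thesis by (intro that[of N]) auto
qed

lemma const_cauchy: "x \<in> carrier V \<Longrightarrow> (\<lambda>_. x) \<in> cauchy_seqs V"
  by (auto intro!: cauchy_seqsI simp: diff_self nrm_zero)

lemma add_cauchy:
  assumes s: "s \<in> cauchy_seqs V" and t: "t \<in> cauchy_seqs V"
  shows "(\<lambda>n. s n \<oplus> t n) \<in> cauchy_seqs V"
proof (rule cauchy_seqsI)
  fix e :: real assume e: "e > 0"
  from e obtain N where N: "\<And>m n. m \<ge> N \<Longrightarrow> n \<ge> N \<Longrightarrow> nrm V (s m \<ominus> s n) < e/2"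
    using cauchy_seqsD[OF s, of "e/2"] by auto
  from e obtain M where M: "\<And>m n. m \<ge> M \<Longrightarrow> n \<ge> M \<Longrightarrow> nrm V (t m \<ominus> t n) < e/2"
    using cauchy_seqsD[OF t, of "e/2"] by auto
  have "nrm V ((s m \<oplus> t m) \<ominus> (s n \<oplus> t n)) < e" if "m \<ge> max N M" "n \<ge> max N M" for m n
    using nrm_add_diff[of "s m" "t m" "s n" "t n"] N[of m n] M[of m n] that
      cauchy_seqs_in[OF s] cauchy_seqs_in[OF t] by auto
  then show "\<exists>N. \<forall>m\<ge>N. \<forall>n\<ge>N. nrm V ((s m \<oplus> t m) \<ominus> (s n \<oplus> t n)) < e" by blast
qed (use cauchy_seqs_in s t in auto)

lemma smult_cauchy:
  assumes s: "s \<in> cauchy_seqs V"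
  shows "(\<lambda>n. c \<odot> s n) \<in> cauchy_seqs V"
proof (rule cauchy_seqsI)
  fix e :: real assume e: "e > 0"
  have pos: "cmod c + 1 > 0" by (simp add: add_nonneg_pos)
  from e pos obtain N where N: "\<And>m n. m \<ge> N \<Longrightarrow> n \<ge> N \<Longrightarrow> nrm V (s m \<ominus> s n) < e/(cmod c + 1)"
    using cauchy_seqsD[OF s, of "e/(cmod c + 1)"] by auto
  have "nrm V (c \<odot> s m \<ominus> c \<odot> s n) < e" if "m \<ge> N" "n \<ge> N" for m n
  proof -
    have "nrm V (s m \<ominus> s n) \<ge> 0"
      using cauchy_seqs_in[OF s] by (simp add: nrm_nonneg)
    then have "cmod c * nrm V (s m \<ominus> s n) \<le> (cmod c + 1) * nrm V (s m \<ominus> s n)"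
      by (simp add: mult_right_mono)
    also have "\<dots> < e" using N[OF that] pos by (simp add: field_simps)
    finally show ?thesis using cauchy_seqs_in[OF s] by (simp add: nrm_smult_diff)
  qed
  then show "\<exists>N. \<forall>m\<ge>N. \<forall>n\<ge>N. nrm V (c \<odot> s m \<ominus> c \<odot> s n) < e" by blast
qed (use cauchy_seqs_in s in \<open>auto simp: smult_in\<close>)

lemma diff_cauchy:
  assumes s: "s \<in> cauchy_seqs V" and t: "t \<in> cauchy_seqs V"
  shows "(\<lambda>n. s n \<ominus> t n) \<in> cauchy_seqs V"
  using add_cauchy[OF s smult_cauchy[OF t, of "-1"]] cauchy_seqs_in[OF s] cauchy_seqs_in[OF t]
  by (simp add: diff_eq)

lemma nrm_convergent:
  assumes s: "s \<in> cauchy_seqs V"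
  shows "convergent (\<lambda>n. nrm V (s n))"
proof -
  have "Cauchy (\<lambda>n. nrm V (s n))"
  proof (rule CauchyI)
    fix e :: real assume "e > 0"
    then obtain N where "\<And>m n. m \<ge> N \<Longrightarrow> n \<ge> N \<Longrightarrow> nrm V (s m \<ominus> s n) < e"
      using cauchy_seqsD[OF s] by metis
    then show "\<exists>M. \<forall>m\<ge>M. \<forall>n\<ge>M. norm (nrm V (s m) - nrm V (s n)) < e"
      using le_less_trans[OF nrm_diff_abs[OF cauchy_seqs_in[OF s] cauchy_seqs_in[OF s]]]
      by (intro exI[of _ N]) auto
  qed
  then show ?thesis by (simp add: Cauchy_convergent_iff)
qed

lemma null_relD:
  assumes "(s, t) \<in> null_rel V"
  shows "s \<in> cauchy_seqs V" "t \<in> cauchy_seqs V" "(\<lambda>n. nrm V (s n \<ominus> t n)) \<longlonglongrightarrow> 0"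
  using assms by (auto simp: null_rel_def)

lemma equiv_null_rel: "equiv (cauchy_seqs V) (null_rel V)"
proof (rule equivI)
  show "null_rel V \<subseteq> cauchy_seqs V \<times> cauchy_seqs V"
    by (auto simp: null_rel_def)
  show "refl_on (cauchy_seqs V) (null_rel V)"
    by (auto simp: refl_on_def null_rel_def diff_self cauchy_seqs_in nrm_zero)
  show "sym (null_rel V)"
    by (auto simp: sym_def null_rel_def nrm_diff_swap cauchy_seqs_in)
  show "trans (null_rel V)"
  proof (rule transI)
    fix s t r assume st: "(s, t) \<in> null_rel V" and tr: "(t, r) \<in> null_rel V"
    note c = null_relD[OF st] null_relD[OF tr]
    have "(\<lambda>n. nrm V (s n \<ominus> t n) + nrm V (t n \<ominus> r n)) \<longlonglongrightarrow> 0"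
      using tendsto_add[OF c(3) c(6)] by simp
    then have "(\<lambda>n. nrm V (s n \<ominus> r n)) \<longlonglongrightarrow> 0"
      by (rule Lim_null_comparison[rotated])
        (use c nrm_diff_triangle cauchy_seqs_in nrm_nonneg in auto)
    then show "(s, r) \<in> null_rel V" using c by (auto simp: null_rel_def)
  qed
qed

abbreviation cls :: "(nat \<Rightarrow> 'a) \<Rightarrow> (nat \<Rightarrow> 'a) set" where
  "cls s \<equiv> null_rel V `` {s}"

lemma completion_cls: "s \<in> cauchy_seqs V \<Longrightarrow> cls s \<in> carrier (completion V)"
  by (auto simp: completion_def quotientI)

lemma completion_cases:
  assumes "P \<in> carrier (completion V)"
  obtains s where "s \<in> cauchy_seqs V" "P = cls s"
  using assms by (auto simp: completion_def elim: quotientE)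

lemma cls_eq_iff:
  assumes "s \<in> cauchy_seqs V" "t \<in> cauchy_seqs V"
  shows "cls s = cls t \<longleftrightarrow> (\<lambda>n. nrm V (s n \<ominus> t n)) \<longlonglongrightarrow> 0"
  using eq_equiv_class_iff[OF equiv_null_rel assms] assms by (simp add: null_rel_def)

lemma cls_self: "s \<in> cauchy_seqs V \<Longrightarrow> s \<in> cls s"
  using equiv_class_self[OF equiv_null_rel] by auto

lemma cls_memD: 
  assumes "t \<in> cls s"
  shows "t \<in> cauchy_seqs V" "s \<in> cauchy_seqs V" "(\<lambda>n. nrm V (s n \<ominus> t n)) \<longlonglongrightarrow> 0" "cls t = cls s"
  using assms null_relD equiv_class_eq[OF equiv_null_rel] by auto

lemma UN_const_class:
  assumes "s \<in> cauchy_seqs V" "\<And>t. t \<in> cls s \<Longrightarrow> F t = F s"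
  shows "(\<Union>t\<in>cls s. F t) = F s"
  using assms cls_self[OF assms(1)] by blast

lemma add_cls:
  assumes s: "s \<in> cauchy_seqs V" and t: "t \<in> cauchy_seqs V"
  shows "cls s \<oplus>\<^bsub>completion V\<^esub> cls t = cls (\<lambda>n. s n \<oplus> t n)"
proof -
  have eq: "cls (\<lambda>n. s' n \<oplus> t' n) = cls (\<lambda>n. s n \<oplus> t n)" if "s' \<in> cls s" "t' \<in> cls t" for s' t'
  proof -
    note c = cls_memD[OF that(1)] cls_memD[OF that(2)]
    have "(\<lambda>n. nrm V (s n \<ominus> s' n) + nrm V (t n \<ominus> t' n)) \<longlonglongrightarrow> 0"
      using tendsto_add[OF c(3) c(7)] by simp
    then have "(\<lambda>n. nrm V ((s n \<oplus> t n) \<ominus> (s' n \<oplus> t' n))) \<longlonglongrightarrow> 0"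
      by (rule Lim_null_comparison[rotated])
        (use c nrm_add_diff cauchy_seqs_in nrm_nonneg in auto)
    then show ?thesis using c by (subst eq_commute, subst cls_eq_iff) (auto intro: add_cauchy)
  qed
  have "cls s \<oplus>\<^bsub>completion V\<^esub> cls t = (\<Union>s'\<in>cls s. \<Union>t'\<in>cls t. cls (\<lambda>n. s' n \<oplus> t' n))"
    by (simp add: completion_def)
  also have "\<dots> = (\<Union>s'\<in>cls s. \<Union>t'\<in>cls t. cls (\<lambda>n. s n \<oplus> t n))"
    using eq by simp
  also have "\<dots> = cls (\<lambda>n. s n \<oplus> t n)"
    using cls_self[OF s] cls_self[OF t] by blast
  finally show ?thesis .
qed

lemma smult_cls:
  assumes s: "s \<in> cauchy_seqs V"
  shows "c \<odot>\<^bsub>completion V\<^esub> cls s = cls (\<lambda>n. c \<odot> s n)"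
proof -
  have eq: "cls (\<lambda>n. c \<odot> s' n) = cls (\<lambda>n. c \<odot> s n)" if "s' \<in> cls s" for s'
  proof -
    note d = cls_memD[OF that(1)]
    have "(\<lambda>n. cmod c * nrm V (s n \<ominus> s' n)) \<longlonglongrightarrow> 0"
      using tendsto_mult_left[OF d(3)] by simp
    then have "(\<lambda>n. nrm V (c \<odot> s n \<ominus> c \<odot> s' n)) \<longlonglongrightarrow> 0"
      using cauchy_seqs_in d by (simp add: nrm_smult_diff)
    then show ?thesis using d by (subst eq_commute, subst cls_eq_iff) (auto intro: smult_cauchy)
  qed
  have "c \<odot>\<^bsub>completion V\<^esub> cls s = (\<Union>s'\<in>cls s. cls (\<lambda>n. c \<odot> s' n))"
    by (simp add: completion_def)
  also have "\<dots> = cls (\<lambda>n. c \<odot> s n)"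
    using eq s by (intro UN_const_class)
  finally show ?thesis .
qed

lemma zero_cls: "\<zero>\<^bsub>completion V\<^esub> = cls (\<lambda>_. \<zero>)"
  by (simp add: completion_def)

text \<open>The norm of a class is defined as the common limit of the norms along its members; equivalent
  sequences have the same limit by the reverse triangle inequality.\<close>

lemma nrm_cls_lim:
  assumes s: "s \<in> cauchy_seqs V"
  shows "(\<lambda>n. nrm V (s n)) \<longlonglongrightarrow> nrm (completion V) (cls s)"
proof -
  have conv: "(\<lambda>n. nrm V (s n)) \<longlonglongrightarrow> lim (\<lambda>n. nrm V (s n))"
    using nrm_convergent[OF s] by (simp add: convergent_LIMSEQ_iff)
  have "lim (\<lambda>n. nrm V (t n)) = lim (\<lambda>n. nrm V (s n))" if "t \<in> cls s" for t
  proof -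
    note d = cls_memD[OF that(1)]
    have "(\<lambda>n. nrm V (s n) - nrm V (t n)) \<longlonglongrightarrow> 0"
      using d(3) by (rule Lim_null_comparison[rotated])
        (use d nrm_diff_abs cauchy_seqs_in in auto)
    from tendsto_diff[OF conv this] show ?thesis by (simp add: limI)
  qed
  then have "(\<lambda>t. lim (\<lambda>n. nrm V (t n))) ` cls s = {lim (\<lambda>n. nrm V (s n))}"
    using cls_self[OF s] by blast
  then have "nrm (completion V) (cls s) = lim (\<lambda>n. nrm V (s n))"
    by (simp add: completion_def)
  then show ?thesis using conv by simp
qed

lemma nrm_cls_const: "x \<in> carrier V \<Longrightarrow> nrm (completion V) (cls (\<lambda>_. x)) = nrm V x"
  using nrm_cls_lim[OF const_cauchy, of x] by (simp add: LIMSEQ_const_iff)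

lemma completion_complex_space: "complex_space (completion V)"
proof (intro complex_space.intro complex_vsI)
  fix P Q R a b
  note si = add_cauchy smult_cauchy const_cauchy cauchy_seqs_in
  note ss = add_cls smult_cls zero_cls si completion_cls smult_smult M.a_ac one_smult zero_smult
    smult_add_left smult_add_right
  show "\<zero>\<^bsub>completion V\<^esub> \<in> carrier (completion V)" by (simp add: ss)
  assume "P \<in> carrier (completion V)"
  then obtain s where P: "s \<in> cauchy_seqs V" "P = cls s" using completion_cases by blast
  show "\<zero>\<^bsub>completion V\<^esub> \<oplus>\<^bsub>completion V\<^esub> P = P" using P by (simp add: ss)
  show "a \<odot>\<^bsub>completion V\<^esub> P \<in> carrier (completion V)" using P by (simp add: ss)
  show "(a + b) \<odot>\<^bsub>completion V\<^esub> P =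
         a \<odot>\<^bsub>completion V\<^esub> P \<oplus>\<^bsub>completion V\<^esub> b \<odot>\<^bsub>completion V\<^esub> P" using P by (simp add: ss)
  show "(a * b) \<odot>\<^bsub>completion V\<^esub> P = a \<odot>\<^bsub>completion V\<^esub> (b \<odot>\<^bsub>completion V\<^esub> P)"
    using P by (simp add: ss)
  show "1 \<odot>\<^bsub>completion V\<^esub> P = P" using P by (simp add: ss)
  show "0 \<odot>\<^bsub>completion V\<^esub> P = \<zero>\<^bsub>completion V\<^esub>" using P by (simp add: ss)
  assume "Q \<in> carrier (completion V)"
  then obtain t where Q: "t \<in> cauchy_seqs V" "Q = cls t" using completion_cases by blast
  show "P \<oplus>\<^bsub>completion V\<^esub> Q \<in> carrier (completion V)" using P Q by (simp add: ss)
  show "P \<oplus>\<^bsub>completion V\<^esub> Q = Q \<oplus>\<^bsub>completion V\<^esub> P" using P Q by (simp add: ss)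
  show "a \<odot>\<^bsub>completion V\<^esub> (P \<oplus>\<^bsub>completion V\<^esub> Q) =
         a \<odot>\<^bsub>completion V\<^esub> P \<oplus>\<^bsub>completion V\<^esub> a \<odot>\<^bsub>completion V\<^esub> Q" using P Q by (simp add: ss)
  assume "R \<in> carrier (completion V)"
  then obtain r where R: "r \<in> cauchy_seqs V" "R = cls r" using completion_cases by blast
  show "P \<oplus>\<^bsub>completion V\<^esub> Q \<oplus>\<^bsub>completion V\<^esub> R = P \<oplus>\<^bsub>completion V\<^esub> (Q \<oplus>\<^bsub>completion V\<^esub> R)"
    using P Q R by (simp add: ss)
qed

lemma completion_seminormed: "seminormed (completion V)"
proof -
  interpret C: complex_space "completion V" by (rule completion_complex_space)
  show ?thesis
  proof
    fix P assume "P \<in> carrier (completion V)"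
    then obtain s where P: "s \<in> cauchy_seqs V" "P = cls s" using completion_cases by blast
    show "0 \<le> nrm (completion V) P"
      using nrm_cls_lim[OF P(1)] P nrm_nonneg cauchy_seqs_in by (auto intro: LIMSEQ_le_const)
    show "nrm (completion V) (c \<odot>\<^bsub>completion V\<^esub> P) = cmod c * nrm (completion V) P" for c
    proof (rule LIMSEQ_unique)
      show "(\<lambda>n. nrm V (c \<odot> s n)) \<longlonglongrightarrow> nrm (completion V) (c \<odot>\<^bsub>completion V\<^esub> P)"
        using nrm_cls_lim[OF smult_cauchy[OF P(1)]] P by (simp add: smult_cls)
      show "(\<lambda>n. nrm V (c \<odot> s n)) \<longlonglongrightarrow> cmod c * nrm (completion V) P"
        using tendsto_mult_left[OF nrm_cls_lim[OF P(1)]] P cauchy_seqs_in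
        by (simp add: nrm_smult)
    qed
    fix Q assume "Q \<in> carrier (completion V)"
    then obtain t where Q: "t \<in> cauchy_seqs V" "Q = cls t" using completion_cases by blast
    show "nrm (completion V) (P \<oplus>\<^bsub>completion V\<^esub> Q) \<le> nrm (completion V) P + nrm (completion V) Q"
    proof (rule LIMSEQ_le)
      show "(\<lambda>n. nrm V (s n \<oplus> t n)) \<longlonglongrightarrow> nrm (completion V) (P \<oplus>\<^bsub>completion V\<^esub> Q)"
        using nrm_cls_lim[OF add_cauchy[OF P(1) Q(1)]] P Q by (simp add: add_cls)
      show "(\<lambda>n. nrm V (s n) + nrm V (t n)) \<longlonglongrightarrow> nrm (completion V) P + nrm (completion V) Q"
        using tendsto_add[OF nrm_cls_lim[OF P(1)] nrm_cls_lim[OF Q(1)]] P Q by simp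
    qed (use P Q cauchy_seqs_in nrm_triangle in auto)
  qed
qed

lemma diff_cls:
  assumes s: "s \<in> cauchy_seqs V" and t: "t \<in> cauchy_seqs V"
  shows "cls s \<ominus>\<^bsub>completion V\<^esub> cls t = cls (\<lambda>n. s n \<ominus> t n)"
  using s t cauchy_seqs_in
  by (simp add: complex_space.diff_eq[OF completion_complex_space] completion_cls smult_cls
      smult_cauchy add_cls diff_eq)

lemma completion_definite:
  assumes "P \<in> carrier (completion V)" "nrm (completion V) P = 0"
  shows "P = \<zero>\<^bsub>completion V\<^esub>"
proof -
  obtain s where P: "s \<in> cauchy_seqs V" "P = cls s" using completion_cases assms by blast
  then show ?thesis
    using nrm_cls_lim[OF P(1)] assms(2) const_cauchy cauchy_seqs_in
    by (simp add: zero_cls cls_eq_iff diff_zero)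
qed

text \<open>Every Cauchy sequence of the completion is approximated, up to a null sequence, by a sequence
  of constant classes; the approximating vectors form a Cauchy sequence, whose class is the limit.\<close>

lemma completion_complete:
  assumes P: "P \<in> cauchy_seqs (completion V)"
  obtains L where "L \<in> carrier (completion V)"
    "(\<lambda>n. nrm (completion V) (P n \<ominus>\<^bsub>completion V\<^esub> L)) \<longlonglongrightarrow> 0"
proof -
  interpret C: seminormed "completion V" by (rule completion_seminormed)
  \<comment> \<open>A late term of a representing sequence approximates the class.\<close>
  have approx: "\<exists>x\<in>carrier V. nrm (completion V) (Q \<ominus>\<^bsub>completion V\<^esub> cls (\<lambda>_. x)) \<le> e"
    if Q: "Q \<in> carrier (completion V)" and e: "e > 0" for Q e
  proof -
    obtain s where s: "s \<in> cauchy_seqs V" "Q = cls s" using completion_cases Q by blast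
    obtain N where N: "\<And>m n. m \<ge> N \<Longrightarrow> n \<ge> N \<Longrightarrow> nrm V (s m \<ominus> s n) < e"
      using cauchy_seqsD[OF s(1) e] by metis
    have "(\<lambda>n. nrm V (s n \<ominus> s N)) \<longlonglongrightarrow> nrm (completion V) (Q \<ominus>\<^bsub>completion V\<^esub> cls (\<lambda>_. s N))"
      using nrm_cls_lim[OF diff_cauchy[OF s(1) const_cauchy]] s const_cauchy cauchy_seqs_in
      by (simp add: diff_cls)
    then have "nrm (completion V) (Q \<ominus>\<^bsub>completion V\<^esub> cls (\<lambda>_. s N)) \<le> e"
      by (rule LIMSEQ_le_const2) (use N less_imp_le in blast)
    then show ?thesis using cauchy_seqs_in[OF s(1)] by blast
  qed
  have "\<forall>n. \<exists>x\<in>carrier V.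
    nrm (completion V) (P n \<ominus>\<^bsub>completion V\<^esub> cls (\<lambda>_. x)) \<le> inverse (real (Suc n))"
    using approx C.cauchy_seqs_in[OF P] by simp
  then obtain v where v: "\<And>n. v n \<in> carrier V"
    and vP: "\<And>n. nrm (completion V) (P n \<ominus>\<^bsub>completion V\<^esub> cls (\<lambda>_. v n)) \<le> inverse (real (Suc n))"
    by metis
  have cv: "cls (\<lambda>_. v n) \<in> carrier (completion V)" for n
    using v const_cauchy completion_cls by blast
  have dist: "nrm V (v m \<ominus> v n) \<le> inverse (real (Suc m)) + inverse (real (Suc n))
      + nrm (completion V) (P m \<ominus>\<^bsub>completion V\<^esub> P n)" for m n
  proof -
    have "nrm V (v m \<ominus> v n) = nrm (completion V) (cls (\<lambda>_. v m) \<ominus>\<^bsub>completion V\<^esub> cls (\<lambda>_. v n))"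
      using v const_cauchy by (simp add: diff_cls nrm_cls_const)
    then show ?thesis
      using C.nrm_diff_triangle[of "cls (\<lambda>_. v m)" "P m" "cls (\<lambda>_. v n)"]
        C.nrm_diff_triangle[of "P m" "P n" "cls (\<lambda>_. v n)"] cv C.cauchy_seqs_in[OF P]
        vP[of m] vP[of n] C.nrm_diff_swap[of "P m" "cls (\<lambda>_. v m)"]
      by fastforce
  qed
  have inv: "(\<lambda>n. inverse (real (Suc n))) \<longlonglongrightarrow> 0"
    by (rule LIMSEQ_inverse_real_of_nat)
  have vc: "v \<in> cauchy_seqs V"
  proof (rule cauchy_seqsI)
    fix e :: real assume e: "e > 0"
    obtain N where N: "\<And>m n. m \<ge> N \<Longrightarrow> n \<ge> N \<Longrightarrow> nrm (completion V) (P m \<ominus>\<^bsub>completion V\<^esub> P n) < e/3"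
      using C.cauchy_seqsD[OF P, of "e/3"] e by auto
    obtain M where M: "\<And>n. n \<ge> M \<Longrightarrow> inverse (real (Suc n)) < e/3"
      using order_tendstoD(2)[OF inv, of "e/3"] e by (auto simp: eventually_sequentially)
    have "nrm V (v m \<ominus> v n) < e" if "m \<ge> max N M" "n \<ge> max N M" for m n
      using dist[of m n] N[of m n] M[of m] M[of n] that by simp
    then show "\<exists>N. \<forall>m\<ge>N. \<forall>n\<ge>N. nrm V (v m \<ominus> v n) < e" by blast
  qed (rule v)
  have lim: "(\<lambda>n. nrm (completion V) (cls (\<lambda>_. v n) \<ominus>\<^bsub>completion V\<^esub> cls v)) \<longlonglongrightarrow> 0"
  proof (rule LIMSEQ_I)
    fix e :: real assume e: "e > 0"
    obtain N where N: "\<And>m n. m \<ge> N \<Longrightarrow> n \<ge> N \<Longrightarrow> nrm V (v m \<ominus> v n) < e/2"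
      using cauchy_seqsD[OF vc, of "e/2"] e by auto
    have "norm (nrm (completion V) (cls (\<lambda>_. v k) \<ominus>\<^bsub>completion V\<^esub> cls v) - 0) < e" if "k \<ge> N" for k
    proof -
      have "(\<lambda>n. nrm V (v k \<ominus> v n)) \<longlonglongrightarrow> nrm (completion V) (cls (\<lambda>_. v k) \<ominus>\<^bsub>completion V\<^esub> cls v)"
        using nrm_cls_lim[OF diff_cauchy[OF const_cauchy[OF v] vc], of k] v vc const_cauchy
        by (simp add: diff_cls)
      then have "nrm (completion V) (cls (\<lambda>_. v k) \<ominus>\<^bsub>completion V\<^esub> cls v) \<le> e/2"
        by (rule LIMSEQ_le_const2) (use N[OF that] less_imp_le in blast)
      moreover have "nrm (completion V) (cls (\<lambda>_. v k) \<ominus>\<^bsub>completion V\<^esub> cls v) \<ge> 0"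
        using cv completion_cls[OF vc] by (simp add: C.nrm_nonneg)
      ultimately show ?thesis using e by simp
    qed
    then show "\<exists>no. \<forall>n\<ge>no. norm (nrm (completion V)
        (cls (\<lambda>_. v n) \<ominus>\<^bsub>completion V\<^esub> cls v) - 0) < e" by blast
  qed
  have "(\<lambda>n. inverse (real (Suc n)) +
      nrm (completion V) (cls (\<lambda>_. v n) \<ominus>\<^bsub>completion V\<^esub> cls v)) \<longlonglongrightarrow> 0"
    using tendsto_add[OF inv lim] by simp
  then have "(\<lambda>n. nrm (completion V) (P n \<ominus>\<^bsub>completion V\<^esub> cls v)) \<longlonglongrightarrow> 0"
  proof (rule Lim_null_comparison[rotated], intro always_eventually allI)
    fix n
    show "norm (nrm (completion V) (P n \<ominus>\<^bsub>completion V\<^esub> cls v))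
      \<le> inverse (real (Suc n)) + nrm (completion V) (cls (\<lambda>_. v n) \<ominus>\<^bsub>completion V\<^esub> cls v)"
      using C.nrm_diff_triangle[of "P n" "cls (\<lambda>_. v n)" "cls v"] vP[of n] cv
        C.cauchy_seqs_in[OF P] completion_cls[OF vc]
        C.nrm_nonneg[of "P n \<ominus>\<^bsub>completion V\<^esub> cls v"] by auto
  qed
  then show thesis using that completion_cls[OF vc] by blast
qed

end

lemma metric_space_ndist:
  assumes "seminormed V" "\<And>x. x \<in> carrier V \<Longrightarrow> nrm V x = 0 \<Longrightarrow> x = \<zero>\<^bsub>V\<^esub>"
  shows "Metric_space (carrier V) (ndist V)"
proof -
  interpret seminormed V by fact
  show ?thesis
  proof
    fix x y z
    show "0 \<le> ndist V x y" by (simp add: ndist_def nrm_nonneg)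
    show "ndist V x y = ndist V y x" using nrm_diff_swap by (auto simp: ndist_def)
    assume x: "x \<in> carrier V" and y: "y \<in> carrier V"
    then show "ndist V x y = 0 \<longleftrightarrow> x = y"
      using assms(2)[of "x \<ominus>\<^bsub>V\<^esub> y"] diff_eq_zero[of x y] by (auto simp: ndist_def diff_self nrm_zero)
    assume "z \<in> carrier V"
    then show "ndist V x z \<le> ndist V x y + ndist V y z"
      using x y nrm_diff_triangle by (auto simp: ndist_def)
  qed
qed

lemma is_banach_completion:
  assumes "seminormed V"
  shows "is_banach (completion V)"
proof -
  interpret seminormed V by fact
  interpret C: seminormed "completion V" by (rule completion_seminormed)
  interpret M: Metric_space "carrier (completion V)" "ndist (completion V)"
    using metric_space_ndist[OF completion_seminormed] completion_definite by blast
  have "M.mcomplete"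
    unfolding M.mcomplete_def
  proof (intro allI impI)
    fix P assume P: "M.MCauchy P"
    then have Pc: "P n \<in> carrier (completion V)" for n
      by (auto simp: M.MCauchy_def)
    have "P \<in> cauchy_seqs (completion V)"
      using P Pc by (intro C.cauchy_seqsI) (auto simp: M.MCauchy_def ndist_def)
    then obtain L where L: "L \<in> carrier (completion V)"
      "(\<lambda>n. nrm (completion V) (P n \<ominus>\<^bsub>completion V\<^esub> L)) \<longlonglongrightarrow> 0"
      using completion_complete by blast
    have "limitin M.mtopology P L sequentially"
      unfolding M.limitin_metric_dist_null using L Pc by (simp add: ndist_def)
    then show "\<exists>x. limitin M.mtopology P x sequentially" ..
  qed
  then show ?thesis
    using C.seminormed_axioms completion_definite by (simp add: is_banach_def is_seminormed_iff)
qed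

section \<open>Bounded operators\<close>

lemma lin_homI:
  assumes "\<And>x. x \<in> carrier E \<Longrightarrow> f x \<in> carrier F" "f \<in> extensional (carrier E)"
    "\<And>x y. x \<in> carrier E \<Longrightarrow> y \<in> carrier E \<Longrightarrow> f (x \<oplus>\<^bsub>E\<^esub> y) = f x \<oplus>\<^bsub>F\<^esub> f y"
    "\<And>c x. x \<in> carrier E \<Longrightarrow> f (c \<odot>\<^bsub>E\<^esub> x) = c \<odot>\<^bsub>F\<^esub> f x"
  shows "f \<in> lin_hom E F"
  using assms by (auto simp: lin_hom_def PiE_def)

lemma lin_homD:
  assumes "f \<in> lin_hom E F"
  shows "x \<in> carrier E \<Longrightarrow> f x \<in> carrier F" "f \<in> extensional (carrier E)"
    "x \<in> carrier E \<Longrightarrow> y \<in> carrier E \<Longrightarrow> f (x \<oplus>\<^bsub>E\<^esub> y) = f x \<oplus>\<^bsub>F\<^esub> f y"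
    "x \<in> carrier E \<Longrightarrow> f (c \<odot>\<^bsub>E\<^esub> x) = c \<odot>\<^bsub>F\<^esub> f x"
  using assms by (auto simp: lin_hom_def PiE_def)

lemma lin_hom_diff:
  assumes "complex_space E" "complex_space F" "f \<in> lin_hom E F" "x \<in> carrier E" "y \<in> carrier E"
  shows "f (x \<ominus>\<^bsub>E\<^esub> y) = f x \<ominus>\<^bsub>F\<^esub> f y"
  using assms complex_space.diff_eq[OF assms(1)] complex_space.diff_eq[OF assms(2)]
  by (simp add: lin_homD complex_space.smult_in)

lemma lin_hom_zero:
  assumes "complex_space E" "complex_space F" "f \<in> lin_hom E F"
  shows "f \<zero>\<^bsub>E\<^esub> = \<zero>\<^bsub>F\<^esub>"
proof -
  interpret E: complex_space E by fact
  interpret F: complex_space F by fact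
  have "f (0 \<odot>\<^bsub>E\<^esub> \<zero>\<^bsub>E\<^esub>) = 0 \<odot>\<^bsub>F\<^esub> f \<zero>\<^bsub>E\<^esub>"
    by (rule lin_homD(4)[OF assms(3)]) simp
  then show ?thesis
    using lin_homD(1)[OF assms(3), of "\<zero>\<^bsub>E\<^esub>"] by (simp add: E.zero_smult F.zero_smult)
qed

lemma compose_lin_hom:
  assumes "f \<in> lin_hom E F" "g \<in> lin_hom F G" "complex_space E"
  shows "compose (carrier E) g f \<in> lin_hom E G"
  by (rule lin_homI)
    (use assms in \<open>auto simp: compose_eq lin_homD complex_space.smult_in complex_space.add_closed\<close>)

text \<open>A continuous linear map sends some ball of radius \<open>r\<close> around zero into the unit ball, and
  rescaling a vector to norm \<open>r/2\<close> gives the bound \<open>2/r\<close>. Together with the converse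
  \<open>Ban_homI\<close> below, this lets morphisms of Banach spaces be handled by norm estimates, without
  their topologies.\<close>

lemma Ban_hom_bounded:
  assumes V: "is_banach V" and W: "is_banach W" and f: "f \<in> Ban_hom V W"
  obtains K where "K \<ge> 0" "\<And>x. x \<in> carrier V \<Longrightarrow> nrm W (f x) \<le> K * nrm V x"
proof -
  interpret V: seminormed V using V by (simp add: is_banach_def is_seminormed_iff)
  interpret W: seminormed W using W by (simp add: is_banach_def is_seminormed_iff)
  have Vd: "x = \<zero>\<^bsub>V\<^esub>" if "x \<in> carrier V" "nrm V x = 0" for x
    using V that by (auto simp: is_banach_def)
  have Wd: "x = \<zero>\<^bsub>W\<^esub>" if "x \<in> carrier W" "nrm W x = 0" for x
    using W that by (auto simp: is_banach_def)
  interpret MV: Metric_space "carrier V" "ndist V"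
    using metric_space_ndist[OF V.seminormed_axioms Vd] .
  interpret MW: Metric_space "carrier W" "ndist W"
    using metric_space_ndist[OF W.seminormed_axioms Wd] .
  have lin: "f \<in> lin_hom V W" and cont: "continuous_map MV.mtopology MW.mtopology f"
    using f by (auto simp: Ban_hom_def)
  note f0 = lin_hom_zero[OF V.complex_space_axioms W.complex_space_axioms lin]
  have "openin MV.mtopology {x \<in> topspace MV.mtopology. f x \<in> MW.mball \<zero>\<^bsub>W\<^esub> 1}"
    by (rule openin_continuous_map_preimage[OF cont]) simp
  moreover have "\<zero>\<^bsub>V\<^esub> \<in> {x \<in> topspace MV.mtopology. f x \<in> MW.mball \<zero>\<^bsub>W\<^esub> 1}"
    using f0 by (simp add: ndist_def W.diff_self W.nrm_zero)
  ultimately obtain r where r: "r > 0"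
    and sub: "MV.mball \<zero>\<^bsub>V\<^esub> r \<subseteq> {x \<in> topspace MV.mtopology. f x \<in> MW.mball \<zero>\<^bsub>W\<^esub> 1}"
    unfolding MV.openin_mtopology by blast
  have small: "nrm W (f x) < 1" if "x \<in> carrier V" "nrm V x < r" for x
  proof -
    have "ndist V \<zero>\<^bsub>V\<^esub> x = nrm V x"
      using that V.nrm_diff_swap[of x "\<zero>\<^bsub>V\<^esub>"] by (simp add: ndist_def V.diff_zero)
    then have "x \<in> MV.mball \<zero>\<^bsub>V\<^esub> r" using that by simp
    then have "ndist W \<zero>\<^bsub>W\<^esub> (f x) < 1" using sub by auto
    then show ?thesis
      using that lin_homD(1)[OF lin that(1)] W.nrm_diff_swap[of "f x" "\<zero>\<^bsub>W\<^esub>"]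
      by (simp add: ndist_def W.diff_zero)
  qed
  have "nrm W (f x) \<le> (2 / r) * nrm V x" if x: "x \<in> carrier V" for x
  proof (cases "nrm V x = 0")
    case True
    then show ?thesis using Vd[OF x] f0 by (simp add: W.nrm_zero)
  next
    case False
    then have pos: "nrm V x > 0" using V.nrm_nonneg[OF x] by simp
    let ?c = "complex_of_real (r / (2 * nrm V x))"
    have cmod: "cmod ?c = r / (2 * nrm V x)" using pos r by (simp only: norm_of_real) simp
    have "nrm V (?c \<odot>\<^bsub>V\<^esub> x) = r / 2"
      using pos cmod by (simp only: V.nrm_smult[OF x]) simp
    then have "nrm W (f (?c \<odot>\<^bsub>V\<^esub> x)) < 1" using small V.smult_in[OF x] r by auto
    then have "(r / (2 * nrm V x)) * nrm W (f x) < 1"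
      using cmod lin_homD(1)[OF lin x] by (simp only: lin_homD(4)[OF lin x] W.nrm_smult)
    then show ?thesis using pos r by (simp add: field_simps)
  qed
  then show thesis using that[of "2 / r"] r by simp
qed

lemma Ban_hom_lin: "f \<in> Ban_hom V W \<Longrightarrow> f \<in> lin_hom V W"
  by (simp add: Ban_hom_def)

lemma Ban_homI:
  assumes V: "is_banach V" and W: "is_banach W" and lin: "f \<in> lin_hom V W"
    and K: "\<And>x. x \<in> carrier V \<Longrightarrow> nrm W (f x) \<le> K * nrm V x"
  shows "f \<in> Ban_hom V W"
proof -
  interpret V: seminormed V using V by (simp add: is_banach_def is_seminormed_iff)
  interpret W: seminormed W using W by (simp add: is_banach_def is_seminormed_iff)
  have Vd: "x = \<zero>\<^bsub>V\<^esub>" if "x \<in> carrier V" "nrm V x = 0" for x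
    using V that by (auto simp: is_banach_def)
  have Wd: "x = \<zero>\<^bsub>W\<^esub>" if "x \<in> carrier W" "nrm W x = 0" for x
    using W that by (auto simp: is_banach_def)
  interpret MV: Metric_space "carrier V" "ndist V"
    using metric_space_ndist[OF V.seminormed_axioms Vd] .
  interpret MW: Metric_space "carrier W" "ndist W"
    using metric_space_ndist[OF W.seminormed_axioms Wd] .
  have "continuous_map MV.mtopology MW.mtopology f"
    unfolding continuous_map
  proof (intro conjI allI impI)
    show "f ` topspace MV.mtopology \<subseteq> topspace MW.mtopology"
      using lin_homD(1)[OF lin] by auto
    fix U assume U: "openin MW.mtopology U"
    show "openin MV.mtopology {x \<in> topspace MV.mtopology. f x \<in> U}"
      unfolding MV.openin_mtopology
    proof (intro conjI allI impI)
      fix x assume "x \<in> {x \<in> topspace MV.mtopology. f x \<in> U}"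
      then have x: "x \<in> carrier V" "f x \<in> U" by auto
      with U obtain r where r: "r > 0" "MW.mball (f x) r \<subseteq> U"
        unfolding MW.openin_mtopology by blast
      define d where "d = r / (\<bar>K\<bar> + 1)"
      have K1: "\<bar>K\<bar> + 1 > 0" by simp
      have d: "d > 0" using r K1 by (simp add: d_def)
      have "f y \<in> U" if y: "y \<in> carrier V" "nrm V (x \<ominus>\<^bsub>V\<^esub> y) < d" for y
      proof -
        have nn: "nrm V (x \<ominus>\<^bsub>V\<^esub> y) \<ge> 0" using x y by (simp add: V.nrm_nonneg)
        have "nrm W (f x \<ominus>\<^bsub>W\<^esub> f y) \<le> K * nrm V (x \<ominus>\<^bsub>V\<^esub> y)"
          using K[of "x \<ominus>\<^bsub>V\<^esub> y"] x y
          by (simp add: lin_hom_diff[OF V.complex_space_axioms W.complex_space_axioms lin])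
        also have "\<dots> \<le> (\<bar>K\<bar> + 1) * nrm V (x \<ominus>\<^bsub>V\<^esub> y)"
          using nn by (intro mult_right_mono) auto
        also have "\<dots> < r" using y(2) K1 by (simp add: d_def field_simps)
        finally have "f y \<in> MW.mball (f x) r"
          using x y lin_homD(1)[OF lin] by (simp add: ndist_def)
        then show ?thesis using r by blast
      qed
      then have "MV.mball x d \<subseteq> {x \<in> topspace MV.mtopology. f x \<in> U}"
        by (auto simp: ndist_def)
      then show "\<exists>r>0. MV.mball x r \<subseteq> {x \<in> topspace MV.mtopology. f x \<in> U}"
        using d by blast
    qed auto
  qed
  then show ?thesis using lin by (simp add: Ban_hom_def)
qed

lemma compose_Ban_hom:
  assumes U: "is_banach U" and V: "is_banach V" and W: "is_banach W"
    and f: "f \<in> Ban_hom U V" and g: "g \<in> Ban_hom V W"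
  shows "compose (carrier U) g f \<in> Ban_hom U W"
proof -
  obtain K where K: "K \<ge> 0" "\<And>x. x \<in> carrier U \<Longrightarrow> nrm V (f x) \<le> K * nrm U x"
    using Ban_hom_bounded[OF U V f] by blast
  obtain L where L: "L \<ge> 0" "\<And>x. x \<in> carrier V \<Longrightarrow> nrm W (g x) \<le> L * nrm V x"
    using Ban_hom_bounded[OF V W g] by blast
  have sp: "complex_space U"
    using U by (simp add: is_banach_def is_seminormed_def complex_space_def)
  show ?thesis
  proof (rule Ban_homI[OF U W compose_lin_hom[OF Ban_hom_lin[OF f] Ban_hom_lin[OF g] sp],
        where K = "L * K"])
    fix x assume x: "x \<in> carrier U"
    have "nrm W (g (f x)) \<le> L * nrm V (f x)"
      using L(2) lin_homD(1)[OF Ban_hom_lin[OF f] x] by blast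
    also have "\<dots> \<le> L * (K * nrm U x)"
      using K(2)[OF x] L(1) by (rule mult_left_mono)
    finally show "nrm W (compose (carrier U) g f x) \<le> L * K * nrm U x"
      using x by (simp add: compose_eq mult.assoc)
  qed
qed

text \<open>The map is not required to be undefined outside the carrier, so that restrictions of a map between
  the ambient locally convex spaces, in particular inclusions \<open>\<lambda>x. x\<close>, are operators between gauge
  spaces as they stand.\<close>

locale bounded_operator = V: seminormed V + W: seminormed W
  for V :: "'a nspace" and W :: "'b nspace" +
  fixes f :: "'a \<Rightarrow> 'b" and K :: real
  assumes maps: "x \<in> carrier V \<Longrightarrow> f x \<in> carrier W"
    and map_add: "x \<in> carrier V \<Longrightarrow> y \<in> carrier V \<Longrightarrow> f (x \<oplus>\<^bsub>V\<^esub> y) = f x \<oplus>\<^bsub>W\<^esub> f y"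
    and map_smult: "x \<in> carrier V \<Longrightarrow> f (c \<odot>\<^bsub>V\<^esub> x) = c \<odot>\<^bsub>W\<^esub> f x"
    and K_nonneg: "0 \<le> K"
    and bound: "x \<in> carrier V \<Longrightarrow> nrm W (f x) \<le> K * nrm V x"
begin

lemma map_diff: "x \<in> carrier V \<Longrightarrow> y \<in> carrier V \<Longrightarrow> f (x \<ominus>\<^bsub>V\<^esub> y) = f x \<ominus>\<^bsub>W\<^esub> f y"
  by (simp add: V.diff_eq W.diff_eq maps map_add map_smult V.smult_in)

lemma map_cauchy:
  assumes s: "s \<in> cauchy_seqs V"
  shows "f \<circ> s \<in> cauchy_seqs W"
proof (rule W.cauchy_seqsI)
  fix e :: real assume e: "e > 0"
  have pos: "K + 1 > 0" using K_nonneg by simp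
  obtain N where N: "\<And>m n. m \<ge> N \<Longrightarrow> n \<ge> N \<Longrightarrow> nrm V (s m \<ominus>\<^bsub>V\<^esub> s n) < e / (K + 1)"
    using V.cauchy_seqsD[OF s, of "e / (K + 1)"] e pos by auto
  have "nrm W ((f \<circ> s) m \<ominus>\<^bsub>W\<^esub> (f \<circ> s) n) < e" if "m \<ge> N" "n \<ge> N" for m n
  proof -
    have sc: "s m \<in> carrier V" "s n \<in> carrier V" using V.cauchy_seqs_in[OF s] by auto
    have "nrm W ((f \<circ> s) m \<ominus>\<^bsub>W\<^esub> (f \<circ> s) n) \<le> K * nrm V (s m \<ominus>\<^bsub>V\<^esub> s n)"
      using bound[of "s m \<ominus>\<^bsub>V\<^esub> s n"] sc by (simp add: map_diff)
    also have "\<dots> \<le> (K + 1) * nrm V (s m \<ominus>\<^bsub>V\<^esub> s n)"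
      using sc V.nrm_nonneg by (intro mult_right_mono) auto
    also have "\<dots> < e" using N[OF that] pos by (simp add: field_simps)
    finally show ?thesis .
  qed
  then show "\<exists>N. \<forall>m\<ge>N. \<forall>n\<ge>N. nrm W ((f \<circ> s) m \<ominus>\<^bsub>W\<^esub> (f \<circ> s) n) < e" by blast
qed (use s V.cauchy_seqs_in maps in auto)

lemma completion_map_cls:
  assumes s: "s \<in> cauchy_seqs V"
  shows "completion_map V W f (V.cls s) = W.cls (f \<circ> s)"
proof -
  have "W.cls (f \<circ> t) = W.cls (f \<circ> s)" if "t \<in> V.cls s" for t
  proof -
    note c = V.cls_memD[OF that]
    have "(\<lambda>n. K * nrm V (s n \<ominus>\<^bsub>V\<^esub> t n)) \<longlonglongrightarrow> 0"
      using tendsto_mult_left[OF c(3), of K] by simp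
    then have "(\<lambda>n. nrm W ((f \<circ> s) n \<ominus>\<^bsub>W\<^esub> (f \<circ> t) n)) \<longlonglongrightarrow> 0"
    proof (rule Lim_null_comparison[rotated], intro always_eventually allI)
      fix n
      have "s n \<in> carrier V" "t n \<in> carrier V" using c V.cauchy_seqs_in by auto
      then show "norm (nrm W ((f \<circ> s) n \<ominus>\<^bsub>W\<^esub> (f \<circ> t) n)) \<le> K * nrm V (s n \<ominus>\<^bsub>V\<^esub> t n)"
        using bound[of "s n \<ominus>\<^bsub>V\<^esub> t n"] W.nrm_nonneg[of "f (s n) \<ominus>\<^bsub>W\<^esub> f (t n)"] maps
        by (simp add: map_diff)
    qed
    then show ?thesis
      using c by (subst eq_commute, subst W.cls_eq_iff) (auto intro: map_cauchy)
  qed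
  then have "(\<Union>t\<in>V.cls s. W.cls (f \<circ> t)) = W.cls (f \<circ> s)"
    using s by (intro V.UN_const_class)
  then show ?thesis using V.completion_cls[OF s] by (simp add: completion_map_def)
qed

lemma completion_map_operator:
  "bounded_operator (completion V) (completion W) (completion_map V W f) K"
proof -
  interpret CV: seminormed "completion V" by (rule V.completion_seminormed)
  interpret CW: seminormed "completion W" by (rule W.completion_seminormed)
  show ?thesis
  proof
    fix P c assume "P \<in> carrier (completion V)"
    then obtain s where P: "s \<in> cauchy_seqs V" "P = V.cls s" using V.completion_cases by blast
    note sc = V.cauchy_seqs_in[OF P(1)]
    show "completion_map V W f P \<in> carrier (completion W)"
      using P by (simp add: completion_map_cls map_cauchy W.completion_cls)
    show "completion_map V W f (c \<odot>\<^bsub>completion V\<^esub> P) =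
        c \<odot>\<^bsub>completion W\<^esub> completion_map V W f P"
      using P sc by (simp add: completion_map_cls map_cauchy[unfolded o_def] V.smult_cls W.smult_cls
          V.smult_cauchy o_def map_smult)
    have "nrm (completion W) (W.cls (f \<circ> s)) \<le> K * nrm (completion V) (V.cls s)"
      by (rule LIMSEQ_le[OF W.nrm_cls_lim[OF map_cauchy[OF P(1)]]
            tendsto_mult_left[OF V.nrm_cls_lim[OF P(1)]]])
        (use bound sc in auto)
    then show "nrm (completion W) (completion_map V W f P) \<le> K * nrm (completion V) P"
      using P by (simp add: completion_map_cls)
    fix Q assume "Q \<in> carrier (completion V)"
    then obtain t where Q: "t \<in> cauchy_seqs V" "Q = V.cls t" using V.completion_cases by blast
    show "completion_map V W f (P \<oplus>\<^bsub>completion V\<^esub> Q) =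
        completion_map V W f P \<oplus>\<^bsub>completion W\<^esub> completion_map V W f Q"
      using P Q sc V.cauchy_seqs_in[OF Q(1)]
      by (simp add: completion_map_cls map_cauchy[unfolded o_def] V.add_cls W.add_cls V.add_cauchy
          o_def map_add)
  qed (rule K_nonneg)
qed

lemma completion_map_Ban_hom:
  "completion_map V W f \<in> Ban_hom (completion V) (completion W)"
proof -
  interpret C: bounded_operator "completion V" "completion W" "completion_map V W f" K
    by (rule completion_map_operator)
  show ?thesis
    by (rule Ban_homI[where K = K])
      (use C.maps C.map_add C.map_smult C.bound in
        \<open>auto intro!: is_banach_completion lin_homI V.seminormed_axioms W.seminormed_axioms
          simp: completion_map_def\<close>)
qed

end

section \<open>Locally convex spaces and bounded sets\<close>

locale lcs =
  fixes E :: "'a lctvs" (structure)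
  assumes lctvs: "is_lctvs E"

sublocale lcs \<subseteq> complex_space E
  using lctvs by (simp add: complex_space_def is_lctvs_def)

context lcs
begin

abbreviation T where "T \<equiv> topol E"

lemma topspace_T [simp]: "topspace T = carrier E"
  using lctvs by (simp add: is_lctvs_def)

lemma continuous_add:
  assumes "continuous_map X T f" "continuous_map X T g"
  shows "continuous_map X T (\<lambda>x. f x \<oplus> g x)"
proof -
  have "continuous_map (prod_topology T T) T (\<lambda>(x, y). x \<oplus> y)"
    using lctvs by (simp add: is_lctvs_def)
  from continuous_map_compose[OF continuous_map_pairedI[OF assms] this]
  show ?thesis by (simp add: o_def)
qed

lemma continuous_smult:
  assumes "continuous_map X euclidean c" "continuous_map X T f"
  shows "continuous_map X T (\<lambda>x. c x \<odot> f x)"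
proof -
  have "continuous_map (prod_topology euclidean T) T (\<lambda>(c, x). c \<odot> x)"
    using lctvs by (simp add: is_lctvs_def)
  from continuous_map_compose[OF continuous_map_pairedI[OF assms] this]
  show ?thesis by (simp add: o_def)
qed

lemma open_preimage_affine:
  assumes U: "openin T U" and x: "x \<in> carrier E"
  shows "openin T {y \<in> carrier E. a \<odot> x \<oplus> b \<odot> y \<in> U}"
proof -
  have "continuous_map T T (\<lambda>y. a \<odot> x \<oplus> b \<odot> y)"
    by (intro continuous_add continuous_smult)
      (auto intro: smult_in x continuous_map_id[unfolded id_def])
  from openin_continuous_map_preimage[OF this U] show ?thesis by simp
qed

lemma nbhd_add:
  assumes "openin T U" "\<zero> \<in> U"
  obtains V where "openin T V" "\<zero> \<in> V" "\<And>x y. x \<in> V \<Longrightarrow> y \<in> V \<Longrightarrow> x \<oplus> y \<in> U"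
proof -
  have "continuous_map (prod_topology T T) T (\<lambda>(x, y). x \<oplus> y)"
    using lctvs by (simp add: is_lctvs_def)
  from openin_continuous_map_preimage[OF this assms(1)]
  have "openin (prod_topology T T) {p \<in> carrier E \<times> carrier E. (\<lambda>(x, y). x \<oplus> y) p \<in> U}"
    by simp
  note opn = this[unfolded openin_prod_topology_alt, rule_format]
  have "(\<zero>, \<zero>) \<in> {p \<in> carrier E \<times> carrier E. (\<lambda>(x, y). x \<oplus> y) p \<in> U}"
    using assms by simp
  from opn[OF this] obtain V W where "openin T V" "openin T W" "\<zero> \<in> V" "\<zero> \<in> W"
    and VW: "V \<times> W \<subseteq> {p \<in> carrier E \<times> carrier E. (\<lambda>(x, y). x \<oplus> y) p \<in> U}"
    by blast
  then show thesis by (intro that[of "V \<inter> W"]) auto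
qed

text \<open>Joint continuity of scalar multiplication at \<open>(0, 0)\<close> controls small scalars; shrinking the
  neighbourhood turns this into control over the whole unit disc.\<close>

lemma nbhd_balanced:
  assumes "openin T U" "\<zero> \<in> U"
  obtains V where "openin T V" "\<zero> \<in> V" "\<And>c x. cmod c \<le> 1 \<Longrightarrow> x \<in> V \<Longrightarrow> c \<odot> x \<in> U"
proof -
  have "continuous_map (prod_topology euclidean T) T (\<lambda>(c, x). c \<odot> x)"
    using lctvs by (simp add: is_lctvs_def)
  from openin_continuous_map_preimage[OF this assms(1)]
  have "openin (prod_topology euclidean T) {p \<in> UNIV \<times> carrier E. (\<lambda>(c, x). c \<odot> x) p \<in> U}"
    by simp
  note opn = this[unfolded openin_prod_topology_alt, rule_format]
  have "(0, \<zero>) \<in> {p \<in> UNIV \<times> carrier E. (\<lambda>(c, x). c \<odot> x) p \<in> U}"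
    using assms by (simp add: smult_zero)
  from opn[OF this] obtain D V where D: "openin euclidean D" "0 \<in> D" and V: "openin T V" "\<zero> \<in> V"
    and DV: "D \<times> V \<subseteq> {p \<in> UNIV \<times> carrier E. (\<lambda>(c, x). c \<odot> x) p \<in> U}"
    by blast
  obtain d where d: "d > 0" "ball 0 d \<subseteq> D"
    using D by (auto simp: open_contains_ball)
  \<comment> \<open>Shrinking \<open>V\<close> by the factor \<open>d/2\<close> makes room for all scalars of the unit disc.\<close>
  define k where "k = complex_of_real (2 / d)"
  define V' where "V' = {x \<in> carrier E. 0 \<odot> \<zero> \<oplus> k \<odot> x \<in> V}"
  show thesis
  proof
    show "openin T V'" unfolding V'_def by (rule open_preimage_affine[OF V(1)]) simp
    show "\<zero> \<in> V'" using V by (simp add: V'_def smult_zero)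
    fix c x assume c: "cmod c \<le> 1" and x: "x \<in> V'"
    have xc: "x \<in> carrier E" and kx: "k \<odot> x \<in> V"
      using x by (auto simp: V'_def smult_zero smult_in)
    have "cmod c * d \<le> 1 * d" using c d by (intro mult_right_mono) auto
    then have "cmod (c / k) < d" using d by (simp add: k_def norm_divide norm_mult)
    then have "c / k \<in> D" using d by auto
    then have "(c / k) \<odot> (k \<odot> x) \<in> U" using kx DV by auto
    then show "c \<odot> x \<in> U" using d xc by (simp add: smult_smult k_def)
  qed
qed

text \<open>Boundedness only provides one dilation of each neighbourhood that contains \<open>B\<close>. Applied to a
  balanced neighbourhood it controls all sufficiently small multiples of \<open>B\<close>, which is the form that
  can be combined for several sets.\<close>

lemma bounded_absorbed:
  assumes B: "bounded_in E B" and U: "openin T U" "\<zero> \<in> U"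
  obtains e where "e > 0" "\<And>c x. cmod c \<le> e \<Longrightarrow> x \<in> B \<Longrightarrow> c \<odot> x \<in> U"
proof -
  obtain V where V: "openin T V" "\<zero> \<in> V" "\<And>c x. cmod c \<le> 1 \<Longrightarrow> x \<in> V \<Longrightarrow> c \<odot> x \<in> U"
    using nbhd_balanced[OF U] by blast
  obtain r where r: "r > 0" "B \<subseteq> (\<lambda>x. complex_of_real r \<odot> x) ` V"
    using B V by (auto simp: bounded_in_def)
  have "c \<odot> x \<in> U" if c: "cmod c \<le> 1 / r" and x: "x \<in> B" for c x
  proof -
    obtain v where v: "v \<in> V" "x = complex_of_real r \<odot> v" using r x by blast
    have vc: "v \<in> carrier E" using v openin_subset[OF V(1)] by auto
    have "cmod (c * complex_of_real r) \<le> 1" using c r by (simp add: norm_mult field_simps)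
    then have "(c * complex_of_real r) \<odot> v \<in> U" using V v by blast
    then show ?thesis using v vc by (simp add: smult_smult)
  qed
  then show thesis using that[of "1 / r"] r by simp
qed

lemma bounded_inI:
  assumes "B \<subseteq> carrier E"
    and "\<And>U. openin T U \<Longrightarrow> \<zero> \<in> U \<Longrightarrow> \<exists>e>0. \<forall>x\<in>B. complex_of_real e \<odot> x \<in> U"
  shows "bounded_in E B"
  unfolding bounded_in_def
proof (intro conjI allI impI)
  fix U assume "openin T U \<and> \<zero> \<in> U"
  then obtain e where e: "e > 0" "\<forall>x\<in>B. complex_of_real e \<odot> x \<in> U" using assms(2) by blast
  have "B \<subseteq> (\<lambda>x. complex_of_real (1 / e) \<odot> x) ` U"
  proof
    fix x assume x: "x \<in> B"
    then have "x = complex_of_real (1 / e) \<odot> (complex_of_real e \<odot> x)"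
      using assms(1) e by (auto simp: smult_smult one_smult subset_iff)
    then show "x \<in> (\<lambda>x. complex_of_real (1 / e) \<odot> x) ` U" using e x by blast
  qed
  then show "\<exists>r>0. B \<subseteq> (\<lambda>x. complex_of_real r \<odot> x) ` U" using e by (intro exI[of _ "1 / e"]) auto
qed (rule assms)

lemma bounded_subset: "bounded_in E C \<Longrightarrow> B \<subseteq> C \<Longrightarrow> bounded_in E B"
  unfolding bounded_in_def by (meson order_trans)

lemma bounded_scaled:
  assumes B: "bounded_in E B"
  shows "bounded_in E ((\<lambda>x. c \<odot> x) ` B)"
proof (rule bounded_inI)
  have Bc: "B \<subseteq> carrier E" using B by (simp add: bounded_in_def)
  then show "(\<lambda>x. c \<odot> x) ` B \<subseteq> carrier E" by (auto simp: smult_in)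
  fix U assume U: "openin T U" "\<zero> \<in> U"
  obtain e where e: "e > 0" "\<And>c x. cmod c \<le> e \<Longrightarrow> x \<in> B \<Longrightarrow> c \<odot> x \<in> U"
    using bounded_absorbed[OF B U] by blast
  define d where "d = e / (cmod c + 1)"
  have p: "cmod c + 1 > 0" by (simp add: add_nonneg_pos)
  have d: "d > 0" using e p by (simp add: d_def)
  have "d * cmod c \<le> d * (cmod c + 1)" using d by simp
  also have "\<dots> = e" using p by (simp add: d_def)
  finally have "cmod (complex_of_real d * c) \<le> e" using d by (simp add: norm_mult)
  then have "\<forall>x\<in>(\<lambda>x. c \<odot> x) ` B. complex_of_real d \<odot> x \<in> U"
    using e Bc by (auto simp: smult_smult subset_iff)
  then show "\<exists>e>0. \<forall>x\<in>(\<lambda>x. c \<odot> x) ` B. complex_of_real e \<odot> x \<in> U" using d by blast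
qed

text \<open>A point of the closure differs from a point of \<open>B\<close> by an arbitrarily small vector, so a multiple
  of the closure lies in \<open>W + W\<close> as soon as the same multiple of \<open>B\<close> lies in \<open>W\<close>.\<close>

lemma bounded_closure:
  assumes B: "bounded_in E B"
  shows "bounded_in E (T closure_of B)"
proof (rule bounded_inI)
  have Bc: "B \<subseteq> carrier E" using B by (simp add: bounded_in_def)
  show "T closure_of B \<subseteq> carrier E" using closure_of_subset_topspace[of T B] by simp
  fix U assume U: "openin T U" "\<zero> \<in> U"
  obtain W where W: "openin T W" "\<zero> \<in> W" "\<And>x y. x \<in> W \<Longrightarrow> y \<in> W \<Longrightarrow> x \<oplus> y \<in> U"
    using nbhd_add[OF U] by blast
  obtain e where e: "e > 0" "\<And>c x. cmod c \<le> e \<Longrightarrow> x \<in> B \<Longrightarrow> c \<odot> x \<in> W"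
    using bounded_absorbed[OF B W(1,2)] by blast
  let ?e = "complex_of_real e"
  have "?e \<odot> x \<in> U" if x: "x \<in> T closure_of B" for x
  proof -
    have xc: "x \<in> carrier E" using x closure_of_subset_topspace[of T B] by auto
    let ?O = "{y \<in> carrier E. ?e \<odot> x \<oplus> (- ?e) \<odot> y \<in> W}"
    have diff: "?e \<odot> x \<oplus> (- ?e) \<odot> y = ?e \<odot> (x \<ominus> y)" if "y \<in> carrier E" for y
      using xc that by (simp add: diff_eq smult_add_right smult_smult smult_in)
    have "x \<in> ?O" using xc W by (simp add: diff diff_self smult_zero)
    moreover have "openin T ?O" by (rule open_preimage_affine[OF W(1) xc])
    ultimately have "\<exists>y. y \<in> B \<and> y \<in> ?O"
      using x[unfolded in_closure_of] by (elim conjE allE[of _ ?O]) simp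
    then obtain y where y: "y \<in> B" "?e \<odot> x \<oplus> (- ?e) \<odot> y \<in> W" by blast
    have yc: "y \<in> carrier E" using y Bc by blast
    have "?e \<odot> y \<in> W" using e y by simp
    then have "(?e \<odot> x \<oplus> (- ?e) \<odot> y) \<oplus> ?e \<odot> y \<in> U" using W y by blast
    moreover have "(?e \<odot> x \<oplus> (- ?e) \<odot> y) \<oplus> ?e \<odot> y = ?e \<odot> x"
      using xc yc
      by (simp add: M.a_assoc smult_in smult_add_left[symmetric] zero_smult)
    ultimately show ?thesis by simp
  qed
  then show "\<exists>e>0. \<forall>x\<in>T closure_of B. complex_of_real e \<odot> x \<in> U" using e by blast
qed

lemma bounded_sum:
  assumes B: "bounded_in E B" and C: "bounded_in E C"
  shows "bounded_in E {x \<oplus> y | x y. x \<in> B \<and> y \<in> C}"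
proof (rule bounded_inI)
  have Bc: "B \<subseteq> carrier E" "C \<subseteq> carrier E" using B C by (auto simp: bounded_in_def)
  then show "{x \<oplus> y | x y. x \<in> B \<and> y \<in> C} \<subseteq> carrier E" by auto
  fix U assume U: "openin T U" "\<zero> \<in> U"
  obtain W where W: "openin T W" "\<zero> \<in> W" "\<And>x y. x \<in> W \<Longrightarrow> y \<in> W \<Longrightarrow> x \<oplus> y \<in> U"
    using nbhd_add[OF U] by blast
  obtain e where e: "e > 0" "\<And>c x. cmod c \<le> e \<Longrightarrow> x \<in> B \<Longrightarrow> c \<odot> x \<in> W"
    using bounded_absorbed[OF B W(1,2)] by blast
  obtain d where d: "d > 0" "\<And>c x. cmod c \<le> d \<Longrightarrow> x \<in> C \<Longrightarrow> c \<odot> x \<in> W"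
    using bounded_absorbed[OF C W(1,2)] by blast
  have "complex_of_real (min d e) \<odot> (x \<oplus> y) \<in> U" if "x \<in> B" "y \<in> C" for x y
  proof -
    have m: "cmod (complex_of_real (min d e)) = min d e"
      using d e by (simp only: norm_of_real)
    have "complex_of_real (min d e) \<odot> x \<in> W" "complex_of_real (min d e) \<odot> y \<in> W"
      using d(2)[of "complex_of_real (min d e)" y] e(2)[of "complex_of_real (min d e)" x] m that
      by simp_all
    then show ?thesis using W Bc that by (simp add: smult_add_right subset_iff)
  qed
  then show "\<exists>e>0. \<forall>x\<in>{x \<oplus> y | x y. x \<in> B \<and> y \<in> C}. complex_of_real e \<odot> x \<in> U"
    using d e by (intro exI[of _ "min d e"]) auto
qed

end

lemma bounded_image:
  assumes E: "lcs E" and F: "lcs F" and f: "f \<in> Tc_hom E F" and B: "bounded_in E B"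
  shows "bounded_in F (f ` B)"
proof -
  interpret E: lcs E by fact
  interpret F: lcs F by fact
  have lin: "f \<in> lin_hom E F" and cont: "continuous_map E.T F.T f"
    using f by (auto simp: Tc_hom_def)
  have Bc: "B \<subseteq> carrier E" using B by (simp add: bounded_in_def)
  show ?thesis
  proof (rule F.bounded_inI)
    show "f ` B \<subseteq> carrier F" using Bc lin_homD(1)[OF lin] by auto
    fix U assume U: "openin F.T U" "\<zero>\<^bsub>F\<^esub> \<in> U"
    have o: "openin E.T {x \<in> carrier E. f x \<in> U}"
      using openin_continuous_map_preimage[OF cont U(1)] by simp
    have z: "\<zero>\<^bsub>E\<^esub> \<in> {x \<in> carrier E. f x \<in> U}"
      using U lin_hom_zero[OF E.complex_space_axioms F.complex_space_axioms lin] by simp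
    obtain e where e: "e > 0"
      "\<And>c x. cmod c \<le> e \<Longrightarrow> x \<in> B \<Longrightarrow> c \<odot>\<^bsub>E\<^esub> x \<in> {x \<in> carrier E. f x \<in> U}"
      using E.bounded_absorbed[OF B o z] by blast
    have "complex_of_real e \<odot>\<^bsub>F\<^esub> f x \<in> U" if "x \<in> B" for x
      using e(2)[of "complex_of_real e" x] e(1) that Bc lin_homD(4)[OF lin, of x] by auto
    then show "\<exists>e>0. \<forall>x\<in>f ` B. complex_of_real e \<odot>\<^bsub>F\<^esub> x \<in> U" using e(1) by blast
  qed
qed

section \<open>Absolutely convex bounded sets and their gauges\<close>

context lcs
begin

lemma disks_carrier: "B \<in> disks E \<Longrightarrow> x \<in> B \<Longrightarrow> x \<in> carrier E"
  by (auto simp: disks_def abs_convex_in_def)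

lemma disks_bounded: "B \<in> disks E \<Longrightarrow> bounded_in E B"
  by (simp add: disks_def)

lemma disks_combine:
  assumes "B \<in> disks E" "x \<in> B" "y \<in> B" "cmod a + cmod b \<le> 1"
  shows "a \<odot> x \<oplus> b \<odot> y \<in> B"
  using assms by (simp add: disks_def abs_convex_in_def)

lemma disks_smult:
  assumes "B \<in> disks E" "x \<in> B" "cmod a \<le> 1"
  shows "a \<odot> x \<in> B"
  using disks_combine[OF assms(1,2,2), of a 0] assms disks_carrier[OF assms(1,2)]
  by (simp add: zero_smult smult_in)

lemma disks_zero:
  assumes "B \<in> disks E"
  shows "\<zero> \<in> B"
proof -
  obtain x where x: "x \<in> B" using assms by (auto simp: disks_def abs_convex_in_def)
  show ?thesis
    using disks_smult[OF assms x, of 0] disks_carrier[OF assms x] by (simp add: zero_smult)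
qed

lemma zero_disk: "{\<zero>} \<in> disks E"
  unfolding disks_def
proof (intro CollectI conjI)
  show "abs_convex_in E {\<zero>}" by (simp add: abs_convex_in_def smult_zero)
  show "bounded_in E {\<zero>}" by (rule bounded_inI) (auto simp: smult_zero intro: exI[of _ 1])
qed

text \<open>The sum of two disks contains both, because disks contain zero. This makes the index category of
  \<open>IB E\<close> directed, with a bound that is easier to handle than the absolutely convex hull of the
  union.\<close>

lemma sum_disk:
  assumes B: "B \<in> disks E" and C: "C \<in> disks E"
  shows "{x \<oplus> y | x y. x \<in> B \<and> y \<in> C} \<in> disks E" (is "?D \<in> _")
    and "B \<subseteq> {x \<oplus> y | x y. x \<in> B \<and> y \<in> C}" and "C \<subseteq> {x \<oplus> y | x y. x \<in> B \<and> y \<in> C}"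
proof -
  note c = disks_carrier[OF B] disks_carrier[OF C]
  have "abs_convex_in E ?D"
    unfolding abs_convex_in_def
  proof (intro conjI ballI allI impI)
    show "?D \<subseteq> carrier E" using c by auto
    show "?D \<noteq> {}" using disks_zero[OF B] disks_zero[OF C] by auto
    fix u v a b assume "u \<in> ?D" "v \<in> ?D" and ab: "cmod a + cmod b \<le> 1"
    then obtain x y x' y' where u: "u = x \<oplus> y" "x \<in> B" "y \<in> C"
      and v: "v = x' \<oplus> y'" "x' \<in> B" "y' \<in> C" by blast
    have "a \<odot> u \<oplus> b \<odot> v = (a \<odot> x \<oplus> b \<odot> x') \<oplus> (a \<odot> y \<oplus> b \<odot> y')"
      using u v c by (simp add: smult_add_right smult_in M.a_ac)
    then show "a \<odot> u \<oplus> b \<odot> v \<in> ?D"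
      using disks_combine[OF B u(2) v(2) ab] disks_combine[OF C u(3) v(3) ab] by blast
  qed
  then show "?D \<in> disks E"
    using bounded_sum[OF disks_bounded[OF B] disks_bounded[OF C]] by (simp only: disks_def mem_Collect_eq)
  show "B \<subseteq> ?D"
  proof
    fix x assume "x \<in> B"
    then have "x = x \<oplus> \<zero>" using c by simp
    then show "x \<in> ?D" using \<open>x \<in> B\<close> disks_zero[OF C] by blast
  qed
  show "C \<subseteq> ?D"
  proof
    fix x assume "x \<in> C"
    then have "x = \<zero> \<oplus> x" using c by simp
    then show "x \<in> ?D" using \<open>x \<in> C\<close> disks_zero[OF B] by blast
  qed
qed

text \<open>The map \<open>(u, v) \<mapsto> a u + b v\<close> is continuous and sends \<open>B \<times> B\<close> into \<open>B\<close>, hence sends the closure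
  of \<open>B \<times> B\<close> into the closure of \<open>B\<close>.\<close>

lemma closure_disk:
  assumes B: "B \<in> disks E"
  shows "T closure_of B \<in> disks E"
  unfolding disks_def abs_convex_in_def
proof (intro CollectI conjI ballI allI impI)
  show "T closure_of B \<subseteq> carrier E" using closure_of_subset_topspace[of T B] by simp
  have "B \<subseteq> T closure_of B" using disks_carrier[OF B] by (intro closure_of_subset) auto
  then show "T closure_of B \<noteq> {}" using disks_zero[OF B] by auto
  show "bounded_in E (T closure_of B)" using bounded_closure disks_bounded B by blast
  fix u v a b assume uv: "u \<in> T closure_of B" "v \<in> T closure_of B" and ab: "cmod a + cmod b \<le> 1"
  let ?f = "\<lambda>p. a \<odot> fst p \<oplus> b \<odot> snd p"
  have "continuous_map (prod_topology T T) T ?f"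
    by (intro continuous_add continuous_smult continuous_map_fst continuous_map_snd) auto
  then have "?f ` (prod_topology T T closure_of (B \<times> B)) \<subseteq> T closure_of (?f ` (B \<times> B))"
    by (rule continuous_map_image_closure_subset)
  moreover have "T closure_of (?f ` (B \<times> B)) \<subseteq> T closure_of B"
    by (rule closure_of_mono) (use disks_combine[OF B] ab in auto)
  moreover have "(u, v) \<in> prod_topology T T closure_of (B \<times> B)"
    using uv by (simp add: closure_of_Times)
  ultimately show "a \<odot> u \<oplus> b \<odot> v \<in> T closure_of B" by force
qed

lemma mem_scaled_iff:
  assumes "B \<subseteq> carrier E" "x \<in> carrier E" "r > 0"
  shows "x \<in> (\<lambda>b. complex_of_real r \<odot> b) ` B \<longleftrightarrow> complex_of_real (inverse r) \<odot> x \<in> B"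
proof
  assume "x \<in> (\<lambda>b. complex_of_real r \<odot> b) ` B"
  then obtain b where b: "b \<in> B" "x = complex_of_real r \<odot> b" by blast
  then show "complex_of_real (inverse r) \<odot> x \<in> B"
    using assms by (simp add: smult_smult one_smult subset_iff)
next
  assume *: "complex_of_real (inverse r) \<odot> x \<in> B"
  have "x = complex_of_real r \<odot> (complex_of_real (inverse r) \<odot> x)"
    using assms by (simp add: smult_smult one_smult)
  then show "x \<in> (\<lambda>b. complex_of_real r \<odot> b) ` B" using * by blast
qed

text \<open>The positive multiples of a disk already form a linear subspace: if \<open>x\<close> lies in \<open>r B\<close> and \<open>y\<close> in
  \<open>s B\<close>, then \<open>a x + b y\<close> lies in \<open>t B\<close> for every positive \<open>t \<ge> \<bar>a\<bar> r + \<bar>b\<bar> s\<close>.\<close>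

lemma lin_hull_disk:
  assumes B: "B \<in> disks E"
  shows "lin_hull E B = {x \<in> carrier E. \<exists>r>0. complex_of_real (inverse r) \<odot> x \<in> B}" (is "_ = ?H")
proof
  have Bc: "B \<subseteq> carrier E" using disks_carrier[OF B] by auto
  have comb: "a \<odot> x \<oplus> b \<odot> y \<in> ?H" if xy: "x \<in> ?H" "y \<in> ?H" for a b x y
  proof -
    obtain r s where r: "r > 0" "complex_of_real (inverse r) \<odot> x \<in> B"
      and s: "s > 0" "complex_of_real (inverse s) \<odot> y \<in> B"
      and c: "x \<in> carrier E" "y \<in> carrier E" using xy by blast
    \<comment> \<open>The summand 1 keeps \<open>t\<close> positive when \<open>a\<close> and \<open>b\<close> vanish.\<close>
    define t where "t = cmod a * r + cmod b * s + 1"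
    have t: "t > 0" using r s by (simp add: t_def add_nonneg_pos)
    have "cmod (a * complex_of_real (r / t)) + cmod (b * complex_of_real (s / t))
        = (cmod a * r + cmod b * s) / t"
      using r s t by (simp add: norm_mult norm_divide add_divide_distrib)
    also have "\<dots> \<le> 1" using t by (simp add: t_def)
    finally have "(a * complex_of_real (r / t)) \<odot> (complex_of_real (inverse r) \<odot> x) \<oplus>
        (b * complex_of_real (s / t)) \<odot> (complex_of_real (inverse s) \<odot> y) \<in> B"
      by (rule disks_combine[OF B r(2) s(2)])
    moreover have "(a * complex_of_real (r / t)) \<odot> (complex_of_real (inverse r) \<odot> x) \<oplus>
        (b * complex_of_real (s / t)) \<odot> (complex_of_real (inverse s) \<odot> y)
        = complex_of_real (inverse t) \<odot> (a \<odot> x \<oplus> b \<odot> y)"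
      using c r s t
      by (simp add: smult_smult smult_in smult_add_right field_simps)
    ultimately show ?thesis using c t by (auto simp: smult_in)
  qed
  have add: "x \<oplus> y \<in> ?H" if "x \<in> ?H" "y \<in> ?H" for x y
    using comb[OF that, of 1 1] that by (simp add: one_smult)
  have sm: "a \<odot> x \<in> ?H" if "x \<in> ?H" for x a
    using comb[OF that that, of a 0] that by (simp add: zero_smult smult_in)
  have "submodule ?H complex_ring E"
  proof (rule submoduleI)
    show z: "\<zero> \<in> ?H" using disks_zero[OF B] by (auto simp: smult_zero intro: exI[of _ 1])
    show "\<ominus> x \<in> ?H" if "x \<in> ?H" for x
    proof -
      have "\<ominus> x = (-1) \<odot> x"
        using that diff_eq[of \<zero> x] by (simp add: a_minus_def smult_in)
      with sm[OF that, of "-1"] show ?thesis by (simp only:)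
    qed
  qed (use add sm in auto)
  moreover have "B \<subseteq> ?H"
    using Bc by (auto intro!: exI[of _ "1::real"] simp: one_smult subset_iff)
  ultimately show "lin_hull E B \<subseteq> ?H" unfolding lin_hull_def by blast
  show "?H \<subseteq> lin_hull E B"
    unfolding lin_hull_def
  proof (intro subsetI InterI)
    fix x S assume x: "x \<in> ?H" and S: "S \<in> {S. submodule S complex_ring E \<and> B \<subseteq> S}"
    then obtain r where r: "r > 0" "complex_of_real (inverse r) \<odot> x \<in> B" and xc: "x \<in> carrier E"
      by blast
    have "complex_of_real r \<odot> (complex_of_real (inverse r) \<odot> x) \<in> S"
      using S r submoduleE(4)[of S "complex_of_real r"] by auto
    then show "x \<in> S" using r xc by (simp add: smult_smult one_smult)
  qed
qed

lemma lin_hullI: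
  assumes "B \<in> disks E" "x \<in> carrier E" "r > 0" "complex_of_real (inverse r) \<odot> x \<in> B"
  shows "x \<in> lin_hull E B"
  using assms by (auto simp: lin_hull_disk)

lemma lin_hull_carrier: "B \<in> disks E \<Longrightarrow> x \<in> lin_hull E B \<Longrightarrow> x \<in> carrier E"
  by (simp add: lin_hull_disk)

lemma gauge_set:
  assumes B: "B \<in> disks E" and x: "x \<in> carrier E"
  shows "gauge_in E B x = Inf {r. 0 < r \<and> complex_of_real (inverse r) \<odot> x \<in> B}"
proof -
  have "B \<subseteq> carrier E" using disks_carrier[OF B] by auto
  then have "{r. 0 < r \<and> x \<in> (\<lambda>b. complex_of_real r \<odot> b) ` B}
      = {r. 0 < r \<and> complex_of_real (inverse r) \<odot> x \<in> B}"
    using mem_scaled_iff[OF _ x] by blast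
  then show ?thesis by (simp add: gauge_in_def)
qed

lemma gauge_le:
  assumes B: "B \<in> disks E" and x: "x \<in> carrier E"
    and r: "0 < r" "complex_of_real (inverse r) \<odot> x \<in> B"
  shows "gauge_in E B x \<le> r"
  unfolding gauge_set[OF B x]
  by (rule cInf_lower) (use r in \<open>auto intro!: bdd_belowI[of _ 0]\<close>)

lemma gauge_nonneg:
  assumes B: "B \<in> disks E" and x: "x \<in> lin_hull E B"
  shows "0 \<le> gauge_in E B x"
proof -
  have xc: "x \<in> carrier E" using lin_hull_carrier[OF B x] .
  have "\<exists>r>0. complex_of_real (inverse r) \<odot> x \<in> B"
    using x by (simp add: lin_hull_disk[OF B])
  then show ?thesis
    unfolding gauge_set[OF B xc] by (intro cInf_greatest) auto
qed

text \<open>The infimum defining the gauge need not be attained, but the set over which it is taken is closed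
  upwards, so that every number above the gauge belongs to it.\<close>

lemma gauge_less:
  assumes B: "B \<in> disks E" and x: "x \<in> lin_hull E B" and r: "gauge_in E B x < r"
  shows "complex_of_real (inverse r) \<odot> x \<in> B"
proof -
  have xc: "x \<in> carrier E" using lin_hull_carrier[OF B x] .
  have ne: "{r. 0 < r \<and> complex_of_real (inverse r) \<odot> x \<in> B} \<noteq> {}"
    using x by (simp add: lin_hull_disk[OF B])
  obtain s where s: "0 < s" "complex_of_real (inverse s) \<odot> x \<in> B" "s < r"
    using cInf_lessD[OF ne r[unfolded gauge_set[OF B xc]]] by blast
  have "complex_of_real (s / r) \<odot> (complex_of_real (inverse s) \<odot> x) \<in> B"
    by (rule disks_smult[OF B s(2)]) (use s in \<open>simp add: norm_divide\<close>)
  then show ?thesis using s xc by (simp add: smult_smult field_simps)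
qed

text \<open>Only one inequality has to be proved; the other one is the same inequality for the inverse
  scalar.\<close>

lemma gauge_smult_le:
  assumes B: "B \<in> disks E" and x: "x \<in> lin_hull E B" and c: "c \<noteq> 0"
  shows "c \<odot> x \<in> lin_hull E B" "gauge_in E B (c \<odot> x) \<le> cmod c * gauge_in E B x"
proof -
  have xc: "x \<in> carrier E" using lin_hull_carrier[OF B x] .
  have *: "complex_of_real (inverse (cmod c * r)) \<odot> (c \<odot> x) \<in> B"
    if r: "gauge_in E B x < r" for r
  proof -
    have r0: "r > 0" using r gauge_nonneg[OF B x] by simp
    have "(c / complex_of_real (cmod c)) \<odot> (complex_of_real (inverse r) \<odot> x) \<in> B"
      by (rule disks_smult[OF B gauge_less[OF B x r]]) (use c in \<open>simp add: norm_divide\<close>)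
    then show ?thesis using c r0 xc by (simp add: smult_smult field_simps)
  qed
  show "c \<odot> x \<in> lin_hull E B"
    by (rule lin_hullI[OF B _ _ *[of "gauge_in E B x + 1"]])
      (use c xc gauge_nonneg[OF B x] in \<open>auto simp: smult_in\<close>)
  have le: "gauge_in E B (c \<odot> x) \<le> cmod c * r" if r: "gauge_in E B x < r" for r
    by (rule gauge_le[OF B _ _ *[OF r]])
      (use c xc gauge_nonneg[OF B x] r in \<open>auto simp: smult_in\<close>)
  show "gauge_in E B (c \<odot> x) \<le> cmod c * gauge_in E B x"
  proof (rule field_le_epsilon)
    fix e :: real assume "e > 0"
    then have "gauge_in E B (c \<odot> x) \<le> cmod c * (gauge_in E B x + e / cmod c)"
      using c by (intro le) simp
    then show "gauge_in E B (c \<odot> x) \<le> cmod c * gauge_in E B x + e"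
      using c by (simp add: distrib_left)
  qed
qed

lemma gauge_add:
  assumes B: "B \<in> disks E" and x: "x \<in> lin_hull E B" and y: "y \<in> lin_hull E B"
  shows "x \<oplus> y \<in> lin_hull E B" "gauge_in E B (x \<oplus> y) \<le> gauge_in E B x + gauge_in E B y"
proof -
  have c: "x \<in> carrier E" "y \<in> carrier E" using lin_hull_carrier[OF B] x y by auto
  have *: "complex_of_real (inverse (r + s)) \<odot> (x \<oplus> y) \<in> B" "r > 0" "s > 0"
    if r: "gauge_in E B x < r" and s: "gauge_in E B y < s" for r s
  proof -
    show r0: "r > 0" "s > 0" using r s gauge_nonneg[OF B x] gauge_nonneg[OF B y] by auto
    have "cmod (complex_of_real (r / (r + s))) + cmod (complex_of_real (s / (r + s))) = 1"
      using r0 by (simp only: norm_of_real) (simp add: add_divide_distrib[symmetric])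
    then have "complex_of_real (r / (r + s)) \<odot> (complex_of_real (inverse r) \<odot> x) \<oplus>
        complex_of_real (s / (r + s)) \<odot> (complex_of_real (inverse s) \<odot> y) \<in> B"
      by (intro disks_combine[OF B gauge_less[OF B x r] gauge_less[OF B y s]]) simp
    then show "complex_of_real (inverse (r + s)) \<odot> (x \<oplus> y) \<in> B"
      using r0 c by (simp add: smult_smult smult_add_right field_simps)
  qed
  show "x \<oplus> y \<in> lin_hull E B"
    by (rule lin_hullI[OF B _ _ *(1)[of "gauge_in E B x + 1" "gauge_in E B y + 1"]])
      (use c gauge_nonneg[OF B x] gauge_nonneg[OF B y] in auto)
  show "gauge_in E B (x \<oplus> y) \<le> gauge_in E B x + gauge_in E B y"
  proof (rule field_le_epsilon)
    fix e :: real assume e: "e > 0"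
    have "gauge_in E B (x \<oplus> y) \<le> (gauge_in E B x + e / 2) + (gauge_in E B y + e / 2)"
      by (rule gauge_le[OF B _ _ *(1)])
        (use c e gauge_nonneg[OF B x] gauge_nonneg[OF B y] in auto)
    then show "gauge_in E B (x \<oplus> y) \<le> gauge_in E B x + gauge_in E B y + e" by simp
  qed
qed

lemma zero_hull: "B \<in> disks E \<Longrightarrow> \<zero> \<in> lin_hull E B"
  by (rule lin_hullI[where r = 1]) (auto simp: smult_zero disks_zero)

lemma gauge_zero:
  assumes B: "B \<in> disks E"
  shows "gauge_in E B \<zero> = 0"
proof (rule antisym)
  show "gauge_in E B \<zero> \<le> 0"
    by (rule field_le_epsilon) (use gauge_le[OF B, of \<zero>] disks_zero[OF B] in \<open>auto simp: smult_zero\<close>)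
qed (rule gauge_nonneg[OF B zero_hull[OF B]])

lemma hull_smult:
  assumes B: "B \<in> disks E" and x: "x \<in> lin_hull E B"
  shows "c \<odot> x \<in> lin_hull E B" "gauge_in E B (c \<odot> x) = cmod c * gauge_in E B x"
proof -
  have xc: "x \<in> carrier E" using lin_hull_carrier[OF B x] .
  have "c \<odot> x \<in> lin_hull E B \<and> gauge_in E B (c \<odot> x) = cmod c * gauge_in E B x"
  proof (cases "c = 0")
    case True
    then show ?thesis using xc by (simp add: zero_smult zero_hull[OF B] gauge_zero[OF B])
  next
    case False
    note le = gauge_smult_le[OF B x False]
    have "gauge_in E B (inverse c \<odot> (c \<odot> x)) \<le> cmod (inverse c) * gauge_in E B (c \<odot> x)"
      using False by (intro gauge_smult_le(2)[OF B le(1)]) simp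
    then have "gauge_in E B x \<le> inverse (cmod c) * gauge_in E B (c \<odot> x)"
      using False xc by (simp add: smult_smult one_smult norm_inverse)
    then have "cmod c * gauge_in E B x \<le> gauge_in E B (c \<odot> x)"
      using False by (simp add: field_simps)
    then show ?thesis using le by simp
  qed
  then show "c \<odot> x \<in> lin_hull E B" "gauge_in E B (c \<odot> x) = cmod c * gauge_in E B x" by auto
qed

lemma gauge_space_simps [simp]:
  "carrier (gauge_space E B) = lin_hull E B"
  "x \<oplus>\<^bsub>gauge_space E B\<^esub> y = x \<oplus> y"
  "c \<odot>\<^bsub>gauge_space E B\<^esub> x = c \<odot> x"
  "\<zero>\<^bsub>gauge_space E B\<^esub> = \<zero>"
  "nrm (gauge_space E B) x = gauge_in E B x"
  by (simp_all add: gauge_space_def)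

lemma gauge_seminormed:
  assumes B: "B \<in> disks E"
  shows "seminormed (gauge_space E B)"
proof -
  have "complex_space (gauge_space E B)"
    by (rule complex_space.intro, rule complex_vsI)
      (use B in \<open>auto simp: gauge_add hull_smult zero_hull lin_hull_carrier smult_smult one_smult
        zero_smult smult_add_left smult_add_right M.a_ac\<close>)
  then show ?thesis
    using B by (auto simp: seminormed_def seminormed_axioms_def gauge_nonneg gauge_add hull_smult)
qed

lemma gauge_diff:
  assumes B: "B \<in> disks E" and "x \<in> lin_hull E B" "y \<in> lin_hull E B"
  shows "x \<ominus>\<^bsub>gauge_space E B\<^esub> y = x \<ominus> y"
proof -
  interpret G: seminormed "gauge_space E B" by (rule gauge_seminormed[OF B])
  show ?thesis using assms G.diff_eq[of x y] by (simp add: diff_eq lin_hull_carrier)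
qed

end

text \<open>A linear map carrying one disk into another is a contraction for the gauges.\<close>

lemma gauge_operator:
  assumes E: "lcs E" and F: "lcs F" and B: "B \<in> disks E" and C: "C \<in> disks F"
    and f: "\<And>x. x \<in> carrier E \<Longrightarrow> f x \<in> carrier F"
      "\<And>x y. x \<in> carrier E \<Longrightarrow> y \<in> carrier E \<Longrightarrow> f (x \<oplus>\<^bsub>E\<^esub> y) = f x \<oplus>\<^bsub>F\<^esub> f y"
      "\<And>c x. x \<in> carrier E \<Longrightarrow> f (c \<odot>\<^bsub>E\<^esub> x) = c \<odot>\<^bsub>F\<^esub> f x"
    and sub: "f ` B \<subseteq> C"
  shows "bounded_operator (gauge_space E B) (gauge_space F C) f 1"
proof -
  interpret E: lcs E by fact
  interpret F: lcs F by fact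
  interpret GE: seminormed "gauge_space E B" by (rule E.gauge_seminormed[OF B])
  interpret GF: seminormed "gauge_space F C" by (rule F.gauge_seminormed[OF C])
  have *: "complex_of_real (inverse r) \<odot>\<^bsub>F\<^esub> f x \<in> C"
    if x: "x \<in> lin_hull E B" and r: "gauge_in E B x < r" for x r
    using E.gauge_less[OF B x r] sub f(3)[OF E.lin_hull_carrier[OF B x]] by (metis image_subset_iff)
  show ?thesis
  proof
    fix x assume "x \<in> carrier (gauge_space E B)"
    then have x: "x \<in> lin_hull E B" by simp
    note xc = E.lin_hull_carrier[OF B x] and nn = E.gauge_nonneg[OF B x]
    show "f x \<in> carrier (gauge_space F C)"
      using F.lin_hullI[OF C f(1)[OF xc] _ *[OF x, of "gauge_in E B x + 1"]] nn by simp
    show "f (c \<odot>\<^bsub>gauge_space E B\<^esub> x) = c \<odot>\<^bsub>gauge_space F C\<^esub> f x" for c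
      using f(3)[OF xc] by simp
    have "gauge_in F C (f x) \<le> gauge_in E B x"
      by (rule field_le_epsilon, rule F.gauge_le[OF C f(1)[OF xc] _ *[OF x]]) (use nn in auto)
    then show "nrm (gauge_space F C) (f x) \<le> 1 * nrm (gauge_space E B) x" by simp
    fix y assume "y \<in> carrier (gauge_space E B)"
    then show "f (x \<oplus>\<^bsub>gauge_space E B\<^esub> y) = f x \<oplus>\<^bsub>gauge_space F C\<^esub> f y"
      using f(2)[OF xc] E.lin_hull_carrier[OF B] by simp
  qed simp
qed

lemma image_disk:
  assumes E: "lcs E" and F: "lcs F" and B: "B \<in> disks E" and f: "f \<in> Tc_hom E F"
  shows "f ` B \<in> disks F"
proof -
  interpret E: lcs E by fact
  interpret F: lcs F by fact
  have lin: "f \<in> lin_hom E F" using f by (simp add: Tc_hom_def)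
  have "a \<odot>\<^bsub>F\<^esub> f x \<oplus>\<^bsub>F\<^esub> b \<odot>\<^bsub>F\<^esub> f y \<in> f ` B"
    if "x \<in> B" "y \<in> B" "cmod a + cmod b \<le> 1" for x y a b
  proof -
    have c: "x \<in> carrier E" "y \<in> carrier E" using E.disks_carrier[OF B] that by auto
    have "f (a \<odot>\<^bsub>E\<^esub> x \<oplus>\<^bsub>E\<^esub> b \<odot>\<^bsub>E\<^esub> y) = a \<odot>\<^bsub>F\<^esub> f x \<oplus>\<^bsub>F\<^esub> b \<odot>\<^bsub>F\<^esub> f y"
      using c by (simp add: lin_homD(3,4)[OF lin] E.smult_in)
    then show ?thesis using E.disks_combine[OF B that] by (metis imageI)
  qed
  then show ?thesis
    using bounded_image[OF E F f E.disks_bounded[OF B]] E.disks_zero[OF B] E.disks_carrier[OF B]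
      lin_homD(1)[OF lin]
    by (auto simp: disks_def abs_convex_in_def)
qed

section \<open>Realizing completions of gauge spaces inside the space\<close>

text \<open>Completions of gauge spaces consist of classes of Cauchy sequences, so completeness is stated for
  sequences. In this form it passes to limits of diagrams component by component.\<close>

locale complete_lcs = lcs +
  assumes hausdorff: "Hausdorff_space T"
    and sequentially_complete: "\<And>s. (\<And>n. s n \<in> carrier E) \<Longrightarrow>
      (\<And>U. openin T U \<Longrightarrow> \<zero> \<in> U \<Longrightarrow> \<exists>N. \<forall>m\<ge>N. \<forall>n\<ge>N. s m \<ominus> s n \<in> U) \<Longrightarrow>
      \<exists>l. limitin T s l sequentially"

text \<open>The image of the sequential filter under a Cauchy sequence is a Cauchy filter, and its limits are the
  limits of the sequence.\<close>

lemma complete_lcsI: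
  assumes "is_lctvs E" "complete_lctvs E"
  shows "complete_lcs E"
proof -
  interpret lcs E using assms(1) by (simp add: lcs_def)
  show ?thesis
  proof
    show "Hausdorff_space T" using assms(2) by (simp add: complete_lctvs_def)
    fix s :: "nat \<Rightarrow> 'a"
    assume s: "\<And>n. s n \<in> carrier E"
      and c: "\<And>U. openin T U \<Longrightarrow> \<zero>\<^bsub>E\<^esub> \<in> U \<Longrightarrow> \<exists>N. \<forall>m\<ge>N. \<forall>n\<ge>N. s m \<ominus>\<^bsub>E\<^esub> s n \<in> U"
    have "cauchy_filter_in E (filtermap s sequentially)"
      unfolding cauchy_filter_in_def
    proof (intro conjI allI impI)
      show "filtermap s sequentially \<noteq> bot" by (simp add: filtermap_bot_iff)
      fix U assume "openin T U \<and> \<zero>\<^bsub>E\<^esub> \<in> U"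
      then obtain N where N: "\<forall>m\<ge>N. \<forall>n\<ge>N. s m \<ominus>\<^bsub>E\<^esub> s n \<in> U" using c by blast
      have "eventually (\<lambda>x. x \<in> s ` {N..}) (filtermap s sequentially)"
        unfolding eventually_filtermap by (auto simp: eventually_sequentially)
      then show "\<exists>A\<subseteq>carrier E. eventually (\<lambda>x. x \<in> A) (filtermap s sequentially) \<and>
          (\<forall>x\<in>A. \<forall>y\<in>A. x \<ominus>\<^bsub>E\<^esub> y \<in> U)"
        using s N by (intro exI[of _ "s ` {N..}"]) auto
    qed
    then obtain l where "limitin T (\<lambda>x. x) l (filtermap s sequentially)"
      using assms(2) by (auto simp: complete_lctvs_def)
    then show "\<exists>l. limitin T s l sequentially"
      by (auto simp: limitin_def eventually_filtermap)
  qed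
qed

text \<open>If \<open>E\<close> is complete, the members of a class of Cauchy sequences for a gauge have a common limit. The disk does
  not occur in the definition: enlarging it leaves the sequences and their limit unchanged, which
  makes realization compatible with the transition maps of \<open>IB E\<close>.\<close>

definition realize :: "'a lctvs \<Rightarrow> (nat \<Rightarrow> 'a) set \<Rightarrow> 'a" where
  "realize E P = (THE l. \<exists>s\<in>P. limitin (topol E) s l sequentially)"

context lcs
begin

lemma limit_add:
  assumes "limitin T s a sequentially" "limitin T t b sequentially"
  shows "limitin T (\<lambda>n. s n \<oplus> t n) (a \<oplus> b) sequentially"
proof -
  have "limitin (prod_topology T T) (\<lambda>n. (s n, t n)) (a, b) sequentially"
    using assms by (simp add: limitin_pairwise o_def)
  moreover have "continuous_map (prod_topology T T) T (\<lambda>(x, y). x \<oplus> y)"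
    using lctvs by (simp add: is_lctvs_def)
  ultimately show ?thesis
    using continuous_map_limit[of "prod_topology T T" T "\<lambda>(x, y). x \<oplus> y"]
    by (fastforce simp: o_def)
qed

lemma limit_smult:
  assumes "limitin T s a sequentially"
  shows "limitin T (\<lambda>n. c \<odot> s n) (c \<odot> a) sequentially"
proof -
  have "continuous_map T T (\<lambda>x. c \<odot> x)"
    by (intro continuous_smult) (auto simp: continuous_map_id[unfolded id_def])
  from continuous_map_limit[OF this assms] show ?thesis by (simp add: o_def)
qed

text \<open>Boundedness of \<open>B\<close> means that, on its linear hull, the gauge of \<open>B\<close> defines a finer topology than
  the one induced by \<open>E\<close>.\<close>

lemma gauge_small_in_nbhd:
  assumes B: "B \<in> disks E" and U: "openin T U" "\<zero> \<in> U"
  obtains e where "e > 0" "\<And>x. x \<in> lin_hull E B \<Longrightarrow> gauge_in E B x < e \<Longrightarrow> x \<in> U"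
proof -
  obtain e where e: "e > 0" "\<And>c x. cmod c \<le> e \<Longrightarrow> x \<in> B \<Longrightarrow> c \<odot> x \<in> U"
    using bounded_absorbed[OF disks_bounded[OF B] U] by blast
  have "x \<in> U" if x: "x \<in> lin_hull E B" "gauge_in E B x < e" for x
    using e(2)[OF _ gauge_less[OF B x], of "complex_of_real e"] e(1) lin_hull_carrier[OF B x(1)]
    by (simp add: smult_smult one_smult)
  then show thesis using that e(1) by blast
qed

lemma limit_gauge_null:
  assumes B: "B \<in> disks E" and s: "\<And>n. s n \<in> lin_hull E B"
    and lim: "(\<lambda>n. gauge_in E B (s n)) \<longlonglongrightarrow> 0"
  shows "limitin T s \<zero> sequentially"
  unfolding limitin_def
proof (intro conjI allI impI)
  fix U assume U: "openin T U \<and> \<zero> \<in> U"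
  then obtain e where e: "e > 0" "\<And>x. x \<in> lin_hull E B \<Longrightarrow> gauge_in E B x < e \<Longrightarrow> x \<in> U"
    using gauge_small_in_nbhd[OF B] by blast
  have "eventually (\<lambda>n. gauge_in E B (s n) < e) sequentially"
    using order_tendstoD(2)[OF lim e(1)] .
  then show "eventually (\<lambda>n. s n \<in> U) sequentially"
    by (rule eventually_mono) (use e s in blast)
qed simp

end

context complete_lcs
begin

lemma limit_unique: "limitin T s a sequentially \<Longrightarrow> limitin T s b sequentially \<Longrightarrow> a = b"
  by (rule limitin_Hausdorff_unique[OF _ _ _ hausdorff]) auto

lemma gauge_cauchy_converges:
  assumes B: "B \<in> disks E" and s: "s \<in> cauchy_seqs (gauge_space E B)"
  shows "\<exists>l. limitin T s l sequentially"
proof -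
  interpret G: seminormed "gauge_space E B" by (rule gauge_seminormed[OF B])
  have sh: "s n \<in> lin_hull E B" for n using G.cauchy_seqs_in[OF s] by simp
  show ?thesis
  proof (rule sequentially_complete)
    show "s n \<in> carrier E" for n using lin_hull_carrier[OF B sh] .
    fix U assume U: "openin T U" "\<zero> \<in> U"
    obtain e where e: "e > 0" "\<And>x. x \<in> lin_hull E B \<Longrightarrow> gauge_in E B x < e \<Longrightarrow> x \<in> U"
      using gauge_small_in_nbhd[OF B U] by blast
    obtain N where N: "\<And>m n. m \<ge> N \<Longrightarrow> n \<ge> N \<Longrightarrow>
        nrm (gauge_space E B) (s m \<ominus>\<^bsub>gauge_space E B\<^esub> s n) < e"
      using G.cauchy_seqsD[OF s e(1)] by metis
    have "s m \<ominus> s n \<in> U" if "m \<ge> N" "n \<ge> N" for m n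
      using e(2)[of "s m \<ominus> s n"] N[OF that] G.diff_closed[of "s m" "s n"] sh
      by (simp add: gauge_diff[OF B])
    then show "\<exists>N. \<forall>m\<ge>N. \<forall>n\<ge>N. s m \<ominus> s n \<in> U" by blast
  qed
qed

lemma limit_null_rel:
  assumes B: "B \<in> disks E" and st: "(s, t) \<in> null_rel (gauge_space E B)"
    and l: "limitin T s l sequentially"
  shows "limitin T t l sequentially"
proof -
  interpret G: seminormed "gauge_space E B" by (rule gauge_seminormed[OF B])
  note c = G.null_relD[OF st]
  have h: "s n \<in> lin_hull E B" "t n \<in> lin_hull E B" for n
    using G.cauchy_seqs_in[OF c(1), of n] G.cauchy_seqs_in[OF c(2), of n] by auto
  have hc: "s n \<in> carrier E" "t n \<in> carrier E" for n
    using lin_hull_carrier[OF B] h by auto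
  have "limitin T (\<lambda>n. s n \<ominus> t n) \<zero> sequentially"
    by (rule limit_gauge_null[OF B])
      (use c(3) h G.diff_closed[of "s _" "t _"] in \<open>auto simp: gauge_diff[OF B]\<close>)
  from limit_add[OF l limit_smult[OF this, of "-1"]]
  have "limitin T (\<lambda>n. s n \<oplus> (-1) \<odot> (s n \<ominus> t n)) (l \<oplus> (-1) \<odot> \<zero>) sequentially" .
  moreover have "s n \<oplus> (-1) \<odot> (s n \<ominus> t n) = t n" for n
    using hc[of n] diff_add_cancel[of "t n" "s n"]
    by (simp add: diff_swap[of "s n" "t n", symmetric] M.a_comm)
  moreover have "l \<oplus> (-1) \<odot> \<zero> = l"
    using limitin_topspace[OF l] by (simp add: smult_zero)
  ultimately show ?thesis by simp
qed

lemma realize_eqI: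
  assumes B: "B \<in> disks E" and s: "s \<in> cauchy_seqs (gauge_space E B)"
    and l: "limitin T s l sequentially"
  shows "realize E (null_rel (gauge_space E B) `` {s}) = l"
proof -
  interpret G: seminormed "gauge_space E B" by (rule gauge_seminormed[OF B])
  show ?thesis
    unfolding realize_def
  proof (rule the_equality)
    show "\<exists>t\<in>G.cls s. limitin T t l sequentially" using G.cls_self[OF s] l by blast
    fix k assume "\<exists>t\<in>G.cls s. limitin T t k sequentially"
    then obtain t where "(s, t) \<in> null_rel (gauge_space E B)" "limitin T t k sequentially" by blast
    then show "k = l" using limit_null_rel[OF B _ l] limit_unique by blast
  qed
qed

lemma realize_limit:
  assumes B: "B \<in> disks E" and s: "s \<in> cauchy_seqs (gauge_space E B)"
  shows "limitin T s (realize E (null_rel (gauge_space E B) `` {s})) sequentially"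
  using gauge_cauchy_converges[OF B s] realize_eqI[OF B s] by auto

lemma realize_closed:
  assumes B: "B \<in> disks E" and P: "P \<in> carrier (completion (gauge_space E B))"
  shows "realize E P \<in> carrier E"
proof -
  interpret G: seminormed "gauge_space E B" by (rule gauge_seminormed[OF B])
  show ?thesis
    by (rule G.completion_cases[OF P]) (use limitin_topspace[OF realize_limit[OF B]] in auto)
qed

lemma realize_add:
  assumes B: "B \<in> disks E" and P: "P \<in> carrier (completion (gauge_space E B))"
    and Q: "Q \<in> carrier (completion (gauge_space E B))"
  shows "realize E (P \<oplus>\<^bsub>completion (gauge_space E B)\<^esub> Q) = realize E P \<oplus> realize E Q"
proof -
  interpret G: seminormed "gauge_space E B" by (rule gauge_seminormed[OF B])
  obtain s where s: "s \<in> cauchy_seqs (gauge_space E B)" "P = G.cls s" using G.completion_cases[OF P] .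
  obtain t where t: "t \<in> cauchy_seqs (gauge_space E B)" "Q = G.cls t" using G.completion_cases[OF Q] .
  have "realize E (G.cls (\<lambda>n. s n \<oplus> t n)) = realize E P \<oplus> realize E Q"
    by (rule realize_eqI[OF B])
      (use G.add_cauchy[OF s(1) t(1)] limit_add realize_limit[OF B] s t in auto)
  then show ?thesis using s t by (simp add: G.add_cls)
qed

lemma realize_smult:
  assumes B: "B \<in> disks E" and P: "P \<in> carrier (completion (gauge_space E B))"
  shows "realize E (c \<odot>\<^bsub>completion (gauge_space E B)\<^esub> P) = c \<odot> realize E P"
proof -
  interpret G: seminormed "gauge_space E B" by (rule gauge_seminormed[OF B])
  obtain s where s: "s \<in> cauchy_seqs (gauge_space E B)" "P = G.cls s" using G.completion_cases[OF P] .
  have "realize E (G.cls (\<lambda>n. c \<odot> s n)) = c \<odot> realize E P"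
    by (rule realize_eqI[OF B])
      (use G.smult_cauchy[OF s(1), of c] limit_smult realize_limit[OF B] s in auto)
  then show ?thesis using s by (simp add: G.smult_cls)
qed

lemma realize_const:
  assumes B: "B \<in> disks E" and x: "x \<in> lin_hull E B"
  shows "realize E (null_rel (gauge_space E B) `` {\<lambda>_. x}) = x"
proof -
  interpret G: seminormed "gauge_space E B" by (rule gauge_seminormed[OF B])
  show ?thesis
    by (rule realize_eqI[OF B]) (use x G.const_cauchy[of x] lin_hull_carrier[OF B x] in auto)
qed

text \<open>If \<open>P\<close> has norm less than \<open>r\<close>, then a representing sequence eventually lies in \<open>r B\<close>, hence its
  limit lies in the closure of \<open>r B\<close>.\<close>

lemma realize_in_closure:
  assumes B: "B \<in> disks E" and P: "P \<in> carrier (completion (gauge_space E B))"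
    and r: "nrm (completion (gauge_space E B)) P < r"
  shows "complex_of_real (inverse r) \<odot> realize E P \<in> T closure_of B"
proof -
  interpret G: seminormed "gauge_space E B" by (rule gauge_seminormed[OF B])
  obtain s where s: "s \<in> cauchy_seqs (gauge_space E B)" "P = G.cls s" using G.completion_cases[OF P] .
  have sh: "s n \<in> lin_hull E B" for n using G.cauchy_seqs_in[OF s(1)] by simp
  have "eventually (\<lambda>n. gauge_in E B (s n) < r) sequentially"
    using order_tendstoD(2)[OF G.nrm_cls_lim[OF s(1)], of r] r s by simp
  then have ev: "eventually (\<lambda>n. complex_of_real (inverse r) \<odot> s n \<in> T closure_of B) sequentially"
  proof (rule eventually_mono)
    fix n assume "gauge_in E B (s n) < r"
    then have "complex_of_real (inverse r) \<odot> s n \<in> B" using gauge_less[OF B sh] by blast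
    then show "complex_of_real (inverse r) \<odot> s n \<in> T closure_of B"
      using closure_of_subset[of B T] disks_carrier[OF B] by auto
  qed
  show ?thesis
    by (rule limitin_closedin[OF limit_smult[OF realize_limit[OF B s(1)]] _ ev, folded s(2)]) auto
qed

text \<open>For a closed disk \<open>B\<close> no information is lost: if a Cauchy sequence for the gauge of \<open>B\<close>
  converges to zero in \<open>E\<close>, the differences \<open>s m - s n\<close> lie in \<open>r B\<close> for large \<open>m\<close> and \<open>n\<close>, and
  letting \<open>n\<close> tend to infinity shows that \<open>s m\<close> lies in \<open>r B\<close>.\<close>

lemma realize_inj:
  assumes B: "B \<in> disks E" and cl: "closedin T B"
    and P: "P \<in> carrier (completion (gauge_space E B))"
    and Q: "Q \<in> carrier (completion (gauge_space E B))"
    and eq: "realize E P = realize E Q"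
  shows "P = Q"
proof -
  interpret G: seminormed "gauge_space E B" by (rule gauge_seminormed[OF B])
  interpret C: seminormed "completion (gauge_space E B)" by (rule G.completion_seminormed)
  let ?D = "P \<ominus>\<^bsub>completion (gauge_space E B)\<^esub> Q"
  have D: "?D \<in> carrier (completion (gauge_space E B))" using P Q by simp
  obtain s where s: "s \<in> cauchy_seqs (gauge_space E B)" "?D = G.cls s" using G.completion_cases[OF D] .
  have sh: "s n \<in> lin_hull E B" for n using G.cauchy_seqs_in[OF s(1)] by simp
  have sc: "s n \<in> carrier E" for n using lin_hull_carrier[OF B sh] .
  have "realize E ?D = realize E P \<oplus> (-1) \<odot> realize E Q"
    using P Q by (simp add: C.diff_eq realize_add[OF B] realize_smult[OF B] C.smult_in)
  also have "\<dots> = \<zero>"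
    using eq realize_closed[OF B Q] by (simp add: diff_eq[symmetric] diff_self)
  finally have lim0: "limitin T s \<zero> sequentially" using realize_limit[OF B s(1)] s(2) by simp
  have "(\<lambda>n. gauge_in E B (s n)) \<longlonglongrightarrow> 0"
  proof (rule LIMSEQ_I)
    fix e :: real assume e: "e > 0"
    define r where "r = e / 2"
    have r: "r > 0" "r < e" using e by (auto simp: r_def)
    obtain N where N: "\<And>m n. m \<ge> N \<Longrightarrow> n \<ge> N \<Longrightarrow>
        nrm (gauge_space E B) (s m \<ominus>\<^bsub>gauge_space E B\<^esub> s n) < r"
      using G.cauchy_seqsD[OF s(1) r(1)] by metis
    have "gauge_in E B (s m) \<le> r" if m: "m \<ge> N" for m
    proof (rule gauge_le[OF B sc r(1)])
      let ?k = "complex_of_real (inverse r)"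
      have in_B: "?k \<odot> s m \<oplus> (- ?k) \<odot> s n \<in> B" if "n \<ge> N" for n
      proof -
        have "?k \<odot> (s m \<ominus> s n) \<in> B"
          using gauge_less[OF B _ , of "s m \<ominus> s n" r] N[OF m that] G.diff_closed[of "s m" "s n"] sh
          by (simp add: gauge_diff[OF B])
        then show ?thesis
          using sc by (simp add: diff_eq smult_add_right smult_smult smult_in)
      qed
      have "limitin T (\<lambda>n. ?k \<odot> s m \<oplus> (- ?k) \<odot> s n) (?k \<odot> s m \<oplus> (- ?k) \<odot> \<zero>) sequentially"
        by (intro limit_add limit_smult lim0) (use sc smult_in in auto)
      then have "?k \<odot> s m \<oplus> (- ?k) \<odot> \<zero> \<in> B"
        by (rule limitin_closedin[OF _ cl])
          (use in_B in \<open>auto simp: eventually_sequentially\<close>)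
      then show "?k \<odot> s m \<in> B" using sc by (simp add: smult_zero smult_in)
    qed
    then show "\<exists>no. \<forall>n\<ge>no. norm (gauge_in E B (s n) - 0) < e"
      using r gauge_nonneg[OF B sh] by (intro exI[of _ N]) (auto intro: le_less_trans)
  qed
  then have "nrm (completion (gauge_space E B)) ?D = 0"
    using G.nrm_cls_lim[OF s(1)] s(2) LIMSEQ_unique by fastforce
  then have "?D = \<zero>\<^bsub>completion (gauge_space E B)\<^esub>" using G.completion_definite[OF D] by blast
  then show ?thesis using C.diff_eq_zero[OF P Q] by blast
qed

end

lemma realize_completion_map:
  assumes E: "complete_lcs E" and F: "complete_lcs F" and B: "B \<in> disks E" and C: "C \<in> disks F"
    and f: "bounded_operator (gauge_space E B) (gauge_space F C) f K"
    and cont: "continuous_map (topol E) (topol F) f"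
    and P: "P \<in> carrier (completion (gauge_space E B))"
  shows "realize F (completion_map (gauge_space E B) (gauge_space F C) f P) = f (realize E P)"
proof -
  interpret E: complete_lcs E by fact
  interpret F: complete_lcs F by fact
  interpret f: bounded_operator "gauge_space E B" "gauge_space F C" f K by fact
  obtain s where s: "s \<in> cauchy_seqs (gauge_space E B)" "P = f.V.cls s"
    using f.V.completion_cases[OF P] .
  have "realize F (f.W.cls (f \<circ> s)) = f (realize E P)"
    by (rule F.realize_eqI[OF C f.map_cauchy[OF s(1)]])
      (use continuous_map_limit[OF cont E.realize_limit[OF B s(1)]] s in auto)
  then show ?thesis using s f.completion_map_cls[OF s(1)] by simp
qed

section \<open>The ind-object IB E\<close>

lemma completion_map_id:
  assumes "seminormed V"
  shows "completion_map V V (\<lambda>x. x) = (\<lambda>P\<in>carrier (completion V). P)"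
proof -
  interpret seminormed V by fact
  interpret bounded_operator V V "\<lambda>x. x" 1 by unfold_locales auto
  show ?thesis
  proof (rule extensionalityI[of _ "carrier (completion V)"])
    fix P assume P: "P \<in> carrier (completion V)"
    then obtain s where "s \<in> cauchy_seqs V" "P = cls s" using completion_cases by blast
    then show "completion_map V V (\<lambda>x. x) P = (\<lambda>P\<in>carrier (completion V). P) P"
      using P completion_map_cls[of s] by (simp add: o_def)
  qed (auto simp: completion_map_def)
qed

lemma completion_map_compose:
  assumes "bounded_operator U V f K" "bounded_operator V W g L"
    "bounded_operator U W (\<lambda>x. g (f x)) M"
  shows "compose (carrier (completion U)) (completion_map V W g) (completion_map U V f)
    = completion_map U W (\<lambda>x. g (f x))"
proof -
  interpret f: bounded_operator U V f K by fact
  interpret g: bounded_operator V W g L by fact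
  interpret gf: bounded_operator U W "\<lambda>x. g (f x)" M by fact
  show ?thesis
  proof (rule extensionalityI[of _ "carrier (completion U)"])
    fix P assume P: "P \<in> carrier (completion U)"
    then obtain s where s: "s \<in> cauchy_seqs U" "P = f.V.cls s" using f.V.completion_cases by blast
    then show "compose (carrier (completion U)) (completion_map V W g) (completion_map U V f) P
        = completion_map U W (\<lambda>x. g (f x)) P"
      using P f.completion_map_cls[OF s(1)] gf.completion_map_cls[OF s(1)]
        g.completion_map_cls[OF f.map_cauchy[OF s(1)]]
      by (simp add: compose_eq o_def)
  qed (auto simp: completion_map_def compose_def)
qed

lemma IB_simps [simp]:
  "Ob (idx (IB E)) = disks E"
  "Hom (idx (IB E)) B C = (if B \<subseteq> C then {()} else {})"
  "Idn (idx (IB E)) B = ()"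
  "Cmp (idx (IB E)) A B C u v = ()"
  "fobj (dgm (IB E)) B = completion (gauge_space E B)"
  "farr (dgm (IB E)) B C w = completion_map (gauge_space E B) (gauge_space E C) (\<lambda>x. x)"
  by (simp_all add: IB_def)

lemma Ban_simps [simp]:
  "Ob Ban = Collect is_banach" "Hom Ban = Ban_hom" "Idn Ban V = (\<lambda>x\<in>carrier V. x)"
  "Cmp Ban U V W g f = compose (carrier U) g f"
  by (simp_all add: Ban_def)

context lcs
begin

lemma inclusion_operator:
  assumes "B \<in> disks E" "C \<in> disks E" "B \<subseteq> C"
  shows "bounded_operator (gauge_space E B) (gauge_space E C) (\<lambda>x. x) 1"
  by (rule gauge_operator[OF lcs_axioms lcs_axioms assms(1,2)]) (use assms(3) in auto)

lemma gauge_banach: "B \<in> disks E \<Longrightarrow> is_banach (completion (gauge_space E B))"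
  by (intro is_banach_completion gauge_seminormed)

lemma IB_is_ind: "is_ind (IB E)"
  unfolding is_ind_def
proof (intro conjI)
  show "category (idx (IB E))"
    unfolding category_def by auto
  show "filtered (idx (IB E))"
    unfolding filtered_def
  proof (intro conjI ballI)
    show "Ob (idx (IB E)) \<noteq> {}" using zero_disk by auto
    fix B C assume BC: "B \<in> Ob (idx (IB E))" "C \<in> Ob (idx (IB E))"
    then show "\<exists>D\<in>Ob (idx (IB E)). Hom (idx (IB E)) B D \<noteq> {} \<and> Hom (idx (IB E)) C D \<noteq> {}"
      using sum_disk[of B C] by (intro bexI[of _ "{x \<oplus> y | x y. x \<in> B \<and> y \<in> C}"]) auto
    show "\<exists>D\<in>Ob (idx (IB E)). \<exists>w\<in>Hom (idx (IB E)) C D.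
        Cmp (idx (IB E)) B C D w u = Cmp (idx (IB E)) B C D w v" for u v
      using BC by (intro bexI[of _ C]) auto
  qed
  show "is_functor (idx (IB E)) Ban (dgm (IB E))"
    unfolding is_functor_def
  proof (intro conjI ballI)
    fix B assume B: "B \<in> Ob (idx (IB E))"
    then show "fobj (dgm (IB E)) B \<in> Ob Ban" by (simp add: gauge_banach)
    show "farr (dgm (IB E)) B B (Idn (idx (IB E)) B) = Idn Ban (fobj (dgm (IB E)) B)"
      using B by (simp add: completion_map_id gauge_seminormed)
    fix C u assume C: "C \<in> Ob (idx (IB E))" and u: "u \<in> Hom (idx (IB E)) B C"
    have BC: "B \<subseteq> C" using u by (simp split: if_splits)
    have BCop: "bounded_operator (gauge_space E B) (gauge_space E C) (\<lambda>x. x) 1"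
      using inclusion_operator B C BC by simp
    then show "farr (dgm (IB E)) B C u \<in> Hom Ban (fobj (dgm (IB E)) B) (fobj (dgm (IB E)) C)"
      by (simp add: bounded_operator.completion_map_Ban_hom)
    fix D v assume D: "D \<in> Ob (idx (IB E))" and v: "v \<in> Hom (idx (IB E)) C D"
    have CD: "C \<subseteq> D" using v by (simp split: if_splits)
    have CDop: "bounded_operator (gauge_space E C) (gauge_space E D) (\<lambda>x. x) 1"
      "bounded_operator (gauge_space E B) (gauge_space E D) (\<lambda>x. x) 1"
      using inclusion_operator B C D BC CD by auto
    show "farr (dgm (IB E)) B D (Cmp (idx (IB E)) B C D v u) =
        Cmp Ban (fobj (dgm (IB E)) B) (fobj (dgm (IB E)) C) (fobj (dgm (IB E)) D)
         (farr (dgm (IB E)) C D v) (farr (dgm (IB E)) B C u)"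
      using completion_map_compose[OF BCop CDop] by simp
  qed
qed

end

section \<open>Morphisms from a Banach space into an ind-object IB E\<close>

text \<open>Since \<open>V\<close> is normed, these are the continuous linear maps from \<open>V\<close> to \<open>E\<close>. The condition on the
  unit ball is the one that produces a disk.\<close>

definition bounded_maps :: "'b nspace \<Rightarrow> 'a lctvs \<Rightarrow> ('b \<Rightarrow> 'a) set" where
  "bounded_maps V E = {t \<in> lin_hom V E. bounded_in E (t ` {x \<in> carrier V. nrm V x \<le> 1})}"

text \<open>The composite of the germ with realization, as a map into \<open>E\<close>. Only the operator enters, because
  realization does not refer to the disk.\<close>

definition germ_val :: "'b nspace \<Rightarrow> 'a lctvs \<Rightarrow> 'a set \<times> ('b \<Rightarrow> (nat \<Rightarrow> 'a) set) \<Rightarrow> 'b \<Rightarrow> 'a" where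
  "germ_val V E p = (\<lambda>x\<in>carrier V. realize E (snd p x))"

text \<open>The value does not depend on the representative that is chosen, by \<open>germ_rel_iff\<close> below.\<close>

definition colim_val ::
  "'b nspace \<Rightarrow> 'a lctvs \<Rightarrow> ('a set \<times> ('b \<Rightarrow> (nat \<Rightarrow> 'a) set)) set \<Rightarrow> 'b \<Rightarrow> 'a" where
  "colim_val V E c = germ_val V E (SOME p. p \<in> c)"

lemma germs_IB_iff:
  "(B, f) \<in> germs V (IB E) \<longleftrightarrow> B \<in> disks E \<and> f \<in> Ban_hom V (completion (gauge_space E B))"
  by (simp add: germs_def)

lemma (in complete_lcs) realize_inclusion:
  assumes "B \<in> disks E" "C \<in> disks E" "B \<subseteq> C" "P \<in> carrier (completion (gauge_space E B))"
  shows "realize E (completion_map (gauge_space E B) (gauge_space E C) (\<lambda>x. x) P) = realize E P"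
  by (rule realize_completion_map[OF complete_lcs_axioms complete_lcs_axioms assms(1,2)
        inclusion_operator[OF assms(1-3)] _ assms(4)])
    (simp add: continuous_map_id[unfolded id_def])

locale banach_to_lcs = complete_lcs E for V :: "'b nspace" and E :: "'a lctvs" (structure) +
  assumes banach: "is_banach V"
begin

sublocale V: seminormed V
  using banach by (simp add: is_banach_def is_seminormed_iff)

text \<open>If \<open>f\<close> is bounded by \<open>K\<close>, it maps the unit ball to vectors of norm less than \<open>K + 1\<close>, and
  realization sends these to \<open>K + 1\<close> times the closure of \<open>B\<close>, a bounded set.\<close>

lemma germ_val_bounded:
  assumes p: "(B, f) \<in> germs V (IB E)"
  shows "germ_val V E (B, f) \<in> bounded_maps V E"
proof -
  have B: "B \<in> disks E" and f: "f \<in> Ban_hom V (completion (gauge_space E B))"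
    using p by (auto simp: germs_IB_iff)
  note lin = Ban_hom_lin[OF f]
  obtain K where K: "K \<ge> 0"
    "\<And>x. x \<in> carrier V \<Longrightarrow> nrm (completion (gauge_space E B)) (f x) \<le> K * nrm V x"
    using Ban_hom_bounded[OF banach gauge_banach[OF B] f] by blast
  have l: "germ_val V E (B, f) \<in> lin_hom V E"
    by (rule lin_homI)
      (use lin_homD(1)[OF lin] in \<open>auto simp: germ_val_def realize_closed[OF B] V.smult_in
        lin_homD(3,4)[OF lin] realize_add[OF B] realize_smult[OF B]\<close>)
  let ?r = "complex_of_real (K + 1)"
  have "germ_val V E (B, f) ` {x \<in> carrier V. nrm V x \<le> 1} \<subseteq> (\<lambda>x. ?r \<odot> x) ` (T closure_of B)"
  proof clarify
    fix x assume x: "x \<in> carrier V" "nrm V x \<le> 1"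
    have "nrm (completion (gauge_space E B)) (f x) \<le> K * 1"
      using K(2)[OF x(1)] mult_left_mono[OF x(2) K(1)] by linarith
    then have in_closure: "complex_of_real (inverse (K + 1)) \<odot> realize E (f x) \<in> T closure_of B"
      by (intro realize_in_closure[OF B lin_homD(1)[OF lin x(1)]]) simp
    have rescale: "?r \<odot> (complex_of_real (inverse (K + 1)) \<odot> realize E (f x)) = realize E (f x)"
    proof -
      have "?r * complex_of_real (inverse (K + 1)) = complex_of_real ((K + 1) * inverse (K + 1))"
        by (simp only: of_real_mult)
      also have "\<dots> = 1" using K(1) by simp
      finally show ?thesis
        using realize_closed[OF B lin_homD(1)[OF lin x(1)]] by (simp only: smult_smult one_smult)
    qed
    show "germ_val V E (B, f) x \<in> (\<lambda>x. ?r \<odot> x) ` (T closure_of B)"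
      using image_eqI[of _ "\<lambda>x. ?r \<odot> x", OF rescale[symmetric] in_closure] x
      by (simp add: germ_val_def)
  qed
  then have "bounded_in E (germ_val V E (B, f) ` {x \<in> carrier V. nrm V x \<le> 1})"
    by (rule bounded_subset[OF bounded_scaled[OF bounded_closure[OF disks_bounded[OF B]]]])
  then show ?thesis using l by (simp add: bounded_maps_def)
qed

text \<open>The image \<open>B\<close> of the unit ball is a disk, and \<open>t\<close> is a contraction from \<open>V\<close> to the gauge space
  of \<open>B\<close>. Following it by the canonical map to the completion, which sends a vector to the class of
  the constant sequence, gives the required operator.\<close>

lemma bounded_map_factors:
  assumes t: "t \<in> bounded_maps V E"
  obtains B f where "(B, f) \<in> germs V (IB E)" "germ_val V E (B, f) = t"
proof -
  have lin: "t \<in> lin_hom V E" using t by (simp add: bounded_maps_def)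
  define B where "B = t ` {x \<in> carrier V. nrm V x \<le> 1}"
  have B: "B \<in> disks E"
    unfolding disks_def
  proof (intro CollectI conjI)
    show "bounded_in E B" using t by (simp add: bounded_maps_def B_def)
    show "abs_convex_in E B"
      unfolding abs_convex_in_def
    proof (intro conjI ballI allI impI)
      show "B \<subseteq> carrier E" using lin_homD(1)[OF lin] by (auto simp: B_def)
      show "B \<noteq> {}" using V.nrm_zero by (auto simp: B_def intro!: exI[of _ "\<zero>\<^bsub>V\<^esub>"])
      fix u v a b assume "u \<in> B" "v \<in> B" and ab: "cmod a + cmod b \<le> 1"
      then obtain x y where x: "u = t x" "x \<in> carrier V" "nrm V x \<le> 1"
        and y: "v = t y" "y \<in> carrier V" "nrm V y \<le> 1" by (auto simp: B_def)
      have "nrm V (a \<odot>\<^bsub>V\<^esub> x \<oplus>\<^bsub>V\<^esub> b \<odot>\<^bsub>V\<^esub> y) \<le> cmod a * nrm V x + cmod b * nrm V y"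
        using V.nrm_triangle[of "a \<odot>\<^bsub>V\<^esub> x" "b \<odot>\<^bsub>V\<^esub> y"] x y by (simp add: V.smult_in V.nrm_smult)
      also have "\<dots> \<le> cmod a * 1 + cmod b * 1"
        using x y by (intro add_mono mult_left_mono) auto
      finally have "nrm V (a \<odot>\<^bsub>V\<^esub> x \<oplus>\<^bsub>V\<^esub> b \<odot>\<^bsub>V\<^esub> y) \<le> 1" using ab by simp
      moreover have "a \<odot> u \<oplus> b \<odot> v = t (a \<odot>\<^bsub>V\<^esub> x \<oplus>\<^bsub>V\<^esub> b \<odot>\<^bsub>V\<^esub> y)"
        using x y by (simp add: lin_homD(3,4)[OF lin] V.smult_in)
      ultimately show "a \<odot> u \<oplus> b \<odot> v \<in> B"
        using x y by (simp add: B_def V.smult_in)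
    qed
  qed
  interpret G: seminormed "gauge_space E B" by (rule gauge_seminormed[OF B])
  have tc: "t x \<in> carrier E" if "x \<in> carrier V" for x using lin_homD(1)[OF lin that] .
  have in_B: "complex_of_real (inverse r) \<odot> t x \<in> B"
    if x: "x \<in> carrier V" and r: "nrm V x < r" for x r
  proof -
    have r0: "r > 0" using r V.nrm_nonneg[OF x] by simp
    have "nrm V (complex_of_real (inverse r) \<odot>\<^bsub>V\<^esub> x) = inverse r * nrm V x"
      using r0 by (simp only: V.nrm_smult[OF x] norm_of_real) simp
    also have "\<dots> \<le> 1" using r r0 by (simp add: field_simps)
    finally show ?thesis
      using x by (auto simp: B_def lin_homD(4)[OF lin x, symmetric] V.smult_in)
  qed
  have hull: "t x \<in> lin_hull E B" if x: "x \<in> carrier V" for x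
    using lin_hullI[OF B tc[OF x] _ in_B[OF x, of "nrm V x + 1"]] V.nrm_nonneg[OF x] by simp
  have gauge: "gauge_in E B (t x) \<le> nrm V x" if x: "x \<in> carrier V" for x
    by (rule field_le_epsilon, rule gauge_le[OF B tc[OF x] _ in_B[OF x]])
      (use V.nrm_nonneg[OF x] in auto)
  define f where "f = (\<lambda>x\<in>carrier V. G.cls (\<lambda>_. t x))"
  have cc: "(\<lambda>_. t x) \<in> cauchy_seqs (gauge_space E B)" if "x \<in> carrier V" for x
    using G.const_cauchy hull[OF that] by simp
  have "f \<in> lin_hom V (completion (gauge_space E B))"
    by (rule lin_homI)
      (use cc in \<open>auto simp: f_def G.completion_cls V.smult_in lin_homD(3,4)[OF lin] G.add_cls
        G.smult_cls\<close>)
  moreover have "nrm (completion (gauge_space E B)) (f x) \<le> 1 * nrm V x" if "x \<in> carrier V" for x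
    using that G.nrm_cls_const[of "t x"] hull gauge by (simp add: f_def)
  ultimately have "f \<in> Ban_hom V (completion (gauge_space E B))"
    by (rule Ban_homI[OF banach gauge_banach[OF B]])
  then have "(B, f) \<in> germs V (IB E)" using B by (simp add: germs_IB_iff)
  moreover have "germ_val V E (B, f) = t"
  proof (rule extensionalityI[of _ "carrier V"])
    show "t \<in> extensional (carrier V)" using lin_homD(2)[OF lin] .
    fix x assume x: "x \<in> carrier V"
    show "germ_val V E (B, f) x = t x"
      using x realize_const[OF B hull[OF x]] by (simp add: germ_val_def f_def)
  qed (simp add: germ_val_def)
  ultimately show thesis by (rule that)
qed

text \<open>Two germs with the same realization already agree after passing to the closure of the sum of
  their disks, because the realization of the completion at a closed disk is injective.\<close>

lemma germ_rel_iff: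
  "(p, q) \<in> germ_rel V (IB E) \<longleftrightarrow>
     p \<in> germs V (IB E) \<and> q \<in> germs V (IB E) \<and> germ_val V E p = germ_val V E q"
proof (cases p, cases q)
  fix B f C g assume pq: "p = (B, f)" "q = (C, g)"
  show ?thesis
  proof
    assume "(p, q) \<in> germ_rel V (IB E)"
    then have germs: "(B, f) \<in> germs V (IB E)" "(C, g) \<in> germs V (IB E)"
      and "\<exists>D\<in>Ob (idx (IB E)). \<exists>u\<in>Hom (idx (IB E)) B D. \<exists>v\<in>Hom (idx (IB E)) C D.
        compose (carrier V) (farr (dgm (IB E)) B D u) f = compose (carrier V) (farr (dgm (IB E)) C D v) g"
      unfolding germ_rel_def pq by auto
    then obtain D where D: "D \<in> disks E" "B \<subseteq> D" "C \<subseteq> D"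
      and eq: "compose (carrier V) (completion_map (gauge_space E B) (gauge_space E D) (\<lambda>x. x)) f =
        compose (carrier V) (completion_map (gauge_space E C) (gauge_space E D) (\<lambda>x. x)) g"
      by (auto split: if_splits)
    have B: "B \<in> disks E" "f \<in> lin_hom V (completion (gauge_space E B))"
      and C: "C \<in> disks E" "g \<in> lin_hom V (completion (gauge_space E C))"
      using germs Ban_hom_lin by (auto simp: germs_IB_iff)
    have "realize E (f x) = realize E (g x)" if x: "x \<in> carrier V" for x
      using fun_cong[OF eq, of x] x
        realize_inclusion[OF B(1) D(1,2) lin_homD(1)[OF B(2) x]]
        realize_inclusion[OF C(1) D(1,3) lin_homD(1)[OF C(2) x]]
      by (simp add: compose_eq)
    then show "p \<in> germs V (IB E) \<and> q \<in> germs V (IB E) \<and> germ_val V E p = germ_val V E q"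
      using germs by (auto simp: pq germ_val_def intro!: restrict_ext)
  next
    assume "p \<in> germs V (IB E) \<and> q \<in> germs V (IB E) \<and> germ_val V E p = germ_val V E q"
    then have germs: "(B, f) \<in> germs V (IB E)" "(C, g) \<in> germs V (IB E)"
      and eq: "germ_val V E (B, f) = germ_val V E (C, g)"
      by (auto simp: pq)
    have B: "B \<in> disks E" "f \<in> lin_hom V (completion (gauge_space E B))"
      and C: "C \<in> disks E" "g \<in> lin_hom V (completion (gauge_space E C))"
      using germs Ban_hom_lin by (auto simp: germs_IB_iff)
    define D where "D = T closure_of {x \<oplus> y | x y. x \<in> B \<and> y \<in> C}"
    have D: "D \<in> disks E" unfolding D_def by (intro closure_disk sum_disk B C)
    have sub: "{x \<oplus> y | x y. x \<in> B \<and> y \<in> C} \<subseteq> D"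
      unfolding D_def by (rule closure_of_subset) (use disks_carrier B C in auto)
    then have BD: "B \<subseteq> D" and CD: "C \<subseteq> D"
      using sum_disk(2,3)[OF B(1) C(1)] by auto
    have cl: "closedin T D" by (simp add: D_def)
    interpret iB: bounded_operator "gauge_space E B" "gauge_space E D" "\<lambda>x. x" 1
      by (rule inclusion_operator[OF B(1) D BD])
    interpret iC: bounded_operator "gauge_space E C" "gauge_space E D" "\<lambda>x. x" 1
      by (rule inclusion_operator[OF C(1) D CD])
    interpret ciB: bounded_operator "completion (gauge_space E B)" "completion (gauge_space E D)"
      "completion_map (gauge_space E B) (gauge_space E D) (\<lambda>x. x)" 1
      by (rule iB.completion_map_operator)
    interpret ciC: bounded_operator "completion (gauge_space E C)" "completion (gauge_space E D)"
      "completion_map (gauge_space E C) (gauge_space E D) (\<lambda>x. x)" 1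
      by (rule iC.completion_map_operator)
    have "completion_map (gauge_space E B) (gauge_space E D) (\<lambda>x. x) (f x) =
        completion_map (gauge_space E C) (gauge_space E D) (\<lambda>x. x) (g x)" if x: "x \<in> carrier V" for x
    proof (rule realize_inj[OF D cl ciB.maps ciC.maps])
      show "f x \<in> carrier (completion (gauge_space E B))" using lin_homD(1)[OF B(2) x] .
      show "g x \<in> carrier (completion (gauge_space E C))" using lin_homD(1)[OF C(2) x] .
      show "realize E (completion_map (gauge_space E B) (gauge_space E D) (\<lambda>x. x) (f x)) =
        realize E (completion_map (gauge_space E C) (gauge_space E D) (\<lambda>x. x) (g x))"
        using fun_cong[OF eq, of x] x
          realize_inclusion[OF B(1) D BD lin_homD(1)[OF B(2) x]]
          realize_inclusion[OF C(1) D CD lin_homD(1)[OF C(2) x]]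
        by (simp add: germ_val_def)
    qed
    then have "compose (carrier V) (farr (dgm (IB E)) B D ()) f =
        compose (carrier V) (farr (dgm (IB E)) C D ()) g"
      by (simp add: compose_def restrict_def fun_eq_iff)
    moreover have "D \<in> Ob (idx (IB E))" "() \<in> Hom (idx (IB E)) B D" "() \<in> Hom (idx (IB E)) C D"
      using D BD CD by auto
    ultimately have "\<exists>D\<in>Ob (idx (IB E)). \<exists>u\<in>Hom (idx (IB E)) B D. \<exists>v\<in>Hom (idx (IB E)) C D.
        compose (carrier V) (farr (dgm (IB E)) B D u) f = compose (carrier V) (farr (dgm (IB E)) C D v) g"
      by (intro bexI[of _ D] bexI[of _ "()"])
    then show "(p, q) \<in> germ_rel V (IB E)"
      unfolding germ_rel_def pq using germs by simp
  qed
qed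

lemma germ_class_eq:
  assumes "p \<in> germs V (IB E)" "q \<in> germs V (IB E)" "germ_val V E p = germ_val V E q"
  shows "germ_rel V (IB E) `` {p} = germ_rel V (IB E) `` {q}"
  using assms by (auto simp: germ_rel_iff)

lemma germ_class:
  assumes "p \<in> germs V (IB E)"
  shows "germ_rel V (IB E) `` {p} \<in> colim_hom V (IB E)"
    "colim_val V E (germ_rel V (IB E) `` {p}) = germ_val V E p"
proof -
  show "germ_rel V (IB E) `` {p} \<in> colim_hom V (IB E)"
    using assms by (simp add: colim_hom_def quotientI)
  have "p \<in> germ_rel V (IB E) `` {p}" using assms by (simp add: germ_rel_iff)
  then have "(SOME q. q \<in> germ_rel V (IB E) `` {p}) \<in> germ_rel V (IB E) `` {p}" by (rule someI)
  then have "(p, SOME q. q \<in> germ_rel V (IB E) `` {p}) \<in> germ_rel V (IB E)"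
    by (simp only: Image_singleton_iff)
  then show "colim_val V E (germ_rel V (IB E) `` {p}) = germ_val V E p"
    unfolding colim_val_def germ_rel_iff by simp
qed

lemma colim_cases:
  assumes "c \<in> colim_hom V (IB E)"
  obtains B f where "(B, f) \<in> germs V (IB E)" "c = germ_rel V (IB E) `` {(B, f)}"
  using assms by (auto simp: colim_hom_def elim!: quotientE)

lemma colim_member:
  assumes c: "c \<in> colim_hom V (IB E)" and p: "(B, f) \<in> c"
  shows "(B, f) \<in> germs V (IB E)" "germ_val V E (B, f) = colim_val V E c"
proof -
  obtain q where "q \<in> germs V (IB E)" "c = germ_rel V (IB E) `` {q}"
    using colim_cases[OF c] by metis
  then show "(B, f) \<in> germs V (IB E)" "germ_val V E (B, f) = colim_val V E c"
    using p germ_class(2) by (auto simp: germ_rel_iff)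
qed

lemma colim_nonempty: "c \<in> colim_hom V (IB E) \<Longrightarrow> c \<noteq> {}"
  by (erule colim_cases) (auto simp: germ_rel_iff)

lemma colim_val_bounded: "c \<in> colim_hom V (IB E) \<Longrightarrow> colim_val V E c \<in> bounded_maps V E"
  by (erule colim_cases) (simp add: germ_class germ_val_bounded)

lemma colim_val_closed:
  assumes "c \<in> colim_hom V (IB E)" "x \<in> carrier V"
  shows "colim_val V E c x \<in> carrier E"
  using colim_val_bounded[OF assms(1)] assms(2) lin_homD(1) by (fastforce simp: bounded_maps_def)

lemma colim_val_inj:
  assumes c: "c \<in> colim_hom V (IB E)" and d: "d \<in> colim_hom V (IB E)"
    and eq: "\<And>x. x \<in> carrier V \<Longrightarrow> colim_val V E c x = colim_val V E d x"
  shows "c = d"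
proof -
  obtain p where p: "p \<in> germs V (IB E)" "c = germ_rel V (IB E) `` {p}" using colim_cases[OF c] by metis
  obtain q where q: "q \<in> germs V (IB E)" "d = germ_rel V (IB E) `` {q}" using colim_cases[OF d] by metis
  have "germ_val V E p = germ_val V E q"
  proof (rule extensionalityI[of _ "carrier V"])
    fix x assume "x \<in> carrier V"
    from eq[OF this] show "germ_val V E p x = germ_val V E q x"
      by (simp only: p(2) q(2) germ_class(2)[OF p(1)] germ_class(2)[OF q(1)])
  qed (simp_all add: germ_val_def)
  from germ_class_eq[OF p(1) q(1) this] show ?thesis by (simp only: p(2) q(2))
qed

text \<open>Together with \<open>colim_val_inj\<close> and \<open>colim_val_bounded\<close>, this identifies the morphisms from \<open>V\<close> to
  \<open>IB E\<close> with the bounded linear maps from \<open>V\<close> to \<open>E\<close>.\<close>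

lemma colim_val_surj:
  assumes "t \<in> bounded_maps V E"
  obtains c where "c \<in> colim_hom V (IB E)" "colim_val V E c = t"
  using bounded_map_factors[OF assms] germ_class by metis

end

lemma UN_constant_eq: "c \<noteq> {} \<Longrightarrow> (\<And>p. p \<in> c \<Longrightarrow> F p = d) \<Longrightarrow> (\<Union>p\<in>c. F p) = d"
  by auto

lemma banach_to_lcsI: "complete_lcs E \<Longrightarrow> is_banach V \<Longrightarrow> banach_to_lcs V E"
  by (simp add: banach_to_lcs_def banach_to_lcs_axioms_def)

text \<open>Naturality in the Banach space: precomposition of germs is precomposition of the corresponding maps
  into \<open>E\<close>.\<close>

lemma germ_pull_val:
  assumes E: "complete_lcs E" and V: "is_banach V" and W: "is_banach W"
    and h: "h \<in> Ban_hom V W" and c: "c \<in> colim_hom W (IB E)"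
  shows "germ_pull V (IB E) c h \<in> colim_hom V (IB E)"
    and "colim_val V E (germ_pull V (IB E) c h) = (\<lambda>x\<in>carrier V. colim_val W E c (h x))"
proof -
  interpret VE: banach_to_lcs V E using E V by (rule banach_to_lcsI)
  interpret WE: banach_to_lcs W E using E W by (rule banach_to_lcsI)
  obtain B f where Bf: "(B, f) \<in> germs W (IB E)" "c = germ_rel W (IB E) `` {(B, f)}"
    using WE.colim_cases[OF c] .
  have pull: "(C, compose (carrier V) g h) \<in> germs V (IB E) \<and>
      germ_val V E (C, compose (carrier V) g h) = (\<lambda>x\<in>carrier V. colim_val W E c (h x))"
    if "(C, g) \<in> c" for C g
  proof
    note Cg = WE.colim_member[OF c that]
    show "(C, compose (carrier V) g h) \<in> germs V (IB E)"
      using Cg(1) compose_Ban_hom[OF V W VE.gauge_banach h] by (simp add: germs_IB_iff)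
    show "germ_val V E (C, compose (carrier V) g h) = (\<lambda>x\<in>carrier V. colim_val W E c (h x))"
      unfolding Cg(2)[symmetric] germ_val_def
      by (rule restrict_ext) (use lin_homD(1)[OF Ban_hom_lin[OF h]] in \<open>simp add: compose_eq\<close>)
  qed
  let ?p = "(B, compose (carrier V) f h)"
  have Bf_in: "(B, f) \<in> c" using Bf WE.germ_rel_iff by simp
  have "germ_pull V (IB E) c h = germ_rel V (IB E) `` {?p}"
    unfolding germ_pull_def
  proof (rule UN_constant_eq[OF WE.colim_nonempty[OF c]])
    fix q assume "q \<in> c"
    then show "(case q of (j, f) \<Rightarrow> germ_rel V (IB E) `` {(j, compose (carrier V) f h)}) =
        germ_rel V (IB E) `` {?p}"
      using pull pull[OF Bf_in] VE.germ_class_eq by (cases q) simp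
  qed
  then show "germ_pull V (IB E) c h \<in> colim_hom V (IB E)"
    and "colim_val V E (germ_pull V (IB E) c h) = (\<lambda>x\<in>carrier V. colim_val W E c (h x))"
    using pull[OF Bf_in] VE.germ_class[of ?p] by simp_all
qed

lemma Tc_hom_lin: "f \<in> Tc_hom E F \<Longrightarrow> f \<in> lin_hom E F"
  by (simp add: Tc_hom_def)

text \<open>Realization is natural because continuous maps preserve limits of sequences; hence the component of
  \<open>IB(g)\<close> at \<open>B\<close> corresponds to \<open>g\<close> after realization.\<close>

lemma IB_map_val:
  assumes E: "complete_lcs E" and F: "complete_lcs F" and g: "g \<in> Tc_hom E F" and B: "B \<in> disks E"
  shows "IB_map E F g B \<in> colim_hom (completion (gauge_space E B)) (IB F)"
    and "colim_val (completion (gauge_space E B)) F (IB_map E F g B)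
      = (\<lambda>P\<in>carrier (completion (gauge_space E B)). g (realize E P))"
proof -
  interpret E: complete_lcs E by fact
  interpret F: complete_lcs F by fact
  let ?V = "completion (gauge_space E B)"
  interpret VF: banach_to_lcs ?V F using F E.gauge_banach[OF B] by (rule banach_to_lcsI)
  have gB: "g ` B \<in> disks F" by (rule image_disk[OF E.lcs_axioms F.lcs_axioms B g])
  note lin = Tc_hom_lin[OF g]
  have op: "bounded_operator (gauge_space E B) (gauge_space F (g ` B)) g 1"
    by (rule gauge_operator[OF E.lcs_axioms F.lcs_axioms B gB])
      (use lin_homD[OF lin] in auto)
  let ?p = "(g ` B, completion_map (gauge_space E B) (gauge_space F (g ` B)) g)"
  have germ: "?p \<in> germs ?V (IB F)"
    using gB bounded_operator.completion_map_Ban_hom[OF op] by (simp add: germs_IB_iff)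
  have "germ_val ?V F ?p = (\<lambda>P\<in>carrier ?V. g (realize E P))"
    unfolding germ_val_def
    by (rule restrict_ext)
      (use g realize_completion_map[OF E F B gB op] in \<open>simp add: Tc_hom_def\<close>)
  then show "IB_map E F g B \<in> colim_hom ?V (IB F)"
    and "colim_val ?V F (IB_map E F g B) = (\<lambda>P\<in>carrier ?V. g (realize E P))"
    using B VF.germ_class[OF germ] by (simp_all add: IB_map_def)
qed

text \<open>Naturality in the locally convex space: composing with \<open>IB(g)\<close> is composing the corresponding map
  into \<open>E\<close> with \<open>g\<close>. The union in the definition of \<open>d\<close> is that of composition in the category of
  ind-objects; all its members coincide because they correspond to the same map into \<open>F\<close>.\<close>

lemma IB_map_apply_val:
  assumes E: "complete_lcs E" and F: "complete_lcs F" and V: "is_banach V"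
    and g: "g \<in> Tc_hom E F" and c: "c \<in> colim_hom V (IB E)"
  defines "d \<equiv> (\<Union>(B, f)\<in>c. germ_pull V (IB F) (IB_map E F g B) f)"
  shows "d \<in> colim_hom V (IB F)" and "colim_val V F d = (\<lambda>x\<in>carrier V. g (colim_val V E c x))"
proof -
  interpret E: complete_lcs E by fact
  interpret VE: banach_to_lcs V E using E V by (rule banach_to_lcsI)
  interpret VF: banach_to_lcs V F using F V by (rule banach_to_lcsI)
  have val: "germ_pull V (IB F) (IB_map E F g B) f \<in> colim_hom V (IB F) \<and>
      colim_val V F (germ_pull V (IB F) (IB_map E F g B) f) = (\<lambda>x\<in>carrier V. g (colim_val V E c x))"
    if "(B, f) \<in> c" for B f
  proof -
    note Bf = VE.colim_member[OF c that]
    have B: "B \<in> disks E" and f: "f \<in> Ban_hom V (completion (gauge_space E B))"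
      using Bf(1) by (auto simp: germs_IB_iff)
    note pull = germ_pull_val[OF F V E.gauge_banach[OF B] f IB_map_val(1)[OF E F g B]]
    have "(\<lambda>x\<in>carrier V. colim_val (completion (gauge_space E B)) F (IB_map E F g B) (f x))
        = (\<lambda>x\<in>carrier V. g (colim_val V E c x))"
      unfolding IB_map_val(2)[OF E F g B] Bf(2)[symmetric] germ_val_def
      by (rule restrict_ext) (use lin_homD(1)[OF Ban_hom_lin[OF f]] in simp)
    then show ?thesis using pull by simp
  qed
  obtain B f where Bf: "(B, f) \<in> c" using VE.colim_nonempty[OF c] by fast
  have "d = germ_pull V (IB F) (IB_map E F g B) f"
    unfolding d_def
  proof (rule UN_constant_eq[OF VE.colim_nonempty[OF c]], clarify)
    fix C h assume Ch: "(C, h) \<in> c"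
    show "germ_pull V (IB F) (IB_map E F g C) h = germ_pull V (IB F) (IB_map E F g B) f"
      using val[OF Ch] val[OF Bf] by (intro VF.colim_val_inj) auto
  qed
  then show "d \<in> colim_hom V (IB F)" "colim_val V F d = (\<lambda>x\<in>carrier V. g (colim_val V E c x))"
    using val[OF Bf] by auto
qed

section \<open>Morphisms of ind-objects into IB E\<close>

lemma is_ind_banach: "is_ind F \<Longrightarrow> a \<in> Ob (idx F) \<Longrightarrow> is_banach (fobj (dgm F) a)"
  by (auto simp: is_ind_def is_functor_def)

lemma is_ind_arrow:
  "is_ind F \<Longrightarrow> a \<in> Ob (idx F) \<Longrightarrow> b \<in> Ob (idx F) \<Longrightarrow> u \<in> Hom (idx F) a b \<Longrightarrow>
    farr (dgm F) a b u \<in> Ban_hom (fobj (dgm F) a) (fobj (dgm F) b)"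
  by (auto simp: is_ind_def is_functor_def)

text \<open>Compatibility of a family of germs along the transition maps of \<open>F\<close> may be tested on the
  corresponding maps into \<open>E\<close>. This lemma, \<open>ind_hom_eqI\<close> and \<open>ind_comp_IB_map\<close> are the tools by
  which all identities between morphisms of ind-objects below are reduced to identities between
  maps.\<close>

lemma ind_homI:
  assumes E: "complete_lcs E" and F: "is_ind F"
    and ext: "\<phi> \<in> extensional (Ob (idx F))"
    and mem: "\<And>a. a \<in> Ob (idx F) \<Longrightarrow> \<phi> a \<in> colim_hom (fobj (dgm F) a) (IB E)"
    and compat: "\<And>a b u x. a \<in> Ob (idx F) \<Longrightarrow> b \<in> Ob (idx F) \<Longrightarrow> u \<in> Hom (idx F) a b \<Longrightarrow>
      x \<in> carrier (fobj (dgm F) a) \<Longrightarrow>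
      colim_val (fobj (dgm F) b) E (\<phi> b) (farr (dgm F) a b u x) = colim_val (fobj (dgm F) a) E (\<phi> a) x"
  shows "\<phi> \<in> ind_hom F (IB E)"
  unfolding ind_hom_def
proof (intro CollectI conjI ballI)
  show "\<phi> \<in> (\<Pi>\<^sub>E a\<in>Ob (idx F). colim_hom (fobj (dgm F) a) (IB E))"
    using ext mem by (auto simp: PiE_def)
  fix a b u assume a: "a \<in> Ob (idx F)" and b: "b \<in> Ob (idx F)" and u: "u \<in> Hom (idx F) a b"
  interpret banach_to_lcs "fobj (dgm F) a" E using E is_ind_banach[OF F a] by (rule banach_to_lcsI)
  note pull = germ_pull_val[OF E is_ind_banach[OF F a] is_ind_banach[OF F b]
      is_ind_arrow[OF F a b u] mem[OF b]]
  show "germ_pull (fobj (dgm F) a) (IB E) (\<phi> b) (farr (dgm F) a b u) = \<phi> a"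
    by (rule colim_val_inj[OF pull(1) mem[OF a]]) (simp add: pull(2) compat[OF a b u])
qed

lemma ind_homD:
  assumes \<phi>: "\<phi> \<in> ind_hom F (IB E)"
  shows "\<phi> \<in> extensional (Ob (idx F))"
    and "a \<in> Ob (idx F) \<Longrightarrow> \<phi> a \<in> colim_hom (fobj (dgm F) a) (IB E)"
  using \<phi> by (auto simp: ind_hom_def PiE_def)

lemma ind_hom_compat:
  assumes E: "complete_lcs E" and F: "is_ind F" and \<phi>: "\<phi> \<in> ind_hom F (IB E)"
    and a: "a \<in> Ob (idx F)" and b: "b \<in> Ob (idx F)" and u: "u \<in> Hom (idx F) a b"
    and x: "x \<in> carrier (fobj (dgm F) a)"
  shows "colim_val (fobj (dgm F) b) E (\<phi> b) (farr (dgm F) a b u x)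
    = colim_val (fobj (dgm F) a) E (\<phi> a) x"
proof -
  have "germ_pull (fobj (dgm F) a) (IB E) (\<phi> b) (farr (dgm F) a b u) = \<phi> a"
    using \<phi> a b u by (simp add: ind_hom_def)
  then show ?thesis
    using germ_pull_val(2)[OF E is_ind_banach[OF F a] is_ind_banach[OF F b]
      is_ind_arrow[OF F a b u] ind_homD(2)[OF \<phi> b]] x by simp
qed

lemma ind_hom_eqI:
  assumes E: "complete_lcs E" and F: "is_ind F"
    and \<phi>: "\<phi> \<in> ind_hom F (IB E)" and \<psi>: "\<psi> \<in> ind_hom F (IB E)"
    and eq: "\<And>a x. a \<in> Ob (idx F) \<Longrightarrow> x \<in> carrier (fobj (dgm F) a) \<Longrightarrow>
      colim_val (fobj (dgm F) a) E (\<phi> a) x = colim_val (fobj (dgm F) a) E (\<psi> a) x"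
  shows "\<phi> = \<psi>"
proof (rule extensionalityI[OF ind_homD(1)[OF \<phi>] ind_homD(1)[OF \<psi>]])
  fix a assume a: "a \<in> Ob (idx F)"
  interpret banach_to_lcs "fobj (dgm F) a" E using E is_ind_banach[OF F a] by (rule banach_to_lcsI)
  show "\<phi> a = \<psi> a"
    by (rule colim_val_inj[OF ind_homD(2)[OF \<phi> a] ind_homD(2)[OF \<psi> a] eq[OF a]])
qed

lemma ind_comp_IB_map:
  assumes E: "complete_lcs E" and E': "complete_lcs E'" and F: "is_ind F"
    and g: "g \<in> Tc_hom E E'" and \<phi>: "\<phi> \<in> ind_hom F (IB E)"
  shows "ind_comp F (IB E') (IB_map E E' g) \<phi> \<in> ind_hom F (IB E')"
    and "a \<in> Ob (idx F) \<Longrightarrow> x \<in> carrier (fobj (dgm F) a) \<Longrightarrow>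
      colim_val (fobj (dgm F) a) E' (ind_comp F (IB E') (IB_map E E' g) \<phi> a) x
      = g (colim_val (fobj (dgm F) a) E (\<phi> a) x)"
proof -
  let ?\<psi> = "ind_comp F (IB E') (IB_map E E' g) \<phi>"
  have val: "?\<psi> a \<in> colim_hom (fobj (dgm F) a) (IB E') \<and> colim_val (fobj (dgm F) a) E' (?\<psi> a)
      = (\<lambda>x\<in>carrier (fobj (dgm F) a). g (colim_val (fobj (dgm F) a) E (\<phi> a) x))"
    if a: "a \<in> Ob (idx F)" for a
    using IB_map_apply_val[OF E E' is_ind_banach[OF F a] g ind_homD(2)[OF \<phi> a]] a
    by (simp add: ind_comp_def)
  then show "a \<in> Ob (idx F) \<Longrightarrow> x \<in> carrier (fobj (dgm F) a) \<Longrightarrow>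
      colim_val (fobj (dgm F) a) E' (?\<psi> a) x = g (colim_val (fobj (dgm F) a) E (\<phi> a) x)"
    by simp
  show "?\<psi> \<in> ind_hom F (IB E')"
  proof (rule ind_homI[OF E' F])
    show "?\<psi> \<in> extensional (Ob (idx F))" by (simp add: ind_comp_def)
    fix a assume a: "a \<in> Ob (idx F)"
    show "?\<psi> a \<in> colim_hom (fobj (dgm F) a) (IB E')" using val[OF a] by simp
    fix b u x assume b: "b \<in> Ob (idx F)" and u: "u \<in> Hom (idx F) a b"
      and x: "x \<in> carrier (fobj (dgm F) a)"
    have "farr (dgm F) a b u x \<in> carrier (fobj (dgm F) b)"
      using lin_homD(1)[OF Ban_hom_lin[OF is_ind_arrow[OF F a b u]] x] .
    then show "colim_val (fobj (dgm F) b) E' (?\<psi> b) (farr (dgm F) a b u x)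
        = colim_val (fobj (dgm F) a) E' (?\<psi> a) x"
      using val[OF a] val[OF b] ind_hom_compat[OF E F \<phi> a b u x] x by simp
  qed
qed

lemma IB_map_ind_hom:
  assumes E: "complete_lcs E" and F: "complete_lcs F" and g: "g \<in> Tc_hom E F"
  shows "IB_map E F g \<in> ind_hom (IB E) (IB F)"
proof -
  interpret E: complete_lcs E by fact
  show ?thesis
  proof (rule ind_homI[OF F E.IB_is_ind])
    show "IB_map E F g \<in> extensional (Ob (idx (IB E)))" by (simp add: IB_map_def)
    fix B assume "B \<in> Ob (idx (IB E))"
    then have B: "B \<in> disks E" by simp
    show "IB_map E F g B \<in> colim_hom (fobj (dgm (IB E)) B) (IB F)"
      using IB_map_val(1)[OF E F g B] by simp
    fix C u x assume "C \<in> Ob (idx (IB E))" and u: "u \<in> Hom (idx (IB E)) B C"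
      and "x \<in> carrier (fobj (dgm (IB E)) B)"
    then have C: "C \<in> disks E" and BC: "B \<subseteq> C" and x: "x \<in> carrier (completion (gauge_space E B))"
      by (auto split: if_splits)
    have "completion_map (gauge_space E B) (gauge_space E C) (\<lambda>x. x) x
        \<in> carrier (completion (gauge_space E C))"
      using lin_homD(1)[OF Ban_hom_lin[OF bounded_operator.completion_map_Ban_hom[OF
            E.inclusion_operator[OF B C BC]]] x] .
    then show "colim_val (fobj (dgm (IB E)) C) F (IB_map E F g C) (farr (dgm (IB E)) B C u x)
        = colim_val (fobj (dgm (IB E)) B) F (IB_map E F g B) x"
      using x by (simp add: IB_map_val(2)[OF E F g B] IB_map_val(2)[OF E F g C]
          E.realize_inclusion[OF B C BC x])
  qed
qed

lemma IB_map_id: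
  assumes E: "complete_lcs E"
  shows "IB_map E E (\<lambda>x\<in>carrier E. x) = ind_id (IB E)"
proof (rule extensionalityI[of _ "disks E"])
  interpret E: complete_lcs E by fact
  have id: "(\<lambda>x\<in>carrier E. x) \<in> Tc_hom E E"
    unfolding Tc_hom_def
    by (auto intro!: lin_homI continuous_map_eq[OF continuous_map_id] simp: E.smult_in)
  fix B assume B: "B \<in> disks E"
  let ?V = "completion (gauge_space E B)"
  interpret VE: banach_to_lcs ?V E using E E.gauge_banach[OF B] by (rule banach_to_lcsI)
  have "(\<lambda>x\<in>carrier ?V. x) \<in> Ban_hom ?V ?V"
    by (rule Ban_homI[OF VE.banach VE.banach, where K = 1])
      (auto intro!: lin_homI simp: VE.V.smult_in)
  then have germ: "(B, \<lambda>x\<in>carrier ?V. x) \<in> germs ?V (IB E)" using B by (simp add: germs_IB_iff)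
  have "IB_map E E (\<lambda>x\<in>carrier E. x) B = germ_rel ?V (IB E) `` {(B, \<lambda>x\<in>carrier ?V. x)}"
    by (rule VE.colim_val_inj[OF IB_map_val(1)[OF E E id B] VE.germ_class(1)[OF germ]])
      (simp add: IB_map_val(2)[OF E E id B] VE.germ_class(2)[OF germ] germ_val_def
        E.realize_closed[OF B])
  then show "IB_map E E (\<lambda>x\<in>carrier E. x) B = ind_id (IB E) B"
    using B by (simp add: ind_id_def)
qed (auto simp: IB_map_def ind_id_def)

lemma compose_Tc_hom:
  assumes "lcs E" "f \<in> Tc_hom E F" "g \<in> Tc_hom F G"
  shows "compose (carrier E) g f \<in> Tc_hom E G"
proof -
  interpret E: lcs E by fact
  have "continuous_map (topol E) (topol G) (g \<circ> f)"
    using assms continuous_map_compose by (auto simp: Tc_hom_def)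
  then have "continuous_map (topol E) (topol G) (compose (carrier E) g f)"
    by (rule continuous_map_eq) (simp add: compose_eq)
  then show ?thesis
    using compose_lin_hom[OF Tc_hom_lin[OF assms(2)] Tc_hom_lin[OF assms(3)] E.complex_space_axioms]
    by (simp add: Tc_hom_def)
qed

lemma IB_map_comp:
  assumes E: "complete_lcs E" and F: "complete_lcs F" and G: "complete_lcs G"
    and f: "f \<in> Tc_hom E F" and g: "g \<in> Tc_hom F G"
  shows "ind_comp (IB E) (IB G) (IB_map F G g) (IB_map E F f) = IB_map E G (compose (carrier E) g f)"
proof -
  interpret E: complete_lcs E by fact
  have gf: "compose (carrier E) g f \<in> Tc_hom E G" by (rule compose_Tc_hom[OF E.lcs_axioms f g])
  note fi = IB_map_ind_hom[OF E F f]
  note comp = ind_comp_IB_map[OF F G E.IB_is_ind g fi]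
  show ?thesis
  proof (rule ind_hom_eqI[OF G E.IB_is_ind comp(1) IB_map_ind_hom[OF E G gf]])
    fix B P assume BP: "B \<in> Ob (idx (IB E))" "P \<in> carrier (fobj (dgm (IB E)) B)"
    then have B: "B \<in> disks E" and P: "P \<in> carrier (completion (gauge_space E B))" by auto
    show "colim_val (fobj (dgm (IB E)) B) G (ind_comp (IB E) (IB G) (IB_map F G g) (IB_map E F f) B) P
        = colim_val (fobj (dgm (IB E)) B) G (IB_map E G (compose (carrier E) g f) B) P"
      using comp(2)[OF BP] P E.realize_closed[OF B P]
      by (simp add: IB_map_val(2)[OF E F f B] IB_map_val(2)[OF E G gf B] compose_eq)
  qed
qed

section \<open>Limits of diagrams of complete locally convex spaces\<close>

locale complete_diagram =
  fixes J :: "('i, 'm) cat" and X :: "('i, 'm, 'a lctvs, 'a \<Rightarrow> 'a) func"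
  assumes diagram: "is_functor J Tc X"
    and complete: "\<And>i. i \<in> Ob J \<Longrightarrow> complete_lcs (fobj X i)"
begin

abbreviation L :: "('i \<Rightarrow> 'a) lctvs" where "L \<equiv> Tc_lim J X"

lemma arrow: "a \<in> Ob J \<Longrightarrow> b \<in> Ob J \<Longrightarrow> u \<in> Hom J a b \<Longrightarrow> farr X a b u \<in> Tc_hom (fobj X a) (fobj X b)"
  using diagram by (auto simp: is_functor_def Tc_def)

lemma object: "i \<in> Ob J \<Longrightarrow> lcs (fobj X i)"
  using complete by (simp add: complete_lcs_def)

lemma space: "i \<in> Ob J \<Longrightarrow> complex_space (fobj X i)"
  using object[of i] by (simp add: lcs_def is_lctvs_def complex_space_def)

lemma L_iff: "x \<in> carrier L \<longleftrightarrow> x \<in> extensional (Ob J) \<and> (\<forall>i\<in>Ob J. x i \<in> carrier (fobj X i)) \<and>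
    (\<forall>a\<in>Ob J. \<forall>b\<in>Ob J. \<forall>u\<in>Hom J a b. farr X a b u (x a) = x b)"
  by (auto simp: Tc_lim_def Let_def PiE_def)

lemma L_ops:
  "x \<oplus>\<^bsub>L\<^esub> y = (\<lambda>i\<in>Ob J. x i \<oplus>\<^bsub>fobj X i\<^esub> y i)"
  "c \<odot>\<^bsub>L\<^esub> x = (\<lambda>i\<in>Ob J. c \<odot>\<^bsub>fobj X i\<^esub> x i)"
  "\<zero>\<^bsub>L\<^esub> = (\<lambda>i\<in>Ob J. \<zero>\<^bsub>fobj X i\<^esub>)"
  by (simp_all add: Tc_lim_def Let_def)

lemma L_component: "x \<in> carrier L \<Longrightarrow> i \<in> Ob J \<Longrightarrow> x i \<in> carrier (fobj X i)"
  by (simp add: L_iff)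

lemma L_topology:
  "topol L = subtopology (product_topology (\<lambda>i. topol (fobj X i)) (Ob J)) (carrier L)"
  by (simp add: Tc_lim_def Let_def)

lemma L_eqI:
  assumes "x \<in> carrier L" "y \<in> carrier L" "\<And>i. i \<in> Ob J \<Longrightarrow> x i = y i"
  shows "x = y"
  by (rule extensionalityI[of _ "Ob J"]) (use assms in \<open>auto simp: L_iff\<close>)

lemma L_add_closed: "x \<in> carrier L \<Longrightarrow> y \<in> carrier L \<Longrightarrow> x \<oplus>\<^bsub>L\<^esub> y \<in> carrier L"
  using lin_homD(3)[OF Tc_hom_lin[OF arrow]]
  by (auto simp: L_iff L_ops complex_space.add_closed[OF space])

lemma L_smult_closed: "x \<in> carrier L \<Longrightarrow> c \<odot>\<^bsub>L\<^esub> x \<in> carrier L"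
  using lin_homD(4)[OF Tc_hom_lin[OF arrow]]
  by (auto simp: L_iff L_ops complex_space.smult_in[OF space])

lemma L_zero_closed: "\<zero>\<^bsub>L\<^esub> \<in> carrier L"
  using lin_hom_zero[OF space space Tc_hom_lin[OF arrow]] complex_space.closed(4)[OF space]
  by (auto simp: L_iff L_ops)

lemma L_complex_space: "complex_space L"
proof (rule complex_space.intro, rule complex_vsI)
  fix x y z a b assume x: "x \<in> carrier L"
  note xi = L_component[OF x]
  show "a \<odot>\<^bsub>L\<^esub> x \<in> carrier L" by (rule L_smult_closed[OF x])
  show "\<zero>\<^bsub>L\<^esub> \<oplus>\<^bsub>L\<^esub> x = x"
  proof (rule L_eqI[OF L_add_closed[OF L_zero_closed x] x])
    fix i assume i: "i \<in> Ob J"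
    interpret complex_space "fobj X i" by (rule space[OF i])
    show "(\<zero>\<^bsub>L\<^esub> \<oplus>\<^bsub>L\<^esub> x) i = x i" using i xi[OF i] by (simp add: L_ops)
  qed
  show "(a + b) \<odot>\<^bsub>L\<^esub> x = a \<odot>\<^bsub>L\<^esub> x \<oplus>\<^bsub>L\<^esub> b \<odot>\<^bsub>L\<^esub> x"
    using xi by (auto simp: L_ops complex_space.smult_add_left[OF space] intro!: restrict_ext)
  show "(a * b) \<odot>\<^bsub>L\<^esub> x = a \<odot>\<^bsub>L\<^esub> (b \<odot>\<^bsub>L\<^esub> x)"
    using xi by (auto simp: L_ops complex_space.smult_smult[OF space] intro!: restrict_ext)
  show "1 \<odot>\<^bsub>L\<^esub> x = x"
    by (rule L_eqI[OF L_smult_closed[OF x] x])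
      (use xi in \<open>simp add: L_ops complex_space.one_smult[OF space]\<close>)
  show "0 \<odot>\<^bsub>L\<^esub> x = \<zero>\<^bsub>L\<^esub>"
    using xi by (auto simp: L_ops complex_space.zero_smult[OF space] intro!: restrict_ext)
  assume y: "y \<in> carrier L"
  note yi = L_component[OF y]
  show "x \<oplus>\<^bsub>L\<^esub> y \<in> carrier L" by (rule L_add_closed[OF x y])
  show "x \<oplus>\<^bsub>L\<^esub> y = y \<oplus>\<^bsub>L\<^esub> x"
    unfolding L_ops
  proof (rule restrict_ext)
    fix i assume i: "i \<in> Ob J"
    interpret complex_space "fobj X i" by (rule space[OF i])
    show "x i \<oplus>\<^bsub>fobj X i\<^esub> y i = y i \<oplus>\<^bsub>fobj X i\<^esub> x i" using xi[OF i] yi[OF i] by (simp add: M.a_comm)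
  qed
  show "a \<odot>\<^bsub>L\<^esub> (x \<oplus>\<^bsub>L\<^esub> y) = a \<odot>\<^bsub>L\<^esub> x \<oplus>\<^bsub>L\<^esub> a \<odot>\<^bsub>L\<^esub> y"
    using xi yi by (auto simp: L_ops complex_space.smult_add_right[OF space] intro!: restrict_ext)
  assume z: "z \<in> carrier L"
  note zi = L_component[OF z]
  show "x \<oplus>\<^bsub>L\<^esub> y \<oplus>\<^bsub>L\<^esub> z = x \<oplus>\<^bsub>L\<^esub> (y \<oplus>\<^bsub>L\<^esub> z)"
    unfolding L_ops
  proof (rule restrict_ext)
    fix i assume i: "i \<in> Ob J"
    interpret complex_space "fobj X i" by (rule space[OF i])
    show "(\<lambda>i\<in>Ob J. x i \<oplus>\<^bsub>fobj X i\<^esub> y i) i \<oplus>\<^bsub>fobj X i\<^esub> z i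
        = x i \<oplus>\<^bsub>fobj X i\<^esub> (\<lambda>i\<in>Ob J. y i \<oplus>\<^bsub>fobj X i\<^esub> z i) i"
      using xi[OF i] yi[OF i] zi[OF i] i by (simp add: M.a_assoc)
  qed
qed (rule L_zero_closed)

lemma L_diff:
  assumes "x \<in> carrier L" "y \<in> carrier L" "i \<in> Ob J"
  shows "(x \<ominus>\<^bsub>L\<^esub> y) i = x i \<ominus>\<^bsub>fobj X i\<^esub> y i"
proof -
  have "x \<ominus>\<^bsub>L\<^esub> y = x \<oplus>\<^bsub>L\<^esub> (-1) \<odot>\<^bsub>L\<^esub> y"
    by (rule complex_space.diff_eq[OF L_complex_space assms(1,2)])
  then show ?thesis
    using assms complex_space.diff_eq[OF space[OF assms(3)] L_component[OF assms(1,3)] L_component[OF assms(2,3)]]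
    by (simp add: L_ops)
qed

lemma topspace_L: "topspace (topol L) = carrier L"
proof -
  have "carrier L \<subseteq> (\<Pi>\<^sub>E i\<in>Ob J. topspace (topol (fobj X i)))"
    by (auto simp: L_iff PiE_def lcs.topspace_T[OF object])
  then show ?thesis unfolding L_topology by (auto simp: topspace_subtopology)
qed

lemma continuous_into_L:
  assumes "\<And>z. z \<in> topspace Z \<Longrightarrow> f z \<in> carrier L"
    and "\<And>i. i \<in> Ob J \<Longrightarrow> continuous_map Z (topol (fobj X i)) (\<lambda>z. f z i)"
  shows "continuous_map Z (topol L) f"
  unfolding L_topology continuous_map_in_subtopology continuous_map_componentwise
  using assms by (auto simp: L_iff)

lemma component_continuous:
  assumes "i \<in> Ob J"
  shows "continuous_map (topol L) (topol (fobj X i)) (\<lambda>x. x i)"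
  unfolding L_topology
  by (rule continuous_map_from_subtopology) (rule continuous_map_product_projection[OF assms])

text \<open>The topology of the limit has a base of neighbourhoods of zero consisting of its
  intersections with boxes, that is products of neighbourhoods finitely many of which are proper.\<close>

lemma box_nbhd:
  assumes U: "openin (topol L) U" and z: "\<zero>\<^bsub>L\<^esub> \<in> U"
  shows "\<exists>W. finite {i \<in> Ob J. W i \<noteq> carrier (fobj X i)} \<and>
    (\<forall>i\<in>Ob J. openin (topol (fobj X i)) (W i)) \<and> (\<forall>i\<in>Ob J. \<zero>\<^bsub>fobj X i\<^esub> \<in> W i) \<and>
    (\<forall>x\<in>carrier L. (\<forall>i\<in>Ob J. x i \<in> W i) \<longrightarrow> x \<in> U)"
proof -
  obtain S where S: "openin (product_topology (\<lambda>i. topol (fobj X i)) (Ob J)) S" "U = S \<inter> carrier L"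
    using U unfolding L_topology openin_subtopology by blast
  have "\<zero>\<^bsub>L\<^esub> \<in> S" using z S by blast
  then obtain W where W: "finite {i \<in> Ob J. W i \<noteq> topspace (topol (fobj X i))}"
    "\<forall>i\<in>Ob J. openin (topol (fobj X i)) (W i)" "\<zero>\<^bsub>L\<^esub> \<in> Pi\<^sub>E (Ob J) W" "Pi\<^sub>E (Ob J) W \<subseteq> S"
    using S(1)[unfolded openin_product_topology_alt] by meson
  have fin: "{i \<in> Ob J. W i \<noteq> carrier (fobj X i)} = {i \<in> Ob J. W i \<noteq> topspace (topol (fobj X i))}"
    using lcs.topspace_T[OF object] by auto
  show ?thesis
  proof (rule exI[of _ W], intro conjI ballI impI)
    show "finite {i \<in> Ob J. W i \<noteq> carrier (fobj X i)}" using W(1) fin by simp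
    show "openin (topol (fobj X i)) (W i)" if "i \<in> Ob J" for i using W that by blast
    show "\<zero>\<^bsub>fobj X i\<^esub> \<in> W i" if "i \<in> Ob J" for i using PiE_mem[OF W(3) that] that by (simp add: L_ops)
    show "x \<in> U" if x: "x \<in> carrier L" "\<forall>i\<in>Ob J. x i \<in> W i" for x
    proof -
      have "x \<in> Pi\<^sub>E (Ob J) W" using x by (auto simp: PiE_def L_iff)
      then show ?thesis using W(4) S(2) x(1) by blast
    qed
  qed
qed

text \<open>Each side of a box neighbourhood is replaced by a convex set with zero in its interior. A side that
  is the whole space is kept, since otherwise the new box could have infinitely many proper sides and
  fail to be a neighbourhood.\<close>

lemma L_locally_convex:
  assumes U: "openin (topol L) U" and z: "\<zero>\<^bsub>L\<^esub> \<in> U"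
  shows "\<exists>V C. openin (topol L) V \<and> \<zero>\<^bsub>L\<^esub> \<in> V \<and> V \<subseteq> C \<and> convex_in L C \<and> C \<subseteq> U"
proof -
  obtain W where box: "finite {i \<in> Ob J. W i \<noteq> carrier (fobj X i)}"
    "\<forall>i\<in>Ob J. openin (topol (fobj X i)) (W i)" "\<forall>i\<in>Ob J. \<zero>\<^bsub>fobj X i\<^esub> \<in> W i"
    "\<forall>x\<in>carrier L. (\<forall>i\<in>Ob J. x i \<in> W i) \<longrightarrow> x \<in> U"
    using box_nbhd[OF U z] by blast
  note W = box[rule_format]
  define Q where "Q i V C \<longleftrightarrow> openin (topol (fobj X i)) V \<and> \<zero>\<^bsub>fobj X i\<^esub> \<in> V \<and> V \<subseteq> C \<and>
      convex_in (fobj X i) C \<and> C \<subseteq> W i \<and> (W i = carrier (fobj X i) \<longrightarrow> V = carrier (fobj X i))"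
    for i V C
  have "\<exists>V C. Q i V C" if i: "i \<in> Ob J" for i
  proof (cases "W i = carrier (fobj X i)")
    case True
    interpret complex_space "fobj X i" by (rule space[OF i])
    show ?thesis
      unfolding Q_def
      by (rule exI[of _ "W i"], rule exI[of _ "W i"])
        (use W(2,3)[OF i] True in \<open>auto simp: convex_in_def smult_in\<close>)
  next
    case False
    have "is_lctvs (fobj X i)" using object[OF i] by (simp add: lcs_def)
    then have "\<exists>V C. openin (topol (fobj X i)) V \<and> \<zero>\<^bsub>fobj X i\<^esub> \<in> V \<and> V \<subseteq> C \<and>
        convex_in (fobj X i) C \<and> C \<subseteq> W i"
      using W(2,3)[OF i] unfolding is_lctvs_def by simp
    then show ?thesis using False by (simp add: Q_def)
  qed
  then obtain V C where Q: "\<And>i. i \<in> Ob J \<Longrightarrow> Q i (V i) (C i)" by metis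
  have V: "\<And>i. i \<in> Ob J \<Longrightarrow> openin (topol (fobj X i)) (V i)"
    "\<And>i. i \<in> Ob J \<Longrightarrow> \<zero>\<^bsub>fobj X i\<^esub> \<in> V i" "\<And>i. i \<in> Ob J \<Longrightarrow> V i \<subseteq> C i"
    "\<And>i. i \<in> Ob J \<Longrightarrow> convex_in (fobj X i) (C i)" "\<And>i. i \<in> Ob J \<Longrightarrow> C i \<subseteq> W i"
    "\<And>i. i \<in> Ob J \<Longrightarrow> W i = carrier (fobj X i) \<Longrightarrow> V i = carrier (fobj X i)"
    using Q by (simp_all add: Q_def)
  have fin: "finite {i \<in> Ob J. V i \<noteq> topspace (topol (fobj X i))}"
    by (rule finite_subset[OF _ W(1)]) (use V(6) lcs.topspace_T[OF object] in auto)
  have "openin (product_topology (\<lambda>i. topol (fobj X i)) (Ob J)) (Pi\<^sub>E (Ob J) V)"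
    using fin V(1) by (simp add: openin_PiE_gen)
  then have "openin (topol L) (Pi\<^sub>E (Ob J) V \<inter> carrier L)"
    unfolding L_topology openin_subtopology by blast
  moreover have "\<zero>\<^bsub>L\<^esub> \<in> Pi\<^sub>E (Ob J) V \<inter> carrier L"
    using V(2) L_zero_closed by (auto simp: L_ops)
  moreover have "Pi\<^sub>E (Ob J) V \<inter> carrier L \<subseteq> {x \<in> carrier L. \<forall>i\<in>Ob J. x i \<in> C i}"
    using V(3) by auto
  moreover have "convex_in L {x \<in> carrier L. \<forall>i\<in>Ob J. x i \<in> C i}"
    using V(4) unfolding convex_in_def
    by (auto intro!: L_add_closed L_smult_closed simp: L_ops(1,2)[THEN fun_cong])
  moreover have "{x \<in> carrier L. \<forall>i\<in>Ob J. x i \<in> C i} \<subseteq> U"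
    using V(5) W(4) by blast
  ultimately show ?thesis by blast
qed

lemma L_lctvs: "is_lctvs L"
  unfolding is_lctvs_def
proof (intro conjI allI impI)
  show "complex_vs L" using L_complex_space by (simp add: complex_space_def)
  show "topspace (topol L) = carrier L" by (rule topspace_L)
  show "continuous_map (prod_topology (topol L) (topol L)) (topol L) (\<lambda>(x, y). x \<oplus>\<^bsub>L\<^esub> y)"
  proof (rule continuous_into_L)
    fix i assume i: "i \<in> Ob J"
    have "continuous_map (prod_topology (topol L) (topol L)) (topol (fobj X i))
        (\<lambda>p. fst p i \<oplus>\<^bsub>fobj X i\<^esub> snd p i)"
      by (intro lcs.continuous_add[OF object[OF i]]
          continuous_map_compose[OF continuous_map_fst component_continuous[OF i], unfolded o_def]
          continuous_map_compose[OF continuous_map_snd component_continuous[OF i], unfolded o_def])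
    then show "continuous_map (prod_topology (topol L) (topol L)) (topol (fobj X i))
        (\<lambda>p. (case p of (x, y) \<Rightarrow> x \<oplus>\<^bsub>L\<^esub> y) i)"
      using i by (simp add: L_ops case_prod_unfold)
  qed (auto simp: topspace_L L_add_closed)
  show "continuous_map (prod_topology euclidean (topol L)) (topol L) (\<lambda>(c, x). c \<odot>\<^bsub>L\<^esub> x)"
  proof (rule continuous_into_L)
    fix i assume i: "i \<in> Ob J"
    have "continuous_map (prod_topology euclidean (topol L)) (topol (fobj X i))
        (\<lambda>p. fst p \<odot>\<^bsub>fobj X i\<^esub> snd p i)"
      by (intro lcs.continuous_smult[OF object[OF i]] continuous_map_fst
          continuous_map_compose[OF continuous_map_snd component_continuous[OF i], unfolded o_def])
    then show "continuous_map (prod_topology euclidean (topol L)) (topol (fobj X i))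
        (\<lambda>p. (case p of (c, x) \<Rightarrow> c \<odot>\<^bsub>L\<^esub> x) i)"
      using i by (simp add: L_ops case_prod_unfold)
  qed (auto simp: topspace_L L_smult_closed)
qed (use L_locally_convex in blast)

text \<open>A Cauchy sequence in the limit converges in each component. The componentwise limits are again
  compatible, as the maps of the diagram are continuous and limits in its Hausdorff spaces are
  unique.\<close>

lemma L_complete: "complete_lcs L"
proof
  show "is_lctvs L" by (rule L_lctvs)
  show "Hausdorff_space (topol L)"
    unfolding L_topology
    by (rule Hausdorff_space_subtopology)
      (use complete_lcs.hausdorff[OF complete] in \<open>auto simp: Hausdorff_space_product_topology\<close>)
  fix s :: "nat \<Rightarrow> 'i \<Rightarrow> 'a"
  assume s: "\<And>n. s n \<in> carrier L"
    and cauchy: "\<And>U. openin (topol L) U \<Longrightarrow> \<zero>\<^bsub>L\<^esub> \<in> U \<Longrightarrow> \<exists>N. \<forall>m\<ge>N. \<forall>n\<ge>N. s m \<ominus>\<^bsub>L\<^esub> s n \<in> U"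
  have "\<exists>l. limitin (topol (fobj X i)) (\<lambda>n. s n i) l sequentially" if i: "i \<in> Ob J" for i
  proof (rule complete_lcs.sequentially_complete[OF complete[OF i]])
    show "s n i \<in> carrier (fobj X i)" for n using L_component[OF s i] .
    fix U assume U: "openin (topol (fobj X i)) U" "\<zero>\<^bsub>fobj X i\<^esub> \<in> U"
    have "openin (topol L) {x \<in> carrier L. x i \<in> U}"
      using openin_continuous_map_preimage[OF component_continuous[OF i] U(1)] by (simp add: topspace_L)
    moreover have "\<zero>\<^bsub>L\<^esub> \<in> {x \<in> carrier L. x i \<in> U}" using U(2) i L_zero_closed by (simp add: L_ops)
    ultimately obtain N where "\<forall>m\<ge>N. \<forall>n\<ge>N. s m \<ominus>\<^bsub>L\<^esub> s n \<in> {x \<in> carrier L. x i \<in> U}"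
      using cauchy by blast
    then show "\<exists>N. \<forall>m\<ge>N. \<forall>n\<ge>N. s m i \<ominus>\<^bsub>fobj X i\<^esub> s n i \<in> U"
      using L_diff[OF s s i] by auto
  qed
  then obtain l where l: "\<And>i. i \<in> Ob J \<Longrightarrow> limitin (topol (fobj X i)) (\<lambda>n. s n i) (l i) sequentially"
    by metis
  define y where "y = (\<lambda>i\<in>Ob J. l i)"
  have yl: "limitin (topol (fobj X i)) (\<lambda>n. s n i) (y i) sequentially" if "i \<in> Ob J" for i
    using l[OF that] that by (simp add: y_def)
  have y: "y \<in> carrier L"
    unfolding L_iff
  proof (intro conjI ballI)
    show "y \<in> extensional (Ob J)" by (simp add: y_def)
    show "y i \<in> carrier (fobj X i)" if "i \<in> Ob J" for i
      using limitin_topspace[OF yl[OF that]] lcs.topspace_T[OF object[OF that]] by simp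
    fix a b u assume a: "a \<in> Ob J" and b: "b \<in> Ob J" and u: "u \<in> Hom J a b"
    have "continuous_map (topol (fobj X a)) (topol (fobj X b)) (farr X a b u)"
      using arrow[OF a b u] by (simp add: Tc_hom_def)
    from continuous_map_limit[OF this yl[OF a]]
    have "limitin (topol (fobj X b)) (\<lambda>n. s n b) (farr X a b u (y a)) sequentially"
      using s a b u by (simp add: o_def L_iff)
    then show "farr X a b u (y a) = y b"
      using complete_lcs.limit_unique[OF complete[OF b]] yl[OF b] by blast
  qed
  have sub: "carrier L \<subseteq> topspace (product_topology (\<lambda>i. topol (fobj X i)) (Ob J))"
    by (auto simp: L_iff PiE_def lcs.topspace_T[OF object])
  have "limitin (topol L) s y sequentially"
    unfolding L_topology limitin_subtopology limitin_componentwise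
  proof (intro conjI ballI always_eventually allI y s yl)
    show "y \<in> extensional (Ob J)" using y by (simp add: L_iff)
    show "s n \<in> topspace (product_topology (\<lambda>i. topol (fobj X i)) (Ob J))" for n
      using s sub by blast
  qed
  then show "\<exists>l. limitin (topol L) s l sequentially" by blast
qed

text \<open>A box neighbourhood restricts only finitely many components, so the smallest of finitely many
  scaling factors works for all of them.\<close>

lemma bounded_in_L:
  assumes B: "B \<subseteq> carrier L" and bd: "\<And>i. i \<in> Ob J \<Longrightarrow> bounded_in (fobj X i) ((\<lambda>x. x i) ` B)"
  shows "bounded_in L B"
proof -
  interpret L: lcs L by (rule lcs.intro[OF L_lctvs])
  show ?thesis
  proof (rule L.bounded_inI[OF B])
    fix U assume U: "openin (topol L) U" "\<zero>\<^bsub>L\<^esub> \<in> U"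
    obtain W where box: "finite {i \<in> Ob J. W i \<noteq> carrier (fobj X i)}"
      "\<forall>i\<in>Ob J. openin (topol (fobj X i)) (W i)" "\<forall>i\<in>Ob J. \<zero>\<^bsub>fobj X i\<^esub> \<in> W i"
      "\<forall>x\<in>carrier L. (\<forall>i\<in>Ob J. x i \<in> W i) \<longrightarrow> x \<in> U"
      using box_nbhd[OF U] by blast
    note W = box[rule_format]
    let ?K = "{i \<in> Ob J. W i \<noteq> carrier (fobj X i)}"
    have "\<exists>e>0. \<forall>c x. cmod c \<le> e \<longrightarrow> x \<in> B \<longrightarrow> c \<odot>\<^bsub>fobj X i\<^esub> x i \<in> W i" if i: "i \<in> Ob J" for i
      using lcs.bounded_absorbed[OF object[OF i] bd[OF i] W(2)[OF i] W(3)[OF i]] by (metis imageI)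
    then obtain e where e: "\<And>i. i \<in> Ob J \<Longrightarrow> e i > (0::real)"
      "\<And>i c x. i \<in> Ob J \<Longrightarrow> cmod c \<le> e i \<Longrightarrow> x \<in> B \<Longrightarrow> c \<odot>\<^bsub>fobj X i\<^esub> x i \<in> W i"
      by metis
    define d where "d = Min (insert 1 (e ` ?K))"
    have fin: "finite (insert 1 (e ` ?K))" using W(1) by simp
    have d: "d > 0" unfolding d_def using e(1) by (subst Min_gr_iff[OF fin]) auto
    have "complex_of_real d \<odot>\<^bsub>L\<^esub> x \<in> U" if x: "x \<in> B" for x
    proof (rule W(4))
      have xL: "x \<in> carrier L" using x B by blast
      then show "complex_of_real d \<odot>\<^bsub>L\<^esub> x \<in> carrier L" by (rule L_smult_closed)
      fix i assume i: "i \<in> Ob J"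
      have "complex_of_real d \<odot>\<^bsub>fobj X i\<^esub> x i \<in> W i"
      proof (cases "i \<in> ?K")
        case True
        then have "d \<le> e i" unfolding d_def using fin by (intro Min_le) auto
        then show ?thesis using e(2)[OF i _ x] d by simp
      next
        case False
        then show ?thesis
          using i complex_space.smult_in[OF space[OF i] L_component[OF xL i]] by auto
      qed
      then show "(complex_of_real d \<odot>\<^bsub>L\<^esub> x) i \<in> W i" using i by (simp add: L_ops)
    qed
    then show "\<exists>e>0. \<forall>x\<in>B. complex_of_real e \<odot>\<^bsub>L\<^esub> x \<in> U" using d by blast
  qed
qed

lemma proj_apply: "x \<in> carrier L \<Longrightarrow> Tc_proj J X i x = x i"
  by (simp add: Tc_proj_def)

lemma proj_Tc_hom:
  assumes i: "i \<in> Ob J"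
  shows "Tc_proj J X i \<in> Tc_hom L (fobj X i)"
  unfolding Tc_hom_def
proof (intro CollectI conjI)
  show "Tc_proj J X i \<in> lin_hom L (fobj X i)"
    by (rule lin_homI)
      (use i in \<open>auto simp: proj_apply L_component L_add_closed L_smult_closed L_ops[THEN fun_cong],
        auto simp: Tc_proj_def\<close>)
  show "continuous_map (topol L) (topol (fobj X i)) (Tc_proj J X i)"
    by (rule continuous_map_eq[OF component_continuous[OF i]]) (simp add: topspace_L proj_apply)
qed

lemma proj_cone:
  assumes "a \<in> Ob J" "b \<in> Ob J" "u \<in> Hom J a b"
  shows "compose (carrier L) (farr X a b u) (Tc_proj J X a) = Tc_proj J X b"
  by (rule extensionalityI[of _ "carrier L"])
    (use assms in \<open>auto simp: compose_eq proj_apply L_iff\<close>, auto simp: Tc_proj_def)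


section \<open>The universal property\<close>

lemma IB_functor: "is_functor J IndBan (IB_diagram X)"
  unfolding is_functor_def
proof (intro conjI ballI)
  fix a assume a: "a \<in> Ob J"
  show "fobj (IB_diagram X) a \<in> Ob IndBan"
    using lcs.IB_is_ind[OF object[OF a]] by (simp add: IB_diagram_def IndBan_def)
  have "farr X a a (Idn J a) = (\<lambda>x\<in>carrier (fobj X a). x)"
    using diagram a by (simp add: is_functor_def Tc_def)
  then show "farr (IB_diagram X) a a (Idn J a) = Idn IndBan (fobj (IB_diagram X) a)"
    using IB_map_id[OF complete[OF a]] by (simp add: IB_diagram_def IndBan_def)
  fix b u assume b: "b \<in> Ob J" and u: "u \<in> Hom J a b"
  show "farr (IB_diagram X) a b u \<in> Hom IndBan (fobj (IB_diagram X) a) (fobj (IB_diagram X) b)"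
    using IB_map_ind_hom[OF complete[OF a] complete[OF b] arrow[OF a b u]]
    by (simp add: IB_diagram_def IndBan_def)
  fix c v assume c: "c \<in> Ob J" and v: "v \<in> Hom J b c"
  have "farr X a c (Cmp J a b c v u) = compose (carrier (fobj X a)) (farr X b c v) (farr X a b u)"
    using diagram a b c u v by (simp add: is_functor_def Tc_def)
  then show "farr (IB_diagram X) a c (Cmp J a b c v u) =
      Cmp IndBan (fobj (IB_diagram X) a) (fobj (IB_diagram X) b) (fobj (IB_diagram X) c)
        (farr (IB_diagram X) b c v) (farr (IB_diagram X) a b u)"
    using IB_map_comp[OF complete[OF a] complete[OF b] complete[OF c] arrow[OF a b u] arrow[OF b c v]]
    by (simp add: IB_diagram_def IndBan_def)
qed

lemma IB_limit_cone:
  "ind_cone J (IB_diagram X) (IB L) (\<lambda>i. IB_map L (fobj X i) (Tc_proj J X i))"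
  unfolding ind_cone_def
proof (intro conjI ballI)
  show "is_ind (IB L)" by (rule lcs.IB_is_ind[OF lcs.intro[OF L_lctvs]])
  show "IB_map L (fobj X i) (Tc_proj J X i) \<in> ind_hom (IB L) (fobj (IB_diagram X) i)"
    if i: "i \<in> Ob J" for i
    using IB_map_ind_hom[OF L_complete complete[OF i] proj_Tc_hom[OF i]]
    by (simp add: IB_diagram_def)
  show "ind_comp (IB L) (fobj (IB_diagram X) b) (farr (IB_diagram X) a b u)
      (IB_map L (fobj X a) (Tc_proj J X a)) = IB_map L (fobj X b) (Tc_proj J X b)"
    if "a \<in> Ob J" "b \<in> Ob J" "u \<in> Hom J a b" for a b u
    using that IB_map_comp[OF L_complete complete complete proj_Tc_hom arrow, of a b u]
    by (simp add: IB_diagram_def proj_cone)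
qed

text \<open>A compatible family of bounded maps into the spaces of the diagram is the same as one bounded
  map into their limit.\<close>

lemma bounded_maps_into_limit:
  assumes t: "\<And>i. i \<in> Ob J \<Longrightarrow> t i \<in> bounded_maps V (fobj X i)"
    and compat: "\<And>a b u x. a \<in> Ob J \<Longrightarrow> b \<in> Ob J \<Longrightarrow> u \<in> Hom J a b \<Longrightarrow> x \<in> carrier V \<Longrightarrow>
      farr X a b u (t a x) = t b x"
    and V: "complex_space V"
  shows "(\<lambda>x\<in>carrier V. \<lambda>i\<in>Ob J. t i x) \<in> bounded_maps V L" (is "?t \<in> _")
proof -
  have lin: "t i \<in> lin_hom V (fobj X i)" if "i \<in> Ob J" for i
    using t[OF that] by (simp add: bounded_maps_def)
  have tL: "(\<lambda>i\<in>Ob J. t i x) \<in> carrier L" if "x \<in> carrier V" for x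
    using that lin_homD(1)[OF lin] compat by (auto simp: L_iff)
  have "?t \<in> lin_hom V L"
  proof (rule lin_homI)
    fix x c assume x: "x \<in> carrier V"
    show "?t x \<in> carrier L" using tL[OF x] x by simp
    show "?t (c \<odot>\<^bsub>V\<^esub> x) = c \<odot>\<^bsub>L\<^esub> ?t x"
      using x lin_homD(4)[OF lin x]
      by (auto simp: L_ops complex_space.smult_in[OF V] intro!: restrict_ext)
    fix y assume y: "y \<in> carrier V"
    show "?t (x \<oplus>\<^bsub>V\<^esub> y) = ?t x \<oplus>\<^bsub>L\<^esub> ?t y"
      using x y lin_homD(3)[OF lin x y]
      by (auto simp: L_ops complex_space.add_closed[OF V] intro!: restrict_ext)
  qed simp
  moreover have "bounded_in L (?t ` {x \<in> carrier V. nrm V x \<le> 1})"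
  proof (rule bounded_in_L)
    show "?t ` {x \<in> carrier V. nrm V x \<le> 1} \<subseteq> carrier L" using tL by auto
    fix i assume i: "i \<in> Ob J"
    have "(\<lambda>x. x i) ` ?t ` {x \<in> carrier V. nrm V x \<le> 1} = t i ` {x \<in> carrier V. nrm V x \<le> 1}"
      unfolding image_image using i by (intro image_cong) auto
    then show "bounded_in (fobj X i) ((\<lambda>x. x i) ` ?t ` {x \<in> carrier V. nrm V x \<le> 1})"
      using t[OF i] by (simp add: bounded_maps_def)
  qed
  ultimately show ?thesis by (simp add: bounded_maps_def)
qed

text \<open>A cone with vertex \<open>F\<close> amounts to maps into the spaces \<open>X i\<close> from each term of \<open>F\<close>, compatible
  in \<open>i\<close>; they assemble to a bounded map \<open>t a\<close> from the \<open>a\<close>-th term into the limit, and this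
  determines a germ. The mediating morphism is unique because a vector of the limit is determined by its
  components.\<close>

lemma IB_limit_universal:
  assumes cone: "ind_cone J (IB_diagram X) F \<phi>"
  shows "\<exists>!m. m \<in> ind_hom F (IB L) \<and>
    (\<forall>i\<in>Ob J. ind_comp F (fobj (IB_diagram X) i) (IB_map L (fobj X i) (Tc_proj J X i)) m = \<phi> i)"
proof -
  have F: "is_ind F" and \<phi>: "\<And>i. i \<in> Ob J \<Longrightarrow> \<phi> i \<in> ind_hom F (IB (fobj X i))"
    and comp: "\<And>a b u. a \<in> Ob J \<Longrightarrow> b \<in> Ob J \<Longrightarrow> u \<in> Hom J a b \<Longrightarrow>
      ind_comp F (IB (fobj X b)) (IB_map (fobj X a) (fobj X b) (farr X a b u)) (\<phi> a) = \<phi> b"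
    using cone by (auto simp: ind_cone_def IB_diagram_def)
  have FL: "banach_to_lcs (fobj (dgm F) a) L" if "a \<in> Ob (idx F)" for a
    by (rule banach_to_lcsI[OF L_complete is_ind_banach[OF F that]])
  have FX: "banach_to_lcs (fobj (dgm F) a) (fobj X i)" if "i \<in> Ob J" "a \<in> Ob (idx F)" for a i
    by (rule banach_to_lcsI[OF complete[OF that(1)] is_ind_banach[OF F that(2)]])
  define t where "t a = (\<lambda>x\<in>carrier (fobj (dgm F) a). \<lambda>i\<in>Ob J.
    colim_val (fobj (dgm F) a) (fobj X i) (\<phi> i a) x)" for a
  have t: "t a \<in> bounded_maps (fobj (dgm F) a) L" if a: "a \<in> Ob (idx F)" for a
    unfolding t_def
  proof (rule bounded_maps_into_limit)
    show "colim_val (fobj (dgm F) a) (fobj X i) (\<phi> i a) \<in> bounded_maps (fobj (dgm F) a) (fobj X i)"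
      if i: "i \<in> Ob J" for i
      by (rule banach_to_lcs.colim_val_bounded[OF FX[OF i a] ind_homD(2)[OF \<phi>[OF i] a]])
    show "farr X b c u (colim_val (fobj (dgm F) a) (fobj X b) (\<phi> b a) x)
        = colim_val (fobj (dgm F) a) (fobj X c) (\<phi> c a) x"
      if b: "b \<in> Ob J" and c: "c \<in> Ob J" and u: "u \<in> Hom J b c" and x: "x \<in> carrier (fobj (dgm F) a)"
      for b c u x
      using ind_comp_IB_map(2)[OF complete[OF b] complete[OF c] F arrow[OF b c u] \<phi>[OF b] a x]
        comp[OF b c u] by simp
    show "complex_space (fobj (dgm F) a)"
      using is_ind_banach[OF F a] by (simp add: is_banach_def is_seminormed_def complex_space_def)
  qed
  have "\<exists>c. c \<in> colim_hom (fobj (dgm F) a) (IB L) \<and> colim_val (fobj (dgm F) a) L c = t a"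
    if a: "a \<in> Ob (idx F)" for a
    using banach_to_lcs.colim_val_surj[OF FL[OF a] t[OF a]] by metis
  then obtain m' where m': "\<And>a. a \<in> Ob (idx F) \<Longrightarrow> m' a \<in> colim_hom (fobj (dgm F) a) (IB L)"
    "\<And>a. a \<in> Ob (idx F) \<Longrightarrow> colim_val (fobj (dgm F) a) L (m' a) = t a"
    by metis
  define m where "m = restrict m' (Ob (idx F))"
  have m: "m \<in> ind_hom F (IB L)"
  proof (rule ind_homI[OF L_complete F])
    show "m \<in> extensional (Ob (idx F))" by (simp add: m_def)
    fix a assume a: "a \<in> Ob (idx F)"
    show "m a \<in> colim_hom (fobj (dgm F) a) (IB L)" using m' a by (simp add: m_def)
    fix b u x assume b: "b \<in> Ob (idx F)" and u: "u \<in> Hom (idx F) a b"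
      and x: "x \<in> carrier (fobj (dgm F) a)"
    have "farr (dgm F) a b u x \<in> carrier (fobj (dgm F) b)"
      using lin_homD(1)[OF Ban_hom_lin[OF is_ind_arrow[OF F a b u]] x] .
    then have "t b (farr (dgm F) a b u x) = t a x"
      using x ind_hom_compat[OF complete F \<phi> a b u x] by (auto simp: t_def intro!: restrict_ext)
    then show "colim_val (fobj (dgm F) b) L (m b) (farr (dgm F) a b u x)
        = colim_val (fobj (dgm F) a) L (m a) x"
      using m' a b by (simp add: m_def)
  qed
  have comp_val: "colim_val (fobj (dgm F) a) (fobj X i)
      (ind_comp F (IB (fobj X i)) (IB_map L (fobj X i) (Tc_proj J X i)) n a) x
      = colim_val (fobj (dgm F) a) L (n a) x i"
    if n: "n \<in> ind_hom F (IB L)" and i: "i \<in> Ob J" and a: "a \<in> Ob (idx F)"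
      and x: "x \<in> carrier (fobj (dgm F) a)" for n i a x
    using ind_comp_IB_map(2)[OF L_complete complete[OF i] F proj_Tc_hom[OF i] n a x]
      banach_to_lcs.colim_val_closed[OF FL[OF a] ind_homD(2)[OF n a] x]
    by (simp add: proj_apply)
  show ?thesis
  proof (rule ex1I[of _ m], intro conjI ballI m)
    fix i assume i: "i \<in> Ob J"
    have "ind_comp F (IB (fobj X i)) (IB_map L (fobj X i) (Tc_proj J X i)) m = \<phi> i"
    proof (rule ind_hom_eqI[OF complete[OF i] F _ \<phi>[OF i]])
      show "ind_comp F (IB (fobj X i)) (IB_map L (fobj X i) (Tc_proj J X i)) m
          \<in> ind_hom F (IB (fobj X i))"
        by (rule ind_comp_IB_map(1)[OF L_complete complete[OF i] F proj_Tc_hom[OF i] m])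
      fix a x assume a: "a \<in> Ob (idx F)" and x: "x \<in> carrier (fobj (dgm F) a)"
      show "colim_val (fobj (dgm F) a) (fobj X i)
          (ind_comp F (IB (fobj X i)) (IB_map L (fobj X i) (Tc_proj J X i)) m a) x
          = colim_val (fobj (dgm F) a) (fobj X i) (\<phi> i a) x"
        using comp_val[OF m i a x] m'(2)[OF a] a x i by (simp add: m_def t_def)
    qed
    then show "ind_comp F (fobj (IB_diagram X) i) (IB_map L (fobj X i) (Tc_proj J X i)) m = \<phi> i"
      by (simp add: IB_diagram_def)
  next
    fix n assume "n \<in> ind_hom F (IB L) \<and> (\<forall>i\<in>Ob J.
      ind_comp F (fobj (IB_diagram X) i) (IB_map L (fobj X i) (Tc_proj J X i)) n = \<phi> i)"
    then have n: "n \<in> ind_hom F (IB L)"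
      and nc: "\<And>i. i \<in> Ob J \<Longrightarrow> ind_comp F (IB (fobj X i)) (IB_map L (fobj X i) (Tc_proj J X i)) n = \<phi> i"
      by (auto simp: IB_diagram_def)
    show "n = m"
    proof (rule ind_hom_eqI[OF L_complete F n m])
      fix a x assume a: "a \<in> Ob (idx F)" and x: "x \<in> carrier (fobj (dgm F) a)"
      show "colim_val (fobj (dgm F) a) L (n a) x = colim_val (fobj (dgm F) a) L (m a) x"
      proof (rule L_eqI)
        show "colim_val (fobj (dgm F) a) L (n a) x \<in> carrier L"
          "colim_val (fobj (dgm F) a) L (m a) x \<in> carrier L"
          using banach_to_lcs.colim_val_closed[OF FL[OF a] _ x] ind_homD(2)[OF n a] ind_homD(2)[OF m a]
          by auto
        fix i assume i: "i \<in> Ob J"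
        show "colim_val (fobj (dgm F) a) L (n a) x i = colim_val (fobj (dgm F) a) L (m a) x i"
          using comp_val[OF n i a x] nc[OF i] m'(2)[OF a] a x i by (simp add: m_def t_def)
      qed
    qed
  qed
qed

end

theorem corollary1p7:
  fixes I :: "('i, 'm) cat"
    and X :: "('i, 'm, 'a lctvs, 'a \<Rightarrow> 'a) func"
  assumes "category I"
    and "is_functor (op_cat I) Tc X"
    and "\<And>i. i \<in> Ob I \<Longrightarrow> complete_lctvs (fobj X i)"
  shows "ind_limit TYPE(('p, 'q, 'b) ind) (op_cat I) (IB_diagram X)
           (IB (Tc_lim (op_cat I) X))
           (\<lambda>i. IB_map (Tc_lim (op_cat I) X) (fobj X i) (Tc_proj (op_cat I) X i))"
proof -
  interpret complete_diagram "op_cat I" X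
  proof (rule complete_diagram.intro)
    show "is_functor (op_cat I) Tc X" by (rule assms(2))
    fix i assume i: "i \<in> Ob (op_cat I)"
    show "complete_lcs (fobj X i)"
    proof (rule complete_lcsI)
      show "is_lctvs (fobj X i)" using assms(2) i by (simp add: is_functor_def Tc_def)
      show "complete_lctvs (fobj X i)" using assms(3) i by (simp add: op_cat_def)
    qed
  qed
  show ?thesis
    unfolding ind_limit_def using IB_functor IB_limit_cone IB_limit_universal by blast
qed

end
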